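(* Let $\mathbb{k}$ be a field and let $M\in\mathrm{rep}(\mathbb{Z}^2)$. Then, as multisets of elements of $\mathbb{Z}^2$ (functions $\mathbb{Z}^2\to\mathbb{N}$), \begin{align*} \beta_0^M&=\mathrm{convex}(\mathrm{dec}\,C_{xy}M),\\ \beta_1^M&=\mathrm{convex}^\vee(\mathrm{dec}\,K_{xy}M)+\mathrm{concave}^\vee(\mathrm{dec}\,C_{xy}M)+\mathrm{dec}\,TL(M)+\mathrm{dec}\,BR(M),\\ \beta_2^M&=\mathrm{concave}(\mathrm{dec}\,K_{xy}M). \end{align*} Moreover, $TL(M)\cong TL(C_{xy}M)$ and $BR(M)\cong BR(C_{xy}M)$, so the Betti tables of $M$ only depend on the isomorphism types of $C_{xy}M$ and $K_{xy}M$ (that is, on the birth-curves and death-curves of $M$).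
   Context: $\mathrm{rep}(\mathbb{Z}^2)$ is the category of functors from $\mathbb{Z}^2$ (product order) to finite dimensional $\mathbb{k}$-vector spaces, identified with pointwise finite dimensional bigraded $\mathbb{k}[\mathbf{x},\mathbf{y}]$-modules ($\mathbf{x}:M_i\to M_{i+(1,0)}$ and $\mathbf{y}:M_i\to M_{i+(0,1)}$ being structure maps). Shift: $M[a]_i=M_{i+a}$. Define $K_{xy}M$ and $C_{xy}M$ as the kernel and cokernel of $\mathbf{x}\mathbf{y}:M[-1,-1]\to M$; $K_xM$ and $C_xM$ as the kernel and cokernel of $\mathbf{x}:M[-1,0]\to M$; $K_yM$ and $C_yM$ as the kernel and cokernel of $\mathbf{y}:M[0,-1]\to M$. Define $$TL(M)=\mathrm{im}\big(K_yM\hookrightarrow M[0,-1]\twoheadrightarrow (C_xM)[0,-1]\big),\qquad BR(M)=\mathrm{im}\big(K_xM\hookrightarrow M[-1,0]\twoheadrightarrow (C_yM)[-1,0]\big).$$ A spread curve is a non-empty subset $I\subseteq\mathbb{Z}^2$ that is poset-connected, poset-convex, and such that $p\in I$ implies $p+(1,1)\notin I$; $\mathbb{k}_I$ denotes the representation that is $\mathbb{k}$ on $I$, $0$ elsewhere, with identity structure maps within $I$. The modules $K_{xy}M$ and $C_{xy}M$ are annihilated by $\mathbf{x}\mathbf{y}$ and decompose essentially uniquely as direct sums of representations $\mathbb{k}_I$ with $I$ a spread curve; $\mathrm{dec}$ denotes the resulting multiset of spread curves (for $C_{xy}M$: the birth-curves of $M$; for $K_{xy}M$: the death-curves of $M$).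 $TL(M)$ and $BR(M)$ are annihilated by $\mathbf{x}$ and $\mathbf{y}$, so $\mathrm{dec}\,TL(M)$ and $\mathrm{dec}\,BR(M)$ are multisets of points of $\mathbb{Z}^2$ (given by the dimension functions). For a spread curve $I$ and $i\in I$: $i$ is a convex corner if $i-(1,0)\notin I$ and $i-(0,1)\notin I$; an inner convex corner if $i+(1,0)\in I$ and $i+(0,1)\in I$; a concave corner if $i+(1,0)\notin I$ and $i+(0,1)\notin I$; an inner concave corner if $i-(1,0)\in I$ and $i-(0,1)\in I$. The corresponding sets are $\mathrm{convex}(I)$, $\mathrm{convex}^\vee(I)$, $\mathrm{concave}(I)$, $\mathrm{concave}^\vee(I)$; applied to a multiset of spread curves, they denote the multiset sum over its members. The Betti tables are $\beta_i^M(p)=\dim H_i(K(M))_p$, $i=0,1,2$, $p\in\mathbb{Z}^2$, where $K(M)$ is the Koszul complex $$0\to M[-1,-1]\xrightarrow{[\mathbf{y},-\mathbf{x}]^T}M[-1,0]\oplus M[0,-1]\xrightarrow{[\mathbf{x},\mathbf{y}]}M\to 0,$$ with $M$ in homological degree $0$. *)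

theory Defs
  imports
    "Jordan_Normal_Form.Missing_VectorSpace"
    "HOL-Algebra.AbelCoset"
    "HOL-Library.Product_Plus"
    "HOL-Library.Product_Order"
begin

section \<open>Pointwise finite dimensional representations of the poset \<open>\<int>\<^sup>2\<close>\<close>

text \<open>The order on \<open>int \<times> int\<close> is the product order and addition is componentwise.\<close>

type_synonym point = "int \<times> int"

record ('k, 'v) rep =
  spc :: "point \<Rightarrow> ('k, 'v) module"
  tr :: "point \<Rightarrow> point \<Rightarrow> 'v \<Rightarrow> 'v"

text \<open>The maps \<open>tr M p q\<close> are only relevant for \<open>p \<le> q\<close>, and only on the carrier at \<open>p\<close>.\<close>

definition pfd_rep :: "('k, 'm) ring_scheme \<Rightarrow> ('k, 'v) rep \<Rightarrow> bool" where
  "pfd_rep K M \<longleftrightarrow>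
     (\<forall>p. vectorspace K (spc M p) \<and> vectorspace.fin_dim K (spc M p)) \<and>
     (\<forall>p q. p \<le> q \<longrightarrow> tr M p q \<in> module_hom K (spc M p) (spc M q)) \<and>
     (\<forall>p. \<forall>v \<in> carrier (spc M p). tr M p p v = v) \<and>
     (\<forall>p q r. p \<le> q \<longrightarrow> q \<le> r \<longrightarrow>
        (\<forall>v \<in> carrier (spc M p). tr M q r (tr M p q v) = tr M p r v))"

definition rep_hom ::
  "('k, 'm) ring_scheme \<Rightarrow> ('k, 'v) rep \<Rightarrow> ('k, 'w) rep \<Rightarrow> (point \<Rightarrow> 'v \<Rightarrow> 'w) set" where
  "rep_hom K M N = {f.
     (\<forall>p. f p \<in> module_hom K (spc M p) (spc N p)) \<and>
     (\<forall>p q. p \<le> q \<longrightarrow> (\<forall>v \<in> carrier (spc M p). f q (tr M p q v) = tr N p q (f p v)))}"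

definition rep_iso :: "('k, 'm) ring_scheme \<Rightarrow> ('k, 'v) rep \<Rightarrow> ('k, 'w) rep \<Rightarrow> bool" where
  "rep_iso K M N \<longleftrightarrow>
     (\<exists>f \<in> rep_hom K M N. \<forall>p. bij_betw (f p) (carrier (spc M p)) (carrier (spc N p)))"

definition shift :: "point \<Rightarrow> ('k, 'v) rep \<Rightarrow> ('k, 'v) rep" where
  "shift a M = \<lparr>spc = (\<lambda>p. spc M (p + a)), tr = (\<lambda>p q. tr M (p + a) (q + a))\<rparr>"


section \<open>Kernels, images, quotients and direct sums\<close>

definition sub_rep :: "('k, 'v) rep \<Rightarrow> (point \<Rightarrow> 'v set) \<Rightarrow> ('k, 'v) rep" where
  "sub_rep M U = \<lparr>spc = (\<lambda>p. (spc M p)\<lparr>carrier := U p\<rparr>), tr = tr M\<rparr>"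

definition ker_rep :: "('k, 'v) rep \<Rightarrow> ('k, 'w) rep \<Rightarrow> (point \<Rightarrow> 'v \<Rightarrow> 'w) \<Rightarrow> ('k, 'v) rep" where
  "ker_rep M N f = sub_rep M (\<lambda>p. {v \<in> carrier (spc M p). f p v = \<zero>\<^bsub>spc N p\<^esub>})"

definition im_rep :: "('k, 'v) rep \<Rightarrow> ('k, 'w) rep \<Rightarrow> (point \<Rightarrow> 'v \<Rightarrow> 'w) \<Rightarrow> ('k, 'w) rep" where
  "im_rep M N f = sub_rep N (\<lambda>p. f p ` carrier (spc M p))"

text \<open>
  The quotient space \<open>V / U\<close> on the set of cosets of \<open>U\<close>. The components \<open>mult\<close> and \<open>one\<close>
  inherited from the ring record play no role in a module.
\<close>

definition quot_module :: "('k, 'v) module \<Rightarrow> 'v set \<Rightarrow> ('k, 'v set) module" where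
  "quot_module V U =
     \<lparr>carrier = a_rcosets\<^bsub>V\<^esub> U, mult = (\<lambda>X Y. U), one = U, zero = U, add = set_add V,
      smult = (\<lambda>c X. \<Union>x\<in>X. U +>\<^bsub>V\<^esub> (c \<odot>\<^bsub>V\<^esub> x))\<rparr>"

definition quot_rep :: "('k, 'v) rep \<Rightarrow> (point \<Rightarrow> 'v set) \<Rightarrow> ('k, 'v set) rep" where
  "quot_rep M U =
     \<lparr>spc = (\<lambda>p. quot_module (spc M p) (U p)),
      tr = (\<lambda>p q X. \<Union>x\<in>X. U q +>\<^bsub>spc M q\<^esub> (tr M p q x))\<rparr>"

definition coker_rep ::
  "('k, 'v) rep \<Rightarrow> ('k, 'w) rep \<Rightarrow> (point \<Rightarrow> 'v \<Rightarrow> 'w) \<Rightarrow> ('k, 'w set) rep" where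
  "coker_rep M N f = quot_rep N (\<lambda>p. f p ` carrier (spc M p))"

definition coker_proj ::
  "('k, 'v) rep \<Rightarrow> ('k, 'w) rep \<Rightarrow> (point \<Rightarrow> 'v \<Rightarrow> 'w) \<Rightarrow> point \<Rightarrow> 'w \<Rightarrow> 'w set" where
  "coker_proj M N f p w = (f p ` carrier (spc M p)) +>\<^bsub>spc N p\<^esub> w"

definition prod_rep :: "('k, 'v) rep \<Rightarrow> ('k, 'w) rep \<Rightarrow> ('k, 'v \<times> 'w) rep" where
  "prod_rep M N =
     \<lparr>spc = (\<lambda>p. direct_sum (spc M p) (spc N p)),
      tr = (\<lambda>p q. map_prod (tr M p q) (tr N p q))\<rparr>"

text \<open>The direct sum of a family indexed by \<open>J\<close>: families of finite support.\<close>

definition sum_module :: "'j set \<Rightarrow> ('j \<Rightarrow> ('k, 'v) module) \<Rightarrow> ('k, 'j \<Rightarrow> 'v) module" where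
  "sum_module J V =
     \<lparr>carrier = {f \<in> (\<Pi>\<^sub>E j\<in>J. carrier (V j)). finite {j \<in> J. f j \<noteq> \<zero>\<^bsub>V j\<^esub>}},
      mult = (\<lambda>f g. \<lambda>j\<in>J. \<zero>\<^bsub>V j\<^esub>),
      one = (\<lambda>j\<in>J. \<zero>\<^bsub>V j\<^esub>),
      zero = (\<lambda>j\<in>J. \<zero>\<^bsub>V j\<^esub>),
      add = (\<lambda>f g. \<lambda>j\<in>J. f j \<oplus>\<^bsub>V j\<^esub> g j),
      smult = (\<lambda>c f. \<lambda>j\<in>J. c \<odot>\<^bsub>V j\<^esub> f j)\<rparr>"

definition sum_rep :: "'j set \<Rightarrow> ('j \<Rightarrow> ('k, 'v) rep) \<Rightarrow> ('k, 'j \<Rightarrow> 'v) rep" where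
  "sum_rep J R =
     \<lparr>spc = (\<lambda>p. sum_module J (\<lambda>j. spc (R j) p)),
      tr = (\<lambda>p q f. \<lambda>j\<in>J. tr (R j) p q (f j))\<rparr>"


section \<open>Kernel and cokernel modules of multiplication by monomials\<close>

text \<open>
  \<open>mon a M\<close> is multiplication by the monomial of degree \<open>a\<close>, as a morphism from \<open>shift (- a) M\<close>
  to \<open>M\<close>.
\<close>

definition mon :: "point \<Rightarrow> ('k, 'v) rep \<Rightarrow> point \<Rightarrow> 'v \<Rightarrow> 'v" where
  "mon a M p = tr M (p - a) p"

definition Kmon :: "point \<Rightarrow> ('k, 'v) rep \<Rightarrow> ('k, 'v) rep" where
  "Kmon a M = ker_rep (shift (- a) M) M (mon a M)"

definition Cmon :: "point \<Rightarrow> ('k, 'v) rep \<Rightarrow> ('k, 'v set) rep" where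
  "Cmon a M = coker_rep (shift (- a) M) M (mon a M)"

abbreviation "K_xy \<equiv> Kmon (1, 1)"
abbreviation "C_xy \<equiv> Cmon (1, 1)"
abbreviation "K_x \<equiv> Kmon (1, 0)"
abbreviation "C_x \<equiv> Cmon (1, 0)"
abbreviation "K_y \<equiv> Kmon (0, 1)"
abbreviation "C_y \<equiv> Cmon (0, 1)"

definition TL :: "('k, 'v) rep \<Rightarrow> ('k, 'v set) rep" where
  "TL M = im_rep (K_y M) (shift (0, - 1) (C_x M))
     (\<lambda>p. coker_proj (shift (- (1, 0)) M) M (mon (1, 0) M) (p + (0, - 1)))"

definition BR :: "('k, 'v) rep \<Rightarrow> ('k, 'v set) rep" where
  "BR M = im_rep (K_x M) (shift (- 1, 0) (C_y M))
     (\<lambda>p. coker_proj (shift (- (0, 1)) M) M (mon (0, 1) M) (p + (- 1, 0)))"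


section \<open>Spread curves and the decomposition multiset\<close>

definition poset_connected :: "point set \<Rightarrow> bool" where
  "poset_connected I \<longleftrightarrow>
     (\<forall>p\<in>I. \<forall>q\<in>I. (\<lambda>a b. a \<in> I \<and> b \<in> I \<and> (a \<le> b \<or> b \<le> a))\<^sup>*\<^sup>* p q)"

definition poset_convex :: "point set \<Rightarrow> bool" where
  "poset_convex I \<longleftrightarrow> (\<forall>p\<in>I. \<forall>r\<in>I. \<forall>q. p \<le> q \<and> q \<le> r \<longrightarrow> q \<in> I)"

definition spread_curve :: "point set \<Rightarrow> bool" where
  "spread_curve I \<longleftrightarrow>
     I \<noteq> {} \<and> poset_connected I \<and> poset_convex I \<and> (\<forall>p\<in>I. p + (1, 1) \<notin> I)"

definition curve_rep :: "'k ring \<Rightarrow> point set \<Rightarrow> ('k, 'k) rep" where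
  "curve_rep K I =
     \<lparr>spc = (\<lambda>p. \<lparr>carrier = (if p \<in> I then carrier K else {\<zero>\<^bsub>K\<^esub>}),
                   mult = mult K, one = one K, zero = zero K, add = add K, smult = mult K\<rparr>),
      tr = (\<lambda>p q v. if p \<in> I \<and> q \<in> I then v else \<zero>\<^bsub>K\<^esub>)\<rparr>"

text \<open>
  A multiset of spread curves is a multiplicity function; the library type of multisets is
  restricted to finite ones, whereas a pointwise finite dimensional representation may have
  infinitely many summands. The index \<open>(I, n)\<close> with \<open>n < D I\<close> stands for the \<open>n\<close>-th copy of \<open>I\<close>.
\<close>

definition is_curve_decomposition :: "'k ring \<Rightarrow> ('k, 'v) rep \<Rightarrow> (point set \<Rightarrow> nat) \<Rightarrow> bool" where
  "is_curve_decomposition K N D \<longleftrightarrow>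
     (\<forall>I. D I \<noteq> 0 \<longrightarrow> spread_curve I) \<and>
     rep_iso K N (sum_rep {(I, n). n < D I} (\<lambda>(I, n). curve_rep K I))"

definition dec :: "'k ring \<Rightarrow> ('k, 'v) rep \<Rightarrow> point set \<Rightarrow> nat" where
  "dec K N = (SOME D. is_curve_decomposition K N D)"

text \<open>
  For a representation annihilated by both variables, the multiset of points is its dimension
  function.
\<close>

definition dec_points :: "('k, 'm) ring_scheme \<Rightarrow> ('k, 'v) rep \<Rightarrow> point \<Rightarrow> nat" where
  "dec_points K N p = vectorspace.dim K (spc N p)"


section \<open>Corners\<close>

definition convex_corners :: "point set \<Rightarrow> point set" where
  "convex_corners I = {i \<in> I. i - (1, 0) \<notin> I \<and> i - (0, 1) \<notin> I}"

definition inner_convex_corners :: "point set \<Rightarrow> point set" where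
  "inner_convex_corners I = {i \<in> I. i + (1, 0) \<in> I \<and> i + (0, 1) \<in> I}"

definition concave_corners :: "point set \<Rightarrow> point set" where
  "concave_corners I = {i \<in> I. i + (1, 0) \<notin> I \<and> i + (0, 1) \<notin> I}"

definition inner_concave_corners :: "point set \<Rightarrow> point set" where
  "inner_concave_corners I = {i \<in> I. i - (1, 0) \<in> I \<and> i - (0, 1) \<in> I}"

text \<open>
  The multiset sum of \<open>c I\<close> over the members \<open>I\<close> of \<open>D\<close>. The range of summation is finite
  whenever \<open>D\<close> decomposes a pointwise finite dimensional representation, since each point then
  lies on finitely many members.
\<close>

definition corner_sum :: "(point set \<Rightarrow> point set) \<Rightarrow> (point set \<Rightarrow> nat) \<Rightarrow> point \<Rightarrow> nat" where
  "corner_sum c D p = (\<Sum>I | D I \<noteq> 0 \<and> p \<in> c I. D I)"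


section \<open>Koszul complex and Betti tables\<close>

definition Kos1 :: "('k, 'v) rep \<Rightarrow> ('k, 'v \<times> 'v) rep" where
  "Kos1 M = prod_rep (shift (- 1, 0) M) (shift (0, - 1) M)"

definition Kos2 :: "('k, 'v) rep \<Rightarrow> ('k, 'v) rep" where
  "Kos2 M = shift (- 1, - 1) M"

text \<open>
  The differential \<open>Kos2 M \<rightarrow> Kos1 M\<close> with matrix \<open>[y, - x]\<^sup>T\<close>, and the differential
  \<open>Kos1 M \<rightarrow> M\<close> with matrix \<open>[x, y]\<close>.
\<close>

definition kos_d2 :: "('k, 'v) rep \<Rightarrow> point \<Rightarrow> 'v \<Rightarrow> 'v \<times> 'v" where
  "kos_d2 M p v =
     (tr M (p - (1, 1)) (p - (1, 0)) v,
      \<ominus>\<^bsub>spc M (p - (0, 1))\<^esub> tr M (p - (1, 1)) (p - (0, 1)) v)"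

definition kos_d1 :: "('k, 'v) rep \<Rightarrow> point \<Rightarrow> 'v \<times> 'v \<Rightarrow> 'v" where
  "kos_d1 M p = (\<lambda>(u, v). tr M (p - (1, 0)) p u \<oplus>\<^bsub>spc M p\<^esub> tr M (p - (0, 1)) p v)"

definition kos_H0 :: "('k, 'v) rep \<Rightarrow> ('k, 'v set) rep" where
  "kos_H0 M = coker_rep (Kos1 M) M (kos_d1 M)"

definition kos_H1 :: "('k, 'v) rep \<Rightarrow> ('k, ('v \<times> 'v) set) rep" where
  "kos_H1 M = quot_rep (ker_rep (Kos1 M) M (kos_d1 M))
     (\<lambda>p. kos_d2 M p ` carrier (spc (Kos2 M) p))"

definition kos_H2 :: "('k, 'v) rep \<Rightarrow> ('k, 'v) rep" where
  "kos_H2 M = ker_rep (Kos2 M) (Kos1 M) (kos_d2 M)"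

definition betti0 :: "('k, 'm) ring_scheme \<Rightarrow> ('k, 'v) rep \<Rightarrow> point \<Rightarrow> nat" where
  "betti0 K M p = vectorspace.dim K (spc (kos_H0 M) p)"

definition betti1 :: "('k, 'm) ring_scheme \<Rightarrow> ('k, 'v) rep \<Rightarrow> point \<Rightarrow> nat" where
  "betti1 K M p = vectorspace.dim K (spc (kos_H1 M) p)"

definition betti2 :: "('k, 'm) ring_scheme \<Rightarrow> ('k, 'v) rep \<Rightarrow> point \<Rightarrow> nat" where
  "betti2 K M p = vectorspace.dim K (spc (kos_H2 M) p)"

end

(*
  All Betti numbers at p, the dimensions of TL and BR, and the corner counts are dimensions that
  can be read off the commutative square M(p - (1,1)), M(p - (1,0)), M(p - (0,1)), M(p), and the
  formulas then follow from rank-nullity. The corner counts enter through a decomposition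
  N = sum of k_I: subspaces such as im x, ker y and their intersections consist of the vectors
  supported on a set of curves, so their dimensions count curves.

  What needs an argument is that a pointwise finite dimensional N annihilated by xy does decompose
  into spread curves. Such curves run from left to right through the layers p_1 - p_2 = t, along x
  or backwards along y. The subspaces of N_p obtained from 0 and N_p by images under y and preimages
  under x form a chain, since im y is contained in ker x; by finite dimension, no limits along
  infinite curves are needed. A basis adapted to these chains on one layer extends to an adapted
  basis on the next layer such that x and y map basis vectors to basis vectors or 0. Starting at
  layer 0 with a basis adapted to the two chains coming from the right and from the left, one obtains
  compatible bases on all layers, whose connected components are the curves.
*)

theory Submission
  imports Defs
begin

section \<open>Dimensions of subspaces\<close>

text \<open>Two chains of subspaces always have a common adapted basis, whereas three need not. This
  is why the construction starts on a single layer, where exactly two chains meet, and leaves it in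
  either direction with only one chain left to respect. Adaptedness survives each step because the
  flags at a new point pull back along x and push forward along y to flags at its two neighbours on
  the previous layer.

  The four terms of the first Betti number are the graded pieces of a filtration of H_1. Sending (u,
  v) to xu maps the cycles onto im x \<inter> im y, and modulo im(xy) this gives the inner concave
  corners of the birth-curves. What remains is ker x \<oplus> ker y modulo the pairs (yv, -xv) with
  v in ker(xy). Dividing ker x and ker y by their parts in im y and im x gives BR and TL, and the
  rest is ker(xy) / (ker x + ker y), counted by the inner convex corners of the death-curves.

  The formulas are proved for an arbitrary curve decomposition, hence for the one that
  \<open>dec\<close> selects.\<close>

abbreviation sdim ::
  "('k, 'm) ring_scheme \<Rightarrow> ('k, 'v, 'd) module_scheme \<Rightarrow> 'v set \<Rightarrow> nat" where
  "sdim K V U \<equiv> vectorspace.dim K (V\<lparr>carrier := U\<rparr>)"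

lemma linear_mapI:
  assumes "vectorspace K V" "vectorspace K W" "T \<in> module_hom K V W"
  shows "linear_map K V W T"
  using assms unfolding linear_map_def mod_hom_def mod_hom_axioms_def
  by (simp add: vectorspace_def)

lemma module_hom_comp:
  assumes "S \<in> module_hom K V W" "T \<in> module_hom K W X"
  shows "(\<lambda>v. T (S v)) \<in> module_hom K V X"
  using assms unfolding module_hom_def by (auto simp: Pi_iff)

lemma module_hom_restrict:
  assumes "T \<in> module_hom K V W" "U \<subseteq> carrier V"
  shows "T \<in> module_hom K (V\<lparr>carrier := U\<rparr>) W"
  using assms unfolding module_hom_def by (auto simp: Pi_iff subset_iff)

lemma module_hom_corestrict:
  assumes "T \<in> module_hom K V W" "T ` carrier V \<subseteq> U"
  shows "T \<in> module_hom K V (W\<lparr>carrier := U\<rparr>)"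
  using assms unfolding module_hom_def by (auto simp: Pi_iff subset_iff)

text \<open>Closure of \<open>V\<close> is all that is assumed, so that the lemma also applies to
  direct sums of curve representations, for which only closure is established below.\<close>

lemma module_hom_inv:
  assumes V: "\<And>v w. v \<in> carrier V \<Longrightarrow> w \<in> carrier V \<Longrightarrow> v \<oplus>\<^bsub>V\<^esub> w \<in> carrier V"
    "\<And>c v. c \<in> carrier K \<Longrightarrow> v \<in> carrier V \<Longrightarrow> c \<odot>\<^bsub>V\<^esub> v \<in> carrier V"
    and T: "T \<in> module_hom K V W"
    and bij: "bij_betw T (carrier V) (carrier W)"
  shows "inv_into (carrier V) T \<in> module_hom K W V"
proof -
  let ?S = "inv_into (carrier V) T"
  have S: "?S w \<in> carrier V" "T (?S w) = w" if "w \<in> carrier W" for w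
    using that bij by (auto simp: bij_betw_def inv_into_into f_inv_into_f)
  have S': "?S (T v) = v" if "v \<in> carrier V" for v
    using that bij by (auto simp: bij_betw_def)
  have add: "?S (v \<oplus>\<^bsub>W\<^esub> w) = ?S v \<oplus>\<^bsub>V\<^esub> ?S w" if "v \<in> carrier W" "w \<in> carrier W" for v w
  proof -
    have "v \<oplus>\<^bsub>W\<^esub> w = T (?S v \<oplus>\<^bsub>V\<^esub> ?S w)"
      using S V that by (simp add: module_hom_add[OF T])
    then show ?thesis using S' S V that by simp
  qed
  have smult: "?S (c \<odot>\<^bsub>W\<^esub> w) = c \<odot>\<^bsub>V\<^esub> ?S w" if "c \<in> carrier K" "w \<in> carrier W" for c w
  proof -
    have "c \<odot>\<^bsub>W\<^esub> w = T (c \<odot>\<^bsub>V\<^esub> ?S w)"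
      using S V that by (simp add: module_hom_smult[OF T])
    then show ?thesis using S' S V that by simp
  qed
  show ?thesis
    unfolding module_hom_def using S add smult by auto
qed

section \<open>Subspaces of a fixed vector space and their dimensions\<close>

context vectorspace
begin

lemma subspaceI:
  assumes "U \<subseteq> carrier V" "\<zero>\<^bsub>V\<^esub> \<in> U" "\<And>u w. u \<in> U \<Longrightarrow> w \<in> U \<Longrightarrow> u \<oplus>\<^bsub>V\<^esub> w \<in> U"
    "\<And>c u. c \<in> carrier K \<Longrightarrow> u \<in> U \<Longrightarrow> c \<odot>\<^bsub>V\<^esub> u \<in> U"
  shows "subspace K U V"
  unfolding subspace_def submodule_def using assms vectorspace_axioms module_axioms by auto

lemma subspace_carrier: "subspace K U V \<Longrightarrow> U \<subseteq> carrier V"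
  by (simp add: subspace_def submodule_def)

lemma subspace_zero: "subspace K U V \<Longrightarrow> \<zero>\<^bsub>V\<^esub> \<in> U"
  by (simp add: subspace_def submodule_def)

lemma subspace_add: "subspace K U V \<Longrightarrow> u \<in> U \<Longrightarrow> w \<in> U \<Longrightarrow> u \<oplus>\<^bsub>V\<^esub> w \<in> U"
  by (simp add: subspace_def submodule_def)

lemma subspace_smult: "subspace K U V \<Longrightarrow> c \<in> carrier K \<Longrightarrow> u \<in> U \<Longrightarrow> c \<odot>\<^bsub>V\<^esub> u \<in> U"
  by (simp add: subspace_def submodule_def)

lemma subspace_neg:
  assumes "subspace K U V" "u \<in> U"
  shows "\<ominus>\<^bsub>V\<^esub> u \<in> U"
proof -
  have "\<ominus>\<^bsub>K\<^esub> \<one>\<^bsub>K\<^esub> \<odot>\<^bsub>V\<^esub> u \<in> U"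
    using assms by (intro subspace_smult) auto
  then show ?thesis
    using assms subspace_carrier by (metis smult_minus_1 subsetD)
qed

lemma subspace_minus:
  "subspace K U V \<Longrightarrow> u \<in> U \<Longrightarrow> w \<in> U \<Longrightarrow> u \<ominus>\<^bsub>V\<^esub> w \<in> U"
  unfolding a_minus_def by (intro subspace_add subspace_neg)

lemma subspace_carrier_self: "subspace K (carrier V) V"
  by (rule subspaceI) auto

lemma subspace_trivial: "subspace K {\<zero>\<^bsub>V\<^esub>} V"
  by (rule subspaceI) auto

lemma subspace_Int: "subspace K U V \<Longrightarrow> subspace K W V \<Longrightarrow> subspace K (U \<inter> W) V"
  by (rule subspaceI)
    (auto dest: subspace_carrier subspace_zero intro: subspace_add subspace_smult)

lemma mem_sum_iff: "v \<in> subspace_sum U W \<longleftrightarrow> (\<exists>u\<in>U. \<exists>w\<in>W. v = u \<oplus>\<^bsub>V\<^esub> w)"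
  unfolding submodule_sum_def by auto

text \<open>Independence in \<open>U\<close> is independence in \<open>V\<close>, so independent
  subsets of \<open>U\<close> have at most \<open>dim\<close> elements; hence a maximal one exists,
  and it is a basis of \<open>U\<close>.\<close>

lemma
  assumes "fin_dim" "subspace K U V"
  shows subspace_fin_dim: "vectorspace.fin_dim K (vs U)"
    and sdim_le_dim: "sdim K V U \<le> dim"
proof -
  interpret U: vectorspace K "vs U" by (rule subspace_is_vs) fact
  have sub: "U \<subseteq> carrier V" using assms subspace_carrier by auto
  have li: "U.lin_dep A = lin_dep A" if "A \<subseteq> U" for A
    using span_li_not_depend(2)[of A U] that assms by simp
  have "\<exists>A. finite A \<and> maximal A (\<lambda>S. S \<subseteq> carrier (vs U) \<and> U.lin_indpt S)"
  proof (rule maximal_exists[where N = dim and B = "{}"])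
    show "{} \<subseteq> carrier (vs U) \<and> U.lin_indpt {}"
      unfolding U.lin_dep_def by auto
    fix A assume "A \<subseteq> carrier (vs U) \<and> U.lin_indpt A"
    then have "A \<subseteq> carrier V" "lin_indpt A" using sub li by auto
    then show "finite A \<and> card A \<le> dim"
      using li_le_dim[OF assms(1)] by auto
  qed
  then obtain A where A: "finite A" "maximal A (\<lambda>S. S \<subseteq> carrier (vs U) \<and> U.lin_indpt S)"
    by auto
  then have "U.basis A" by (intro U.max_li_is_basis)
  then show "U.fin_dim"
    unfolding U.fin_dim_def U.basis_def using A by auto
  have "A \<subseteq> carrier V" "lin_indpt A" using A sub li unfolding maximal_def by auto
  then show "U.dim \<le> dim"
    using U.dim_basis[OF A(1) \<open>U.basis A\<close>] li_le_dim[OF assms(1)] by auto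
qed

lemma nested_subspace:
  assumes "subspace K W V" "subspace K U V" "U \<subseteq> W"
  shows "subspace K U (vs W)"
  using vectorspace.subspaceI[OF subspace_is_vs[OF assms(1)], of U] assms
  by (simp add: subspace_zero subspace_add subspace_smult)

lemma sdim_zero: "sdim K V {\<zero>\<^bsub>V\<^esub>} = 0"
proof -
  interpret Z: vectorspace K "vs {\<zero>\<^bsub>V\<^esub>}"
    by (rule subspace_is_vs[OF subspace_trivial])
  have "Z.span {\<zero>\<^bsub>V\<^esub>} = {\<zero>\<^bsub>V\<^esub>}"
    using Z.span_is_subset2[of "{\<zero>\<^bsub>V\<^esub>}"] Z.span_zero[of "{\<zero>\<^bsub>V\<^esub>}"] by auto
  then show ?thesis using Z.dim0I by simp
qed

lemma sdim_mono:
  assumes "fin_dim" "subspace K U V" "subspace K W V" "U \<subseteq> W"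
  shows "sdim K V U \<le> sdim K V W"
  using vectorspace.sdim_le_dim[OF subspace_is_vs[OF assms(3)] subspace_fin_dim[OF assms(1,3)]
      nested_subspace[OF assms(3,2,4)]] by simp

lemma subspace_eq_carrier:
  assumes "fin_dim" "subspace K U V" "sdim K V U = dim"
  shows "U = carrier V"
proof -
  interpret U: vectorspace K "vs U" by (rule subspace_is_vs) fact
  have sub: "U \<subseteq> carrier V" using assms subspace_carrier by auto
  obtain A where A: "finite A" "U.basis A"
    using U.finite_basis_exists subspace_fin_dim[OF assms(1,2)] by auto
  have card: "card A = dim" using U.dim_basis[OF A] assms by simp
  have AU: "A \<subseteq> U" "U.lin_indpt A" "U.span A = U" using A unfolding U.basis_def by auto
  have "lin_indpt A" "span A = U"
    using span_li_not_depend[of A U] AU assms by auto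
  then have "basis A"
    using dim_li_is_basis[OF assms(1) A(1)] AU sub card by auto
  then show ?thesis
    using \<open>span A = U\<close> unfolding basis_def by simp
qed

text \<open>For members of a chain this turns a comparison of dimensions into an inclusion: a member
  of least dimension with some property lies in all other members with that property.\<close>

lemma subspace_eqI:
  assumes "fin_dim" "subspace K U V" "subspace K W V" "U \<subseteq> W" "sdim K V W \<le> sdim K V U"
  shows "U = W"
proof -
  have "sdim K V U = sdim K V W"
    using sdim_mono[OF assms(1-4)] assms(5) by simp
  then show ?thesis
    using vectorspace.subspace_eq_carrier[OF subspace_is_vs[OF assms(3)]
        subspace_fin_dim[OF assms(1,3)] nested_subspace[OF assms(3,2,4)]] by simp
qed

end

section \<open>Linear maps on subspaces and rank-nullity\<close>

lemma hom_zero: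
  assumes "vectorspace K V" "vectorspace K W" "T \<in> module_hom K V W"
  shows "T \<zero>\<^bsub>V\<^esub> = \<zero>\<^bsub>W\<^esub>"
  using linear_map.T0_is_0[OF linear_mapI[OF assms]] .

lemma hom_neg:
  assumes "vectorspace K V" "vectorspace K W" "T \<in> module_hom K V W" "v \<in> carrier V"
  shows "T (\<ominus>\<^bsub>V\<^esub> v) = \<ominus>\<^bsub>W\<^esub> T v"
  using linear_map.T_neg[OF linear_mapI[OF assms(1-3)] assms(4)] .

lemma hom_minus:
  assumes "vectorspace K V" "vectorspace K W" "T \<in> module_hom K V W" "v \<in> carrier V" "w \<in> carrier V"
  shows "T (v \<ominus>\<^bsub>V\<^esub> w) = T v \<ominus>\<^bsub>W\<^esub> T w"
  using linear_map.T_minus[OF linear_mapI[OF assms(1-3)] assms(4,5)] .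

lemma hom_closed: "T \<in> module_hom K V W \<Longrightarrow> v \<in> carrier V \<Longrightarrow> T v \<in> carrier W"
  by (auto simp: module_hom_def)

lemma subspace_image:
  assumes "vectorspace K V" "vectorspace K W" "T \<in> module_hom K V W" "subspace K U V"
  shows "subspace K (T ` U) W"
proof -
  interpret V: vectorspace K V by fact
  interpret W: vectorspace K W by fact
  have U: "U \<subseteq> carrier V" using V.subspace_carrier assms by auto
  show ?thesis
  proof (rule W.subspaceI)
    show "T ` U \<subseteq> carrier W" using U hom_closed[OF assms(3)] by auto
    show "\<zero>\<^bsub>W\<^esub> \<in> T ` U" using V.subspace_zero[OF assms(4)] hom_zero[OF assms(1-3)] by force
    show "u \<oplus>\<^bsub>W\<^esub> w \<in> T ` U" if uw: "u \<in> T ` U" "w \<in> T ` U" for u w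
    proof -
      obtain a b where ab: "a \<in> U" "b \<in> U" "u = T a" "w = T b" using uw by auto
      then have "u \<oplus>\<^bsub>W\<^esub> w = T (a \<oplus>\<^bsub>V\<^esub> b)" using U by (simp add: module_hom_add[OF assms(3)] subset_iff)
      then show ?thesis using ab V.subspace_add[OF assms(4)] by auto
    qed
    show "c \<odot>\<^bsub>W\<^esub> u \<in> T ` U" if cu: "c \<in> carrier K" "u \<in> T ` U" for c u
    proof -
      obtain a where a: "a \<in> U" "u = T a" using cu by auto
      then have "c \<odot>\<^bsub>W\<^esub> u = T (c \<odot>\<^bsub>V\<^esub> a)" using U cu by (simp add: module_hom_smult[OF assms(3)] subset_iff)
      then show ?thesis using a cu V.subspace_smult[OF assms(4)] by auto
    qed
  qed
qed

lemma subspace_vimage: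
  assumes "vectorspace K V" "vectorspace K W" "T \<in> module_hom K V W" "subspace K U W"
  shows "subspace K {v \<in> carrier V. T v \<in> U} V"
proof -
  interpret V: vectorspace K V by fact
  interpret W: vectorspace K W by fact
  show ?thesis
    by (rule V.subspaceI)
      (auto simp: hom_zero[OF assms(1-3)] module_hom_add[OF assms(3)] module_hom_smult[OF assms(3)]
        W.subspace_zero[OF assms(4)] intro: W.subspace_add[OF assms(4)] W.subspace_smult[OF assms(4)])
qed

lemma subspace_ker:
  assumes "vectorspace K V" "vectorspace K W" "T \<in> module_hom K V W"
  shows "subspace K {v \<in> carrier V. T v = \<zero>\<^bsub>W\<^esub>} V"
  using subspace_vimage[OF assms vectorspace.subspace_trivial[OF assms(2)]] by simp

lemma span_image:
  assumes "vectorspace K V" "vectorspace K W" "T \<in> module_hom K V W" "A \<subseteq> carrier V"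
  shows "T ` module.span K V A = module.span K W (T ` A)"
proof -
  interpret V: vectorspace K V by fact
  interpret W: vectorspace K W by fact
  have TA: "T ` A \<subseteq> carrier W" using assms(4) hom_closed[OF assms(3)] by auto
  have "V.span A \<subseteq> {v \<in> carrier V. T v \<in> W.span (T ` A)}"
    using subspace_vimage[OF assms(1-3) W.span_is_subspace[OF TA]] W.in_own_span[OF TA] assms(4)
    by (intro V.span_is_subset) auto
  moreover have "W.span (T ` A) \<subseteq> T ` V.span A"
    using subspace_image[OF assms(1-3) V.span_is_subspace[OF assms(4)]] V.in_own_span[OF assms(4)]
    by (intro W.span_is_subset) auto
  ultimately show ?thesis by auto
qed

text \<open>The basic counting tool. Restricting to a subspace makes it count intersections with a
  kernel as well, and the additive form avoids subtraction in \<open>nat\<close>.\<close>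

lemma rank_nullity_subspace:
  assumes "vectorspace K V" "vectorspace K W" "T \<in> module_hom K V W"
    "vectorspace.fin_dim K V" "subspace K U V"
  shows "sdim K W (T ` U) + sdim K V {u \<in> U. T u = \<zero>\<^bsub>W\<^esub>} = sdim K V U"
proof -
  interpret V: vectorspace K V by fact
  interpret U: vectorspace K "V.vs U" by (rule V.subspace_is_vs) fact
  interpret linear_map K "V.vs U" W T
    using linear_mapI[OF _ assms(2) module_hom_restrict[OF assms(3)]] U.vectorspace_axioms
      V.subspace_carrier assms(5) by auto
  show ?thesis
    using rank_nullity[OF V.subspace_fin_dim[OF assms(4,5)]] by (simp add: im_def ker_def)
qed

lemma fin_dim_surj:
  assumes "vectorspace K V" "vectorspace K W" "T \<in> module_hom K V W"
    "vectorspace.fin_dim K V" "T ` carrier V = carrier W"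
  shows "vectorspace.fin_dim K W"
  using linear_map.rank_nullity_main(2)[OF linear_mapI[OF assms(1-3)] assms(4,5)] .

lemma sdim_image_inj:
  assumes "vectorspace K V" "vectorspace K W" "T \<in> module_hom K V W"
    "vectorspace.fin_dim K V" "subspace K U V" "inj_on T U"
  shows "sdim K W (T ` U) = sdim K V U"
proof -
  interpret V: vectorspace K V by fact
  interpret W: vectorspace K W by fact
  have "{u \<in> U. T u = \<zero>\<^bsub>W\<^esub>} = {\<zero>\<^bsub>V\<^esub>}"
    using assms(6) V.subspace_zero[OF assms(5)] hom_zero[OF assms(1-3)] by (auto simp: inj_on_def)
  then show ?thesis
    using rank_nullity_subspace[OF assms(1-5)] V.sdim_zero by simp
qed

lemma dim_eq_of_bij:
  assumes "vectorspace K V" "vectorspace K W" "T \<in> module_hom K V W"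
    "vectorspace.fin_dim K V" "bij_betw T (carrier V) (carrier W)"
  shows "vectorspace.dim K V = vectorspace.dim K W"
  using linear_map.dim_eq[OF linear_mapI[OF assms(1-3)] assms(4)] assms(5) by (auto simp: bij_betw_def)

lemma fst_hom: "fst \<in> module_hom K (direct_sum V W) V"
  by (auto simp: module_hom_def direct_sum_def)

lemma fin_dim_direct_sum:
  assumes "vectorspace K V" "vectorspace K W" "vectorspace.fin_dim K V" "vectorspace.fin_dim K W"
  shows "vectorspace.fin_dim K (direct_sum V W)"
proof -
  interpret V: vectorspace K V by fact
  interpret W: vectorspace K W by fact
  interpret S: vectorspace K "direct_sum V W" by (rule direct_sum_is_vs) fact+
  let ?i = "\<lambda>v. (v, \<zero>\<^bsub>W\<^esub>)" and ?j = "\<lambda>w. (\<zero>\<^bsub>V\<^esub>, w)"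
  have i: "?i \<in> module_hom K V (direct_sum V W)"
    by (auto simp: module_hom_def direct_sum_def)
  have j: "?j \<in> module_hom K W (direct_sum V W)"
    by (auto simp: module_hom_def direct_sum_def)
  obtain A B where A: "finite A" "A \<subseteq> carrier V" "V.span A = carrier V"
    and B: "finite B" "B \<subseteq> carrier W" "W.span B = carrier W"
    using assms(3,4) V.fin_dim_def W.fin_dim_def by auto
  let ?G = "?i ` A \<union> ?j ` B"
  have G: "?G \<subseteq> carrier (direct_sum V W)"
    using A B by (auto simp: direct_sum_def)
  have "carrier (direct_sum V W) \<subseteq> S.span ?G"
  proof
    fix z assume z: "z \<in> carrier (direct_sum V W)"
    then have "?i (fst z) \<in> ?i ` V.span A" "?j (snd z) \<in> ?j ` W.span B"
      using A B by (auto simp: direct_sum_def)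
    moreover have "?i ` V.span A \<subseteq> S.span ?G"
      using span_image[OF assms(1) S.vectorspace_axioms i A(2)]
        S.span_is_monotone[of "?i ` A" ?G] by auto
    moreover have "?j ` W.span B \<subseteq> S.span ?G"
      using span_image[OF assms(2) S.vectorspace_axioms j B(2)]
        S.span_is_monotone[of "?j ` B" ?G] by auto
    ultimately have "?i (fst z) \<oplus>\<^bsub>direct_sum V W\<^esub> ?j (snd z) \<in> S.span ?G"
      using S.subspace_add[OF S.span_is_subspace[OF G]] by (meson subsetD)
    then show "z \<in> S.span ?G" using z by (auto simp: direct_sum_def)
  qed
  then have "S.span ?G = carrier (direct_sum V W)" using S.span_is_subset2[OF G] by auto
  moreover have "finite ?G" using A B by simp
  ultimately show ?thesis unfolding S.fin_dim_def using G by (intro exI[of _ ?G]) simp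
qed

text \<open>Rank-nullity for \<open>fst\<close>, whose kernel is a copy of \<open>W\<close>.\<close>

lemma dim_direct_sum:
  assumes "vectorspace K V" "vectorspace K W" "vectorspace.fin_dim K V" "vectorspace.fin_dim K W"
  shows "vectorspace.dim K (direct_sum V W) = vectorspace.dim K V + vectorspace.dim K W"
proof -
  interpret V: vectorspace K V by fact
  interpret W: vectorspace K W by fact
  interpret S: vectorspace K "direct_sum V W" by (rule direct_sum_is_vs) fact+
  have fd: "S.fin_dim" by (rule fin_dim_direct_sum) fact+
  let ?j = "\<lambda>w. (\<zero>\<^bsub>V\<^esub>, w)"
  have j: "?j \<in> module_hom K W (direct_sum V W)"
    by (auto simp: module_hom_def direct_sum_def)
  have "fst ` carrier (direct_sum V W) = carrier V"
    by (force simp: direct_sum_def)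
  moreover have "{u \<in> carrier (direct_sum V W). fst u = \<zero>\<^bsub>V\<^esub>} = ?j ` carrier W"
    by (auto simp: direct_sum_def)
  moreover have "sdim K (direct_sum V W) (?j ` carrier W) = sdim K W (carrier W)"
    by (rule sdim_image_inj[OF assms(2) S.vectorspace_axioms j assms(4) W.subspace_carrier_self])
      (auto simp: inj_on_def)
  ultimately show ?thesis
    using rank_nullity_subspace[OF S.vectorspace_axioms assms(1) fst_hom fd S.subspace_carrier_self]
    by simp
qed

context vectorspace
begin

text \<open>Addition maps the external direct sum of \<open>U\<close> and \<open>W\<close> onto
  their sum, and its kernel is the antidiagonal copy of \<open>U \<inter> W\<close>, embedded by
  \<open>?k\<close>.\<close>

lemma sdim_sum_Int:
  assumes fd: fin_dim and U: "subspace K U V" and W: "subspace K W V"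
  shows "sdim K V (subspace_sum U W) + sdim K V (U \<inter> W) = sdim K V U + sdim K V W"
proof -
  let ?D = "direct_sum (vs U) (vs W)"
  let ?T = "\<lambda>v. fst v \<oplus>\<^bsub>V\<^esub> snd v"
  have vU: "vectorspace K (vs U)" and vW: "vectorspace K (vs W)"
    using U W subspace_is_vs by auto
  interpret D: vectorspace K ?D by (rule direct_sum_is_vs) fact+
  have fdU: "vectorspace.fin_dim K (vs U)" and fdW: "vectorspace.fin_dim K (vs W)"
    using subspace_fin_dim fd U W by auto
  have fdD: "D.fin_dim" by (rule fin_dim_direct_sum) fact+
  have T: "?T \<in> module_hom K ?D V"
    using sum_map_linear[OF U W] by (simp add: linear_map_def mod_hom_def mod_hom_axioms_def)
  have sub: "U \<subseteq> carrier V" "W \<subseteq> carrier V" using U W subspace_carrier by auto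
  let ?k = "\<lambda>v. (v, \<ominus>\<^bsub>V\<^esub> v)"
  have UW: "subspace K (U \<inter> W) V" using U W by (rule subspace_Int)
  have k: "?k \<in> module_hom K (vs (U \<inter> W)) ?D"
    unfolding module_hom_def direct_sum_def
    using sub subspace_neg[OF W] by (auto simp: minus_add subset_iff smult_r_minus)
  have "?T ` carrier ?D = subspace_sum U W"
    unfolding submodule_sum_def direct_sum_def by force
  moreover have "{u \<in> carrier ?D. ?T u = \<zero>\<^bsub>V\<^esub>} = ?k ` (U \<inter> W)"
  proof (intro equalityI subsetI)
    fix z assume "z \<in> {u \<in> carrier ?D. ?T u = \<zero>\<^bsub>V\<^esub>}"
    then obtain a b where z: "z = (a, b)" "a \<in> U" "b \<in> W" "a \<oplus>\<^bsub>V\<^esub> b = \<zero>\<^bsub>V\<^esub>"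
      by (auto simp: direct_sum_def)
    have ab: "a \<in> carrier V" "b \<in> carrier V" using z sub by auto
    then have b: "b = \<ominus>\<^bsub>V\<^esub> a" using z by (metis minus_equality a_comm)
    then have "a = \<ominus>\<^bsub>V\<^esub> b" using ab by (metis minus_minus)
    then have "a \<in> W" using subspace_neg[OF W z(3)] by metis
    then show "z \<in> ?k ` (U \<inter> W)" using b z by blast
  next
    fix z assume "z \<in> ?k ` (U \<inter> W)"
    then obtain a where a: "a \<in> U" "a \<in> W" "z = (a, \<ominus>\<^bsub>V\<^esub> a)" by blast
    moreover have "a \<oplus>\<^bsub>V\<^esub> \<ominus>\<^bsub>V\<^esub> a = \<zero>\<^bsub>V\<^esub>" using a sub by (intro r_neg) auto
    ultimately show "z \<in> {u \<in> carrier ?D. ?T u = \<zero>\<^bsub>V\<^esub>}"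
      using subspace_neg[OF W a(2)] by (simp add: direct_sum_def)
  qed
  moreover have "sdim K ?D (?k ` (U \<inter> W)) = sdim K V (U \<inter> W)"
    using sdim_image_inj[OF subspace_is_vs[OF UW] D.vectorspace_axioms k subspace_fin_dim[OF fd UW]
        vectorspace.subspace_carrier_self[OF subspace_is_vs[OF UW]]]
    by (simp add: inj_on_def)
  moreover have "D.dim = sdim K V U + sdim K V W"
    by (rule dim_direct_sum) fact+
  ultimately show ?thesis
    using rank_nullity_subspace[OF D.vectorspace_axioms vectorspace_axioms T fdD D.subspace_carrier_self]
    by simp
qed

end

section \<open>Bases adapted to chains of subspaces\<close>

definition subspace_chain :: "('k, 'm) ring_scheme \<Rightarrow> ('k, 'v, 'd) module_scheme \<Rightarrow> 'v set set \<Rightarrow> bool" where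
  "subspace_chain K V F \<longleftrightarrow>
     (\<forall>U\<in>F. subspace K U V) \<and> (\<forall>U\<in>F. \<forall>W\<in>F. U \<subseteq> W \<or> W \<subseteq> U)"

text \<open>For subspaces \<open>U\<close> the condition says that \<open>B \<inter> U\<close> is a
  basis of \<open>U\<close>; only the inclusion that is not automatic is required.\<close>

definition adapted_basis ::
  "('k, 'm) ring_scheme \<Rightarrow> ('k, 'v, 'd) module_scheme \<Rightarrow> 'v set set \<Rightarrow> 'v set \<Rightarrow> bool" where
  "adapted_basis K V F B \<longleftrightarrow>
     vectorspace.basis K V B \<and> (\<forall>U\<in>F. U \<subseteq> module.span K V (B \<inter> U))"

context vectorspace
begin

lemma mem_span_insert:
  assumes "v \<in> carrier V" "B \<subseteq> carrier V" "z \<in> span (insert v B)"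
  obtains c s where "c \<in> carrier K" "s \<in> span B" "z = c \<odot>\<^bsub>V\<^esub> v \<oplus>\<^bsub>V\<^esub> s"
proof -
  have "z \<in> subspace_sum (span {v}) (span B)"
    using span_union_is_sum[of "{v}" B] assms by simp
  then obtain r s where rs: "r \<in> span {v}" "s \<in> span B" "z = r \<oplus>\<^bsub>V\<^esub> s"
    unfolding mem_sum_iff by auto
  obtain a where "a \<in> {v} \<rightarrow> carrier K" "lincomb a {v} = r"
    using finite_in_span[of "{v}" r] rs assms by auto
  then have "r = a v \<odot>\<^bsub>V\<^esub> v" "a v \<in> carrier K"
    using assms by (auto simp: lincomb_def)
  then show ?thesis using rs that by auto
qed

lemma span_minimal: "subspace K U V \<Longrightarrow> S \<subseteq> U \<Longrightarrow> span S \<subseteq> U"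
  using span_is_subset by simp

lemma span_insert_zero:
  assumes "S \<subseteq> carrier V"
  shows "span (insert \<zero>\<^bsub>V\<^esub> S) = span S"
  using assms span_minimal[OF span_is_subspace[OF assms], of "insert \<zero>\<^bsub>V\<^esub> S"] in_own_span[OF assms]
    span_is_monotone[of S "insert \<zero>\<^bsub>V\<^esub> S"] span_zero[of S] by auto

lemma basis_span_vs:
  assumes "S \<subseteq> carrier V" "lin_indpt S"
  shows "vectorspace.basis K (vs (span S)) S"
proof -
  have sub: "subspace K (span S) V" using assms span_is_subspace by auto
  interpret U: vectorspace K "vs (span S)" by (rule subspace_is_vs) fact
  show ?thesis
    unfolding U.basis_def using span_li_not_depend[OF in_own_span] assms sub in_own_span by auto
qed

lemma sdim_span:
  assumes "S \<subseteq> carrier V" "lin_indpt S" "finite S"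
  shows "sdim K V (span S) = card S"
  using vectorspace.dim_basis[OF subspace_is_vs[OF span_is_subspace[OF assms(1)]] assms(3)
      basis_span_vs[OF assms(1,2)]] .

lemma li_of_card_le:
  assumes "S \<subseteq> carrier V" "finite S" "card S \<le> sdim K V (span S)"
  shows "lin_indpt S"
proof -
  have sub: "subspace K (span S) V" using assms span_is_subspace by auto
  interpret U: vectorspace K "vs (span S)" by (rule subspace_is_vs) fact
  have "U.span S = span S" "U.lin_dep S = lin_dep S"
    using span_li_not_depend[OF in_own_span] assms sub by auto
  then show ?thesis
    using U.dim_gen_is_basis[OF assms(2)] in_own_span[OF assms(1)] assms(3)
    unfolding U.basis_def by auto
qed

text \<open>A maximal \<open>B\<close> with the required properties already spans \<open>W\<close>.
  Otherwise a vector could be added without spoiling adaptedness, provided that it is taken from the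
  smallest chain member \<open>U\<close> for which \<open>W \<inter> U\<close> is not yet covered:
  members above \<open>U\<close> contain the new vector, and below \<open>U\<close> nothing is
  missing.\<close>

lemma extend_adapted:
  assumes fd: fin_dim and W: "subspace K W V" and F: "subspace_chain K V F"
    and A: "A \<subseteq> W" "lin_indpt A" "\<And>U. U \<in> F \<Longrightarrow> span A \<inter> U \<subseteq> span (A \<inter> U)"
  shows "\<exists>B. A \<subseteq> B \<and> B \<subseteq> W \<and> lin_indpt B \<and> span B = W \<and> (\<forall>U\<in>F. W \<inter> U \<subseteq> span (B \<inter> U))"
proof -
  let ?P = "\<lambda>B. A \<subseteq> B \<and> B \<subseteq> W \<and> lin_indpt B \<and> (\<forall>U\<in>F. span B \<inter> U \<subseteq> span (B \<inter> U))"
  have Wc: "W \<subseteq> carrier V" using W subspace_carrier by auto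
  have "\<exists>B. finite B \<and> maximal B ?P"
  proof (rule maximal_exists[where N = dim and B = A])
    show "?P A" using A by auto
    fix B assume "?P B"
    then show "finite B \<and> card B \<le> dim" using li_le_dim[OF fd] Wc by auto
  qed
  then obtain B where B: "?P B" "\<And>B'. B \<subseteq> B' \<Longrightarrow> ?P B' \<Longrightarrow> B' = B"
    unfolding maximal_def by auto
  have Bc: "B \<subseteq> carrier V" using B Wc by auto
  have spB: "span B \<subseteq> W" using span_minimal[OF W] B by auto
  have "W \<subseteq> span B"
  proof (rule ccontr)
    assume "\<not> W \<subseteq> span B"
    \<comment> \<open>\<open>F\<close> may lack the whole space; adding it guarantees a candidate
      for the smallest uncovered member.\<close>
    then have "carrier V \<in> insert (carrier V) F \<and> \<not> W \<inter> carrier V \<subseteq> span B"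
      using Wc by auto
    from ex_has_least_nat[of "\<lambda>U. U \<in> insert (carrier V) F \<and> \<not> W \<inter> U \<subseteq> span B", OF this,
        of "\<lambda>U. sdim K V U"]
    obtain U where U: "U \<in> insert (carrier V) F" "\<not> W \<inter> U \<subseteq> span B"
      and least: "\<And>U'. U' \<in> insert (carrier V) F \<Longrightarrow> \<not> W \<inter> U' \<subseteq> span B \<Longrightarrow> sdim K V U \<le> sdim K V U'"
      by metis
    obtain v where v: "v \<in> W" "v \<in> U" "v \<notin> span B" using U by auto
    have vc: "v \<in> carrier V" "v \<notin> B" using v Wc in_own_span[OF Bc] by auto
    have sU: "subspace K U V"
      using U F subspace_carrier_self unfolding subspace_chain_def by auto
    let ?B = "insert v B"
    have "lin_indpt ?B"
      using lin_dep_iff_in_span[OF Bc _ vc] B v by simp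
    moreover have "span ?B \<inter> U' \<subseteq> span (?B \<inter> U')" if U': "U' \<in> F" for U'
    proof
      fix z assume z: "z \<in> span ?B \<inter> U'"
      have sU': "subspace K U' V" using F U' unfolding subspace_chain_def by auto
      have zW: "z \<in> W" using span_minimal[OF W, of ?B] B v z by auto
      have BU': "?B \<inter> U' \<subseteq> carrier V" using Bc vc by auto
      show "z \<in> span (?B \<inter> U')"
      proof (cases "U \<subseteq> U'")
        case True
        \<comment> \<open>The multiple of \<open>v\<close> can be subtracted inside
          \<open>U'\<close>; this leaves an element of \<open>span B \<inter> U'\<close>, where
          \<open>B\<close> is already adapted.\<close>
        obtain c s where cs: "c \<in> carrier K" "s \<in> span B" "z = c \<odot>\<^bsub>V\<^esub> v \<oplus>\<^bsub>V\<^esub> s"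
          using mem_span_insert[OF vc(1) Bc] z by blast
        have sc: "s \<in> carrier V" using cs span_is_subset2[OF Bc] by auto
        have "c \<odot>\<^bsub>V\<^esub> v \<in> U'" using cs v True subspace_smult[OF sU'] by auto
        then have "z \<ominus>\<^bsub>V\<^esub> c \<odot>\<^bsub>V\<^esub> v \<in> U'" using z subspace_minus[OF sU'] by auto
        moreover have "z \<ominus>\<^bsub>V\<^esub> c \<odot>\<^bsub>V\<^esub> v = s"
          using cs sc vc unfolding a_minus_def by (metis a_comm M.minus_closed a_assoc r_neg r_zero smult_closed M.a_inv_closed)
        ultimately have "s \<in> span (B \<inter> U')" using B U' cs by auto
        then have "s \<in> span (?B \<inter> U')" using span_is_monotone[of "B \<inter> U'" "?B \<inter> U'"] by auto
        moreover have "v \<in> span (?B \<inter> U')" using in_own_span[OF BU'] v True by auto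
        ultimately show ?thesis
          using subspace_add[OF span_is_subspace[OF BU']] subspace_smult[OF span_is_subspace[OF BU']] cs
          by auto
      next
        case False
        have "U = carrier V \<or> U \<subseteq> U' \<or> U' \<subseteq> U"
          using U U' F unfolding subspace_chain_def by auto
        then have "U' \<subseteq> U" using False subspace_carrier[OF sU'] by auto
        \<comment> \<open>A strictly smaller member meets \<open>W\<close> inside
          \<open>span B\<close> by the choice of \<open>U\<close>, so \<open>z\<close> is in
          \<open>span B\<close> already.\<close>
        then have "\<not> sdim K V U \<le> sdim K V U'"
          using subspace_eqI[OF fd sU' sU] False by auto
        then have "W \<inter> U' \<subseteq> span B" using least U' by auto
        then have "z \<in> span B \<inter> U'" using z zW by blast
        then have "z \<in> span (B \<inter> U')" using B(1) U' by blast
        then show ?thesis using span_is_monotone[of "B \<inter> U'" "?B \<inter> U'"] by auto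
      qed
    qed
    ultimately have "?P ?B" using B v by auto
    then show False using B(2)[of ?B] vc by auto
  qed
  then have "span B = W" using spB by auto
  then show ?thesis using B by (intro exI[of _ B]) auto
qed

text \<open>Induction along \<open>G\<close>, with the whole space as top member: a basis of a
  member extends one of the largest member properly below it, and \<open>extend_adapted\<close>
  keeps it adapted to \<open>F\<close>.\<close>

lemma adapted_basis_two_chains:
  assumes fd: fin_dim and F: "subspace_chain K V F" and G: "subspace_chain K V G"
  obtains B where "adapted_basis K V (F \<union> G) B"
proof -
  let ?Q = "\<lambda>W B. B \<subseteq> W \<and> lin_indpt B \<and> span B = W \<and> (\<forall>U\<in>F. W \<inter> U \<subseteq> span (B \<inter> U)) \<and>
      (\<forall>U\<in>G. U \<subseteq> W \<longrightarrow> U \<subseteq> span (B \<inter> U))"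
  have "\<exists>B. ?Q W B" if "W \<in> insert (carrier V) G" for W
    using that
  proof (induction "sdim K V W" arbitrary: W rule: less_induct)
    case less
    have W: "subspace K W V" 
      using less.prems G subspace_carrier_self unfolding subspace_chain_def by auto
    have "\<exists>A. A \<subseteq> W \<and> lin_indpt A \<and> (\<forall>U\<in>F. span A \<inter> U \<subseteq> span (A \<inter> U)) \<and>
        (\<forall>U\<in>G. U \<subset> W \<longrightarrow> U \<subseteq> span (A \<inter> U))"
    proof (cases "\<exists>U\<in>G. U \<subset> W")
      case False
      have "span {} \<inter> U \<subseteq> span ({} \<inter> U)" for U by auto
      moreover have "lin_indpt {}" unfolding lin_dep_def by auto
      ultimately show ?thesis using False by blast
    next
      case True
      \<comment> \<open>\<open>G\<close> may be infinite, but dimensions are bounded, so among the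
        members properly below \<open>W\<close> there is one of greatest dimension, and it contains
        all the others.\<close>
      have "\<forall>U. U \<in> G \<and> U \<subset> W \<longrightarrow> sdim K V U < Suc dim"
        using sdim_le_dim[OF fd] G unfolding subspace_chain_def by (auto simp: less_Suc_eq_le)
      moreover obtain U0 where "U0 \<in> G \<and> U0 \<subset> W" using True by auto
      ultimately have "\<exists>W'. (W' \<in> G \<and> W' \<subset> W) \<and>
          (\<forall>U. U \<in> G \<and> U \<subset> W \<longrightarrow> sdim K V U \<le> sdim K V W')"
        by (intro ex_has_greatest_nat) auto
      then obtain W' where W': "W' \<in> G" "W' \<subset> W"
        and max: "\<And>U. U \<in> G \<Longrightarrow> U \<subset> W \<Longrightarrow> sdim K V U \<le> sdim K V W'" by auto
      have sW': "subspace K W' V" using G W' unfolding subspace_chain_def by auto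
      have "sdim K V W' < sdim K V W"
        using subspace_eqI[OF fd sW' W] W' by (metis not_less psubset_eq)
      then obtain B where B: "?Q W' B" using less.hyps[of W'] W' by auto
      have "U \<subseteq> span (B \<inter> U)" if "U \<in> G" "U \<subset> W" for U
      proof -
        have sU: "subspace K U V" using G that unfolding subspace_chain_def by auto
        have "U \<subseteq> W' \<or> W' \<subseteq> U" using that W' G unfolding subspace_chain_def by auto
        then have "U \<subseteq> W'" using subspace_eqI[OF fd sW' sU] max[OF that] by auto
        then show ?thesis using B that by auto
      qed
      then show ?thesis using B W' by (intro exI[of _ B]) auto
    qed
    then obtain A where A: "A \<subseteq> W" "lin_indpt A" "\<And>U. U \<in> F \<Longrightarrow> span A \<inter> U \<subseteq> span (A \<inter> U)"
      "\<And>U. U \<in> G \<Longrightarrow> U \<subset> W \<Longrightarrow> U \<subseteq> span (A \<inter> U)"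
      by auto
    from extend_adapted[OF fd W F A(1-3)]
    obtain B where B: "A \<subseteq> B" "B \<subseteq> W" "lin_indpt B" "span B = W"
      "\<And>U. U \<in> F \<Longrightarrow> W \<inter> U \<subseteq> span (B \<inter> U)"
      by auto
    have "U \<subseteq> span (B \<inter> U)" if "U \<in> G" "U \<subseteq> W" for U
    proof (cases "U = W")
      case True
      then show ?thesis using B by (simp add: Int_absorb2)
    next
      case False
      then have "U \<subseteq> span (A \<inter> U)" using A that by auto
      then show ?thesis using span_is_monotone[of "A \<inter> U" "B \<inter> U"] B by auto
    qed
    then show ?case using B by blast
  qed
  from this[OF insertI1] obtain B where B: "?Q (carrier V) B" ..
  have "U \<subseteq> carrier V" if "U \<in> F \<union> G" for U
    using that F G unfolding subspace_chain_def by (blast dest: subspace_carrier)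
  then have "adapted_basis K V (F \<union> G) B"
    using B unfolding adapted_basis_def basis_def by (auto simp: Int_absorb1)
  then show ?thesis using that by auto
qed

end

text \<open>
  The middle of the basis extends the images under \<open>x\<close> to \<open>ker y\<close>; the rest consists of lifts along
  \<open>y\<close>, each taken from the smallest possible member of the chain, which keeps the basis adapted.
\<close>

lemma adapted_basis_step:
  assumes P: "vectorspace K P" "vectorspace.fin_dim K P" and Q: "vectorspace K Q" "vectorspace.fin_dim K Q"
    and R: "vectorspace K R" "vectorspace.fin_dim K R"
    and x: "x \<in> module_hom K P Q" and y: "y \<in> module_hom K Q R"
    and yx: "\<And>v. v \<in> carrier P \<Longrightarrow> y (x v) = \<zero>\<^bsub>R\<^esub>"
    and F: "subspace_chain K Q F" "carrier Q \<in> F" "{\<zero>\<^bsub>Q\<^esub>} \<in> F"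
    and B: "adapted_basis K P ((\<lambda>U. {v \<in> carrier P. x v \<in> U}) ` F) B"
    and C: "adapted_basis K R ((\<lambda>U. y ` U) ` F) C"
  obtains E where "adapted_basis K Q F E"
    "x ` B \<subseteq> insert \<zero>\<^bsub>Q\<^esub> E" "inj_on x {b \<in> B. x b \<noteq> \<zero>\<^bsub>Q\<^esub>}"
    "y ` E \<subseteq> insert \<zero>\<^bsub>R\<^esub> C" "inj_on y {e \<in> E. y e \<noteq> \<zero>\<^bsub>R\<^esub>}"
proof -
  interpret P: vectorspace K P by fact
  interpret Q: vectorspace K Q by fact
  interpret R: vectorspace K R by fact
  have sF: "subspace K U Q" if "U \<in> F" for U using F that unfolding subspace_chain_def by auto
  have cF: "U \<subseteq> carrier Q" if "U \<in> F" for U using sF that Q.subspace_carrier by auto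
  have B': "P.lin_indpt B" "P.span B = carrier P" "B \<subseteq> carrier P" "P.basis B"
    using B unfolding adapted_basis_def P.basis_def by auto
  have adB: "{v \<in> carrier P. x v \<in> U} \<subseteq> P.span (B \<inter> {v \<in> carrier P. x v \<in> U})"
    if "U \<in> F" for U
    using B that unfolding adapted_basis_def by auto
  have C': "R.lin_indpt C" "R.span C = carrier R" "C \<subseteq> carrier R"
    using C unfolding adapted_basis_def R.basis_def by auto
  have finB: "finite B" and finC: "finite C"
    using P.fin_dim_li_fin[OF P(2)] R.fin_dim_li_fin[OF R(2)] B' C' by auto
  define B1 where "B1 = {b \<in> B. x b \<noteq> \<zero>\<^bsub>Q\<^esub>}"
  define B0 where "B0 = {b \<in> B. x b = \<zero>\<^bsub>Q\<^esub>}"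
  define A where "A = x ` B1"
  define ky where "ky = {v \<in> carrier Q. y v = \<zero>\<^bsub>R\<^esub>}"
  have xc: "x v \<in> carrier Q" if "v \<in> carrier P" for v using hom_closed[OF x that] .
  have yc: "y v \<in> carrier R" if "v \<in> carrier Q" for v using hom_closed[OF y that] .
  have Ac: "A \<subseteq> carrier Q" using B' xc unfolding A_def B1_def by auto
  have imx: "x ` carrier P \<inter> U \<subseteq> Q.span (A \<inter> U)" if U: "U \<in> F" for U
  proof
    fix z assume "z \<in> x ` carrier P \<inter> U"
    then obtain v where v: "v \<in> carrier P" "x v \<in> U" "z = x v" by auto
    let ?X = "{v \<in> carrier P. x v \<in> U}"
    have "v \<in> P.span (B \<inter> ?X)" using B U v unfolding adapted_basis_def by auto
    then have "z \<in> Q.span (x ` (B \<inter> ?X))"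
      using span_image[OF P(1) Q(1) x, of "B \<inter> ?X"] v by auto
    moreover have "x ` (B \<inter> ?X) \<subseteq> insert \<zero>\<^bsub>Q\<^esub> (A \<inter> U)"
      unfolding A_def B1_def by auto
    ultimately have "z \<in> Q.span (insert \<zero>\<^bsub>Q\<^esub> (A \<inter> U))"
      using Q.span_is_monotone by blast
    then show "z \<in> Q.span (A \<inter> U)" using Q.span_insert_zero[of "A \<inter> U"] Ac by auto
  qed
  have sx: "subspace K (x ` carrier P) Q"
    using subspace_image[OF P(1) Q(1) x P.subspace_carrier_self] .
  have "A \<subseteq> x ` carrier P" using B' unfolding A_def B1_def by auto
  then have spA: "Q.span A = x ` carrier P"
    using Q.span_minimal[OF sx] imx[OF F(2)] Ac xc by (auto simp: Int_absorb2)
  have cardB: "card B = card B0 + card B1"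
    unfolding B0_def B1_def using finB
    by (subst card_Un_disjoint[symmetric]) (auto intro: arg_cong[where f = card])
  \<comment> \<open>As the zero space is in \<open>F\<close>, its preimage ker x is one of the
    subspaces that \<open>B\<close> respects.\<close>
  have "{v \<in> carrier P. x v = \<zero>\<^bsub>Q\<^esub>} = P.span B0"
  proof
    have "{v \<in> carrier P. x v \<in> {\<zero>\<^bsub>Q\<^esub>}} \<subseteq> P.span (B \<inter> {v \<in> carrier P. x v \<in> {\<zero>\<^bsub>Q\<^esub>}})"
      using adB[OF F(3)] .
    moreover have "B \<inter> {v \<in> carrier P. x v \<in> {\<zero>\<^bsub>Q\<^esub>}} = B0" using B' unfolding B0_def by auto
    ultimately show "{v \<in> carrier P. x v = \<zero>\<^bsub>Q\<^esub>} \<subseteq> P.span B0" by simp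
    show "P.span B0 \<subseteq> {v \<in> carrier P. x v = \<zero>\<^bsub>Q\<^esub>}"
      using B' unfolding B0_def by (intro P.span_minimal subspace_ker P(1) Q(1) x) auto
  qed
  moreover have "P.lin_indpt B0" using P.subset_li_is_li[OF B'(1)] unfolding B0_def by auto
  ultimately have "sdim K P {v \<in> carrier P. x v = \<zero>\<^bsub>Q\<^esub>} = card B0"
    using P.sdim_span[of B0] B' finB unfolding B0_def by auto
  moreover have "P.dim = card B" using P.dim_basis[OF finB B'(4)] .
  \<comment> \<open>The rank of \<open>x\<close> is \<open>card B1\<close>. Since the image is
    spanned by \<open>A\<close>, which has at most \<open>card B1\<close> elements, \<open>A\<close>
    is independent and \<open>x\<close> is injective on \<open>B1\<close>.\<close>
  ultimately have dimA: "sdim K Q (Q.span A) = card B1"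
    using rank_nullity_subspace[OF P(1) Q(1) x P(2) P.subspace_carrier_self] cardB spA by simp
  have finB1: "finite B1" using finB unfolding B1_def by auto
  have "card A \<le> card B1" unfolding A_def using card_image_le[OF finB1] .
  then have liA: "Q.lin_indpt A"
    using Q.li_of_card_le[OF Ac] dimA finB1 unfolding A_def by auto
  then have "card A = card B1"
    using Q.sdim_span[OF Ac] dimA finB1 unfolding A_def by auto
  then have injx: "inj_on x B1" unfolding A_def by (rule eq_card_imp_inj_on[OF finB1])
  have sky: "subspace K ky Q" unfolding ky_def by (rule subspace_ker[OF Q(1) R(1) y])
  have "A \<subseteq> ky" unfolding ky_def using \<open>A \<subseteq> x ` carrier P\<close> yx Ac by auto
  then have "\<exists>D. A \<subseteq> D \<and> D \<subseteq> ky \<and> Q.lin_indpt D \<and> Q.span D = ky \<and>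
      (\<forall>U\<in>F. ky \<inter> U \<subseteq> Q.span (D \<inter> U))"
    by (rule Q.extend_adapted[OF Q(2) sky F(1) _ liA]) (simp add: imx spA)
  then obtain D where D: "A \<subseteq> D" "D \<subseteq> ky" "Q.lin_indpt D" "Q.span D = ky"
    "\<And>U. U \<in> F \<Longrightarrow> ky \<inter> U \<subseteq> Q.span (D \<inter> U)"
    by auto
  have Dc: "D \<subseteq> carrier Q" using D unfolding ky_def by auto
  define C1 where "C1 = C \<inter> y ` carrier Q"
  have "\<exists>l. l \<in> carrier Q \<and> y l = c \<and> (\<forall>U\<in>F. c \<in> y ` U \<longrightarrow> l \<in> U)" if c: "c \<in> C1" for c
  proof -
    have "carrier Q \<in> F \<and> c \<in> y ` carrier Q" using c F unfolding C1_def by auto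
    from ex_has_least_nat[of "\<lambda>U. U \<in> F \<and> c \<in> y ` U", OF this, of "\<lambda>U. sdim K Q U"]
    obtain U where U: "U \<in> F" "c \<in> y ` U"
      and least: "\<And>U'. U' \<in> F \<Longrightarrow> c \<in> y ` U' \<Longrightarrow> sdim K Q U \<le> sdim K Q U'" by metis
    obtain l where l: "l \<in> U" "y l = c" using U by auto
    have "l \<in> U'" if U': "U' \<in> F" "c \<in> y ` U'" for U'
    proof -
      have "U \<subseteq> U' \<or> U' \<subseteq> U" using U U' F unfolding subspace_chain_def by auto
      then have "U \<subseteq> U'"
        using Q.subspace_eqI[OF Q(2) sF[OF U'(1)] sF[OF U(1)]] least[OF U'] by auto
      then show ?thesis using l by auto
    qed
    then show ?thesis using l U cF by auto
  qed
  then obtain l where l: "\<And>c. c \<in> C1 \<Longrightarrow> l c \<in> carrier Q" "\<And>c. c \<in> C1 \<Longrightarrow> y (l c) = c"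
    "\<And>c U. c \<in> C1 \<Longrightarrow> U \<in> F \<Longrightarrow> c \<in> y ` U \<Longrightarrow> l c \<in> U" by metis
  define E where "E = D \<union> l ` C1"
  have Ec: "E \<subseteq> carrier Q" unfolding E_def using Dc l by auto
  \<comment> \<open>Lift \<open>y u\<close> to some \<open>s\<close> in the span of the chosen lifts
    that lie in \<open>U\<close>. The difference of \<open>u\<close> and \<open>s\<close> is then in
    \<open>ky \<inter> U\<close>, which \<open>D\<close> covers.\<close>
  have adE: "U \<subseteq> Q.span (E \<inter> U)" if U: "U \<in> F" for U
  proof
    fix u assume u: "u \<in> U"
    have uc: "u \<in> carrier Q" using u cF U by auto
    let ?C = "C \<inter> y ` U"
    have C1: "?C \<subseteq> C1" unfolding C1_def using cF[OF U] by auto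
    have "y u \<in> R.span ?C" using C U u unfolding adapted_basis_def by auto
    moreover have "?C = y ` l ` ?C" using l(2) C1 by (force simp: image_image)
    moreover have lC: "l ` ?C \<subseteq> carrier Q" using l(1) C1 by auto
    ultimately have "y u \<in> y ` Q.span (l ` ?C)" using span_image[OF Q(1) R(1) y lC] by simp
    then obtain s where s: "s \<in> Q.span (l ` ?C)" "y u = y s" by auto
    have lU: "l ` ?C \<subseteq> E \<inter> U" using l(3) C1 U unfolding E_def by auto
    then have sE: "s \<in> Q.span (E \<inter> U)" using s Q.span_is_monotone[OF lU] by auto
    have EU: "E \<inter> U \<subseteq> carrier Q" using Ec by auto
    have sU: "s \<in> U" using Q.span_minimal[OF sF[OF U]] sE by auto
    then have sc: "s \<in> carrier Q" using cF U by auto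
    have "u \<ominus>\<^bsub>Q\<^esub> s \<in> ky" unfolding ky_def
      using uc sc s hom_minus[OF Q(1) R(1) y uc sc] yc by (simp add: a_minus_def R.r_neg)
    moreover have "u \<ominus>\<^bsub>Q\<^esub> s \<in> U" using Q.subspace_minus[OF sF[OF U]] u sU by auto
    ultimately have "u \<ominus>\<^bsub>Q\<^esub> s \<in> Q.span (D \<inter> U)" using D(5)[OF U] by auto
    then have "u \<ominus>\<^bsub>Q\<^esub> s \<in> Q.span (E \<inter> U)"
      using Q.span_is_monotone[of "D \<inter> U" "E \<inter> U"] unfolding E_def by auto
    then have "(u \<ominus>\<^bsub>Q\<^esub> s) \<oplus>\<^bsub>Q\<^esub> s \<in> Q.span (E \<inter> U)"
      using sE Q.subspace_add[OF Q.span_is_subspace[OF EU]] by auto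
    moreover have "(u \<ominus>\<^bsub>Q\<^esub> s) \<oplus>\<^bsub>Q\<^esub> s = u"
      using uc sc unfolding a_minus_def by (simp add: Q.a_assoc Q.l_neg)
    ultimately show "u \<in> Q.span (E \<inter> U)" by simp
  qed
  have spE: "Q.span E = carrier Q"
    using adE[OF F(2)] Ec Q.span_is_subset2[OF Ec] by (auto simp: Int_absorb2)
  have finD: "finite D" using Q.fin_dim_li_fin[OF Q(2) D(3) Dc] .
  have finC1: "finite C1" using finC unfolding C1_def by auto
  have sy: "subspace K (y ` carrier Q) R"
    using subspace_image[OF Q(1) R(1) y Q.subspace_carrier_self] .
  have "R.span C1 = y ` carrier Q"
    using C F(2) R.span_minimal[OF sy, of C1] unfolding adapted_basis_def C1_def by auto
  moreover have "R.lin_indpt C1" using R.subset_li_is_li[OF C'(1)] unfolding C1_def by auto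
  ultimately have "sdim K R (y ` carrier Q) = card C1"
    using R.sdim_span[of C1] finC1 C' unfolding C1_def by auto
  \<comment> \<open>\<open>E\<close> spans and has at most as many elements as the dimension
    computed here, so it is a basis; the independence of the lifts comes from this count.\<close>
  then have "Q.dim = card C1 + card D"
    using rank_nullity_subspace[OF Q(1) R(1) y Q(2) Q.subspace_carrier_self] Q.sdim_span[OF Dc D(3) finD]
      D(4) unfolding ky_def by simp
  moreover have "card E \<le> card D + card (l ` C1)"
    unfolding E_def by (rule card_Un_le)
  moreover have "card (l ` C1) \<le> card C1" using finC1 by (rule card_image_le)
  ultimately have "Q.basis E"
    using Q.dim_gen_is_basis[of E] Ec spE finD finC1 unfolding E_def by auto
  then have "adapted_basis K Q F E" using adE unfolding adapted_basis_def by auto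
  moreover have "x ` B \<subseteq> insert \<zero>\<^bsub>Q\<^esub> E" using D(1) unfolding E_def A_def B1_def by auto
  moreover have "y ` E \<subseteq> insert \<zero>\<^bsub>R\<^esub> C" using D(2) l(2) unfolding E_def ky_def C1_def by auto
  moreover have "inj_on y {e \<in> E. y e \<noteq> \<zero>\<^bsub>R\<^esub>}"
  proof (rule inj_onI)
    fix e f assume "e \<in> {e \<in> E. y e \<noteq> \<zero>\<^bsub>R\<^esub>}" "f \<in> {e \<in> E. y e \<noteq> \<zero>\<^bsub>R\<^esub>}" "y e = y f"
    moreover then have "e \<in> l ` C1" "f \<in> l ` C1" using D(2) unfolding E_def ky_def by auto
    ultimately show "e = f" using l(2) by auto
  qed
  ultimately show ?thesis using that injx unfolding B1_def by blast
qed

section \<open>Compatible bases of representations annihilated by \<open>xy\<close>\<close>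

declare split_paired_All [simp del] split_paired_Ex [simp del]

lemma le_plus_unit [simp]:
  fixes p :: point
  shows "p \<le> p + (1, 0)" "p \<le> p + (0, 1)" "p \<le> p + (1, 1)"
  by (cases p; simp)+

lemma pfd_repD:
  assumes "pfd_rep K M"
  shows "vectorspace K (spc M p)" "vectorspace.fin_dim K (spc M p)"
    "p \<le> q \<Longrightarrow> tr M p q \<in> module_hom K (spc M p) (spc M q)"
    "v \<in> carrier (spc M p) \<Longrightarrow> tr M p p v = v"
    "p \<le> q \<Longrightarrow> q \<le> r \<Longrightarrow> v \<in> carrier (spc M p) \<Longrightarrow> tr M q r (tr M p q v) = tr M p r v"
  using assms unfolding pfd_rep_def by metis+

definition xy_zero :: "('k, 'v) rep \<Rightarrow> bool" where
  "xy_zero N \<longleftrightarrow> (\<forall>p. \<forall>v\<in>carrier (spc N p). tr N p (p + (1, 1)) v = \<zero>\<^bsub>spc N (p + (1, 1))\<^esub>)"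

lemma tr_closed:
  assumes "pfd_rep K M" "p \<le> q" "v \<in> carrier (spc M p)"
  shows "tr M p q v \<in> carrier (spc M q)"
  using hom_closed[OF pfd_repD(3)[OF assms(1,2)] assms(3)] .

lemma xy_zero_tr:
  assumes N: "pfd_rep K N" "xy_zero N" and pq: "p + (1, 1) \<le> q" and v: "v \<in> carrier (spc N p)"
  shows "tr N p q v = \<zero>\<^bsub>spc N q\<^esub>"
proof -
  have le: "p \<le> p + (1, 1)" by (cases p) auto
  have "tr N p q v = tr N (p + (1, 1)) q (tr N p (p + (1, 1)) v)"
    using pfd_repD(5)[OF N(1) le pq v] by simp
  also have "\<dots> = tr N (p + (1, 1)) q \<zero>\<^bsub>spc N (p + (1, 1))\<^esub>"
    using N(2) v unfolding xy_zero_def by simp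
  also have "\<dots> = \<zero>\<^bsub>spc N q\<^esub>"
    using hom_zero[OF pfd_repD(1)[OF N(1)] pfd_repD(1)[OF N(1)] pfd_repD(3)[OF N(1) pq]] .
  finally show ?thesis .
qed

lemma xy_zero_x_y:
  assumes N: "pfd_rep K N" "xy_zero N" and v: "v \<in> carrier (spc N p)"
  shows "tr N (p + (0, 1)) (p + (1, 1)) (tr N p (p + (0, 1)) v) = \<zero>\<^bsub>spc N (p + (1, 1))\<^esub>"
    and "tr N (p + (1, 0)) (p + (1, 1)) (tr N p (p + (1, 0)) v) = \<zero>\<^bsub>spc N (p + (1, 1))\<^esub>"
proof -
  have "p \<le> p + (0, 1)" "p + (0, 1) \<le> p + (1, 1)" "p \<le> p + (1, 0)" "p + (1, 0) \<le> p + (1, 1)"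
    by (cases p; simp)+
  then show "tr N (p + (0, 1)) (p + (1, 1)) (tr N p (p + (0, 1)) v) = \<zero>\<^bsub>spc N (p + (1, 1))\<^esub>"
    "tr N (p + (1, 0)) (p + (1, 1)) (tr N p (p + (1, 0)) v) = \<zero>\<^bsub>spc N (p + (1, 1))\<^esub>"
    using pfd_repD(5)[OF N(1) _ _ v] xy_zero_tr[OF N order.refl v] by simp_all
qed

text \<open>
  The subspaces of \<open>N\<^sub>p\<close> that can be detected by walking to the right of \<open>p\<close>, along \<open>x\<close> or
  backwards along \<open>y\<close>. They form a chain because \<open>im y \<subseteq> ker x\<close>.
\<close>

inductive flag :: "('k, 'v) rep \<Rightarrow> point \<Rightarrow> 'v set \<Rightarrow> bool" for N where
  zero: "flag N p {\<zero>\<^bsub>spc N p\<^esub>}"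
| full: "flag N p (carrier (spc N p))"
| image: "flag N p U \<Longrightarrow> flag N (p + (0, 1)) (tr N p (p + (0, 1)) ` U)"
| vimage: "flag N (p + (1, 0)) U \<Longrightarrow>
    flag N p {v \<in> carrier (spc N p). tr N p (p + (1, 0)) v \<in> U}"

lemma flag_subspace:
  assumes N: "pfd_rep K N" and "flag N p U"
  shows "subspace K U (spc N p)"
  using assms(2)
proof induction
  case (zero p)
  then show ?case using vectorspace.subspace_trivial[OF pfd_repD(1)[OF N]] .
next
  case (full p)
  then show ?case using vectorspace.subspace_carrier_self[OF pfd_repD(1)[OF N]] .
next
  case (image p U)
  then show ?case
    using subspace_image[OF pfd_repD(1)[OF N] pfd_repD(1)[OF N] pfd_repD(3)[OF N]] by simp
next
  case (vimage p U)
  then show ?case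
    using subspace_vimage[OF pfd_repD(1)[OF N] pfd_repD(1)[OF N] pfd_repD(3)[OF N]] by simp
qed

text \<open>Two images, or two preimages, are compared at the neighbouring point by induction. In
  the mixed case the image along y lies in ker x, and every preimage along x contains ker x.\<close>

lemma flag_total:
  assumes N: "pfd_rep K N" "xy_zero N" and "flag N p U" "flag N p W"
  shows "U \<subseteq> W \<or> W \<subseteq> U"
  using assms(3,4)
proof (induction arbitrary: W)
  case (zero p)
  then show ?case
    using vectorspace.subspace_zero[OF pfd_repD(1)[OF N(1)] flag_subspace[OF N(1)]] by auto
next
  case (full p)
  then show ?case
    using vectorspace.subspace_carrier[OF pfd_repD(1)[OF N(1)] flag_subspace[OF N(1)]] by auto
next
  case (image p U)
  have sub: "U \<subseteq> carrier (spc N p)"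
    using vectorspace.subspace_carrier[OF pfd_repD(1)[OF N(1)] flag_subspace[OF N(1) image.hyps]] .
  have sW: "subspace K W (spc N (p + (0, 1)))" using flag_subspace[OF N(1) image.prems] .
  have sI: "subspace K (tr N p (p + (0, 1)) ` U) (spc N (p + (0, 1)))"
    using flag_subspace[OF N(1) flag.image[OF image.hyps]] .
  from image.prems show ?case
  proof (cases rule: flag.cases)
    case zero
    then show ?thesis
      using vectorspace.subspace_zero[OF pfd_repD(1)[OF N(1)] sI] by auto
  next
    case full
    then show ?thesis
      using vectorspace.subspace_carrier[OF pfd_repD(1)[OF N(1)] sI] by auto
  next
    case (image p' U')
    then have "p' = p" by simp
    then show ?thesis using image image.IH[of U'] by auto
  next
    case (vimage U')
    have "\<zero>\<^bsub>spc N (p + (0, 1) + (1, 0))\<^esub> \<in> U'"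
      using vectorspace.subspace_zero[OF pfd_repD(1)[OF N(1)] flag_subspace[OF N(1) vimage(2)]] .
    moreover have p: "p + (0, 1) + (1, 0) = p + (1, 1)" by (cases p) simp
    moreover have "tr N (p + (0, 1)) (p + (1, 1)) (tr N p (p + (0, 1)) u) = \<zero>\<^bsub>spc N (p + (1, 1))\<^esub>"
      if "u \<in> U" for u
      using xy_zero_x_y(1)[OF N] sub that by blast
    ultimately have "tr N p (p + (0, 1)) ` U \<subseteq> W"
      using vectorspace.subspace_carrier[OF pfd_repD(1)[OF N(1)] sI]
      unfolding vimage(1) p by auto
    then show ?thesis by simp
  qed
next
  case (vimage p U)
  let ?X = "{v \<in> carrier (spc N p). tr N p (p + (1, 0)) v \<in> U}"
  have sX: "subspace K ?X (spc N p)" using flag_subspace[OF N(1) flag.vimage[OF vimage.hyps]] .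
  from vimage.prems show ?case
  proof (cases rule: flag.cases)
    case zero
    then show ?thesis
      using vectorspace.subspace_zero[OF pfd_repD(1)[OF N(1)] sX] by auto
  next
    case full
    then show ?thesis by auto
  next
    case (image p' U')
    have sub: "U' \<subseteq> carrier (spc N p')"
      using vectorspace.subspace_carrier[OF pfd_repD(1)[OF N(1)] flag_subspace[OF N(1) image(3)]] .
    have "\<zero>\<^bsub>spc N (p + (1, 0))\<^esub> \<in> U"
      using vectorspace.subspace_zero[OF pfd_repD(1)[OF N(1)] flag_subspace[OF N(1) vimage.hyps]] .
    moreover have p: "p + (1, 0) = p' + (1, 1)" using image by (cases p') simp
    moreover have "tr N (p' + (0, 1)) (p' + (1, 1)) (tr N p' (p' + (0, 1)) u) = \<zero>\<^bsub>spc N (p' + (1, 1))\<^esub>"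
      "tr N p' (p' + (0, 1)) u \<in> carrier (spc N (p' + (0, 1)))" if "u \<in> U'" for u
      using xy_zero_x_y(1)[OF N] sub that tr_closed[OF N(1) le_plus_unit(2)] by blast+
    ultimately have "W \<subseteq> ?X"
      unfolding p image(2) by (auto simp: image(1))
    then show ?thesis by simp
  next
    case (vimage U')
    then show ?thesis using vimage.IH[of U'] by auto
  qed
qed

lemma flag_chain:
  assumes "pfd_rep K N" "xy_zero N"
  shows "subspace_chain K (spc N p) (Collect (flag N p))"
  using flag_subspace[OF assms(1)] flag_total[OF assms] unfolding subspace_chain_def by auto

section \<open>Propagating bases from layer to layer\<close>

lemma adapted_basis_mono: "adapted_basis K V F B \<Longrightarrow> G \<subseteq> F \<Longrightarrow> adapted_basis K V G B"
  unfolding adapted_basis_def by auto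

text \<open>A partial matching of the two bases: a basis vector survives as a basis vector or dies,
  and injectivity on the survivors keeps curves from branching.\<close>

definition basis_edge :: "('k, 'v) rep \<Rightarrow> point \<Rightarrow> point \<Rightarrow> (point \<Rightarrow> 'v set) \<Rightarrow> bool" where
  "basis_edge N p q B \<longleftrightarrow> tr N p q ` B p \<subseteq> insert \<zero>\<^bsub>spc N q\<^esub> (B q) \<and>
     inj_on (tr N p q) {b \<in> B p. tr N p q b \<noteq> \<zero>\<^bsub>spc N q\<^esub>}"

text \<open>Both neighbours of \<open>q\<close> used here lie one layer closer to the diagonal when
  \<open>q\<close> is to its right: x enters \<open>q\<close> from the one, y leaves
  \<open>q\<close> to the other. The closure rules \<open>vimage\<close> and \<open>image\<close> of
  \<open>flag\<close> turn adaptedness at these neighbours into the hypotheses of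
  \<open>adapted_basis_step\<close>.\<close>

lemma flag_basis_step:
  assumes N: "pfd_rep K N" "xy_zero N"
    and B: "adapted_basis K (spc N (q - (1, 0))) (Collect (flag N (q - (1, 0)))) (B (q - (1, 0)))"
    and C: "adapted_basis K (spc N (q + (0, 1))) (Collect (flag N (q + (0, 1)))) (B (q + (0, 1)))"
  shows "\<exists>E. adapted_basis K (spc N q) (Collect (flag N q)) E \<and>
    basis_edge N (q - (1, 0)) q (B(q := E)) \<and> basis_edge N q (q + (0, 1)) (B(q := E))"
proof -
  define p where "p = q - (1, 0)"
  have q: "q = p + (1, 0)" "p \<le> q" "q \<le> q + (0, 1)" "q + (0, 1) = p + (1, 1)"
    unfolding p_def by (cases q; simp)+
  have ne: "p \<noteq> q" "q + (0, 1) \<noteq> q" unfolding p_def by (cases q; simp)+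
  obtain E where E: "adapted_basis K (spc N q) (Collect (flag N q)) E"
    "tr N p q ` B p \<subseteq> insert \<zero>\<^bsub>spc N q\<^esub> E" "inj_on (tr N p q) {b \<in> B p. tr N p q b \<noteq> \<zero>\<^bsub>spc N q\<^esub>}"
    "tr N q (q + (0, 1)) ` E \<subseteq> insert \<zero>\<^bsub>spc N (q + (0, 1))\<^esub> (B (q + (0, 1)))"
    "inj_on (tr N q (q + (0, 1))) {e \<in> E. tr N q (q + (0, 1)) e \<noteq> \<zero>\<^bsub>spc N (q + (0, 1))\<^esub>}"
  proof (rule adapted_basis_step[OF pfd_repD(1,2)[OF N(1), of p] pfd_repD(1,2)[OF N(1), of q]
        pfd_repD(1,2)[OF N(1), of "q + (0, 1)"] pfd_repD(3)[OF N(1) q(2)] pfd_repD(3)[OF N(1) q(3)] _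
        flag_chain[OF N]])
    show "tr N q (q + (0, 1)) (tr N p q v) = \<zero>\<^bsub>spc N (q + (0, 1))\<^esub>" if "v \<in> carrier (spc N p)" for v
      using xy_zero_x_y(2)[OF N that, folded q(1,4)] .
    show "adapted_basis K (spc N p) ((\<lambda>U. {v \<in> carrier (spc N p). tr N p q v \<in> U}) ` Collect (flag N q)) (B p)"
      using flag.vimage[of N p, folded q(1)]
      by (intro adapted_basis_mono[OF B[folded p_def]] image_subsetI) simp
    show "adapted_basis K (spc N (q + (0, 1))) ((\<lambda>U. tr N q (q + (0, 1)) ` U) ` Collect (flag N q)) (B (q + (0, 1)))"
      using flag.image[of N q] by (intro adapted_basis_mono[OF C] image_subsetI) simp
  qed (auto intro: flag.intros)
  then show ?thesis
    using ne unfolding basis_edge_def p_def[symmetric] by (intro exI[of _ E]) auto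
qed

text \<open>Recursion over the layers. All points of a layer can be treated at once, because x and y
  change the layer by one, so that no edge joins two points of the same layer.\<close>

lemma extend_bases_right:
  assumes N: "pfd_rep K N" "xy_zero N"
    and B0: "\<And>p. fst p = snd p \<Longrightarrow> adapted_basis K (spc N p) (Collect (flag N p)) (B0 p)"
  shows "\<exists>B. \<forall>p. (fst p = snd p \<longrightarrow> B p = B0 p) \<and>
    (snd p \<le> fst p \<longrightarrow> vectorspace.basis K (spc N p) (B p) \<and>
       basis_edge N p (p + (1, 0)) B \<and> basis_edge N (p - (0, 1)) p B)"
proof -
  let ?ad = "\<lambda>p E. adapted_basis K (spc N p) (Collect (flag N p)) E"
  let ?P = "\<lambda>n f. (n = 0 \<longrightarrow> f = B0) \<and> (\<forall>p. fst p - snd p = int n \<longrightarrow> ?ad p (f p))"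
  \<comment> \<open>\<open>f n\<close> matters only on layer n. The update
    \<open>f(q := g q)\<close> puts the new basis at \<open>q\<close> beside the old ones at its two
    neighbours, which is all that these two edges see.\<close>
  let ?Q = "\<lambda>n f g. \<forall>q. fst q - snd q = int n + 1 \<longrightarrow>
      basis_edge N (q - (1, 0)) q (f(q := g q)) \<and> basis_edge N q (q + (0, 1)) (f(q := g q))"
  have "\<exists>f. \<forall>n. ?P n (f n) \<and> ?Q n (f n) (f (Suc n))"
  proof (rule dependent_nat_choice)
    show "\<exists>f. ?P 0 f" using B0 by (intro exI[of _ B0]) auto
    fix f n assume f: "?P n f"
    have "\<exists>E. ?ad q E \<and> basis_edge N (q - (1, 0)) q (f(q := E)) \<and> basis_edge N q (q + (0, 1)) (f(q := E))"
      if q: "fst q - snd q = int n + 1" for q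
    proof -
      have "fst (q - (1, 0)) - snd (q - (1, 0)) = int n" "fst (q + (0, 1)) - snd (q + (0, 1)) = int n"
        using q by (cases q; simp)+
      then have "?ad (q - (1, 0)) (f (q - (1, 0)))" "?ad (q + (0, 1)) (f (q + (0, 1)))"
        using f by simp_all
      then show ?thesis by (rule flag_basis_step[OF N])
    qed
    then obtain g where "\<And>q. fst q - snd q = int n + 1 \<Longrightarrow> ?ad q (g q) \<and>
        basis_edge N (q - (1, 0)) q (f(q := g q)) \<and> basis_edge N q (q + (0, 1)) (f(q := g q))"
      by metis
    then show "\<exists>g. ?P (Suc n) g \<and> ?Q n f g" by (intro exI[of _ g]) auto
  qed
  then obtain f where f: "\<And>n. ?P n (f n)" "\<And>n. ?Q n (f n) (f (Suc n))" by blast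
  define B where "B = (\<lambda>p. f (nat (fst p - snd p)) p)"
  have edge: "basis_edge N (q - (1, 0)) q B" "basis_edge N q (q + (0, 1)) B" if q: "snd q < fst q" for q
  proof -
    define n where "n = nat (fst q - snd q - 1)"
    have n: "fst q - snd q = int n + 1" using q unfolding n_def by simp
    have "fst (q - (1, 0)) - snd (q - (1, 0)) = int n" "fst (q + (0, 1)) - snd (q + (0, 1)) = int n"
      using n by simp_all
    then have "B (q - (1, 0)) = f n (q - (1, 0))" "B (q + (0, 1)) = f n (q + (0, 1))"
      unfolding B_def by (simp_all only: nat_int)
    moreover have "nat (fst q - snd q) = Suc n" using n by simp
    then have "B q = f (Suc n) q" unfolding B_def by simp
    moreover have "q - (1, 0) \<noteq> q" "q + (0, 1) \<noteq> q" by (cases q; simp)+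
    ultimately show "basis_edge N (q - (1, 0)) q B" "basis_edge N q (q + (0, 1)) B"
      using f(2)[of n, rule_format, OF n] unfolding basis_edge_def by auto
  qed
  show ?thesis
  proof (intro exI[of _ B] allI conjI impI)
    fix p :: point
    show "B p = B0 p" if "fst p = snd p" using that f(1)[of 0] unfolding B_def by simp
    assume p: "snd p \<le> fst p"
    then show "vectorspace.basis K (spc N p) (B p)"
      using f(1)[of "nat (fst p - snd p)"] unfolding B_def adapted_basis_def by auto
    show "basis_edge N p (p + (1, 0)) B" using edge(1)[of "p + (1, 0)"] p by (cases p) simp
    show "basis_edge N (p - (0, 1)) p B" using edge(2)[of "p - (0, 1)"] p by (cases p) simp
  qed
qed

text \<open>Exchanging the coordinates exchanges x with y and reflects the layers, so walking left
  in \<open>N\<close> becomes walking right in \<open>swap_rep N\<close>.\<close>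

definition swap_rep :: "('k, 'v) rep \<Rightarrow> ('k, 'v) rep" where
  "swap_rep N = \<lparr>spc = (\<lambda>p. spc N (prod.swap p)), tr = (\<lambda>p q. tr N (prod.swap p) (prod.swap q))\<rparr>"

lemma swap_le [simp]: "prod.swap p \<le> prod.swap q \<longleftrightarrow> p \<le> (q :: point)"
  by (cases p; cases q) auto

lemma pfd_rep_swap:
  assumes "pfd_rep K N"
  shows "pfd_rep K (swap_rep N)"
  unfolding pfd_rep_def swap_rep_def
  using pfd_repD[OF assms] by simp

lemma xy_zero_swap:
  assumes "xy_zero N"
  shows "xy_zero (swap_rep N)"
proof -
  have "prod.swap (p + (1, 1)) = prod.swap p + (1, 1)" for p :: point by (cases p) simp
  then show ?thesis
    using assms unfolding xy_zero_def swap_rep_def by simp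
qed

theorem compatible_bases:
  assumes N: "pfd_rep K N" "xy_zero N"
  obtains B where "\<And>p. vectorspace.basis K (spc N p) (B p)"
    "\<And>p. basis_edge N p (p + (1, 0)) B" "\<And>p. basis_edge N p (p + (0, 1)) B"
proof -
  let ?N = "swap_rep N"
  have N': "pfd_rep K ?N" "xy_zero ?N" using pfd_rep_swap[OF N(1)] xy_zero_swap[OF N(2)] .
  \<comment> \<open>Points of the diagonal are fixed by the swap, so there the flags of
    \<open>N\<close> and of \<open>?N\<close> are two chains in the same space.\<close>
  have "\<exists>E. adapted_basis K (spc N p) (Collect (flag N p) \<union> Collect (flag ?N p)) E"
    if "fst p = snd p" for p
  proof -
    have "spc ?N p = spc N p" using that unfolding swap_rep_def by (cases p) simp
    then have "subspace_chain K (spc N p) (Collect (flag ?N p))"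
      using flag_chain[OF N', of p] by simp
    from vectorspace.adapted_basis_two_chains[OF pfd_repD(1,2)[OF N(1)] flag_chain[OF N] this]
    show ?thesis by blast
  qed
  then obtain B0 where B0: "\<And>p. fst p = snd p \<Longrightarrow>
      adapted_basis K (spc N p) (Collect (flag N p) \<union> Collect (flag ?N p)) (B0 p)"
    by metis
  have "adapted_basis K (spc N p) (Collect (flag N p)) (B0 p)" if "fst p = snd p" for p
    using adapted_basis_mono[OF B0[OF that]] by auto
  from extend_bases_right[OF N this] obtain R where
    R: "\<And>p. fst p = snd p \<Longrightarrow> R p = B0 p" "\<And>p. snd p \<le> fst p \<Longrightarrow> vectorspace.basis K (spc N p) (R p)"
    "\<And>p. snd p \<le> fst p \<Longrightarrow> basis_edge N p (p + (1, 0)) R"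
    "\<And>p. snd p \<le> fst p \<Longrightarrow> basis_edge N (p - (0, 1)) p R"
    by blast
  have "adapted_basis K (spc ?N p) (Collect (flag ?N p)) (B0 p)" if "fst p = snd p" for p
  proof -
    have "spc ?N p = spc N p" using that unfolding swap_rep_def by (cases p) simp
    then show ?thesis using adapted_basis_mono[OF B0[OF that]] by auto
  qed
  from extend_bases_right[OF N' this] obtain L where
    L: "\<And>p. fst p = snd p \<Longrightarrow> L p = B0 p" "\<And>p. snd p \<le> fst p \<Longrightarrow> vectorspace.basis K (spc ?N p) (L p)"
    "\<And>p. snd p \<le> fst p \<Longrightarrow> basis_edge ?N p (p + (1, 0)) L"
    "\<And>p. snd p \<le> fst p \<Longrightarrow> basis_edge ?N (p - (0, 1)) p L"
    by blast
  \<comment> \<open>Both halves agree with \<open>B0\<close> on layer 0. Every edge joins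
    neighbouring layers and is therefore seen entirely by one half.\<close>
  define B where "B = (\<lambda>p. if snd p \<le> fst p then R p else L (prod.swap p))"
  have BR: "B p = R p" if "snd p \<le> fst p" for p using that unfolding B_def by simp
  have BL: "B p = L (prod.swap p)" if "fst p \<le> snd p" for p
  proof (cases "fst p = snd p")
    case True
    then have "prod.swap p = p" by (cases p) simp
    then show ?thesis using True R(1) L(1) unfolding B_def by simp
  next
    case False
    then show ?thesis using that unfolding B_def by simp
  qed
  have edgeR: "basis_edge N p q B" if "basis_edge N p q R" "snd p \<le> fst p" "snd q \<le> fst q" for p q
    using that BR unfolding basis_edge_def by simp
  have edgeL: "basis_edge N p q B"
    if "basis_edge ?N (prod.swap p) (prod.swap q) L" "fst p \<le> snd p" "fst q \<le> snd q" for p q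
    using that BL unfolding basis_edge_def swap_rep_def by simp
  show ?thesis
  proof (rule that[of B])
    fix p :: point
    show "vectorspace.basis K (spc N p) (B p)"
    proof (cases "snd p \<le> fst p")
      case True
      then show ?thesis using R(2) BR by simp
    next
      case False
      then show ?thesis using L(2)[of "prod.swap p"] BL unfolding swap_rep_def by simp
    qed
    show "basis_edge N p (p + (1, 0)) B"
    proof (cases "snd p \<le> fst p")
      case True
      then show ?thesis using edgeR[OF R(3)[OF True]] by (cases p) simp
    next
      case False
      \<comment> \<open>Left of the diagonal, an edge along x in \<open>N\<close> is an edge along y
        in \<open>?N\<close> that ends at the swapped target.\<close>
      have "prod.swap (p + (1, 0)) - (0, 1) = prod.swap p" by (cases p) simp
      then show ?thesis
        using edgeL[of p "p + (1, 0)"] L(4)[of "prod.swap (p + (1, 0))"] False by (cases p) simp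
    qed
    show "basis_edge N p (p + (0, 1)) B"
    proof (cases "fst p \<le> snd p")
      case True
      have "prod.swap (p + (0, 1)) = prod.swap p + (1, 0)" by (cases p) simp
      then show ?thesis
        using edgeL[of p "p + (0, 1)"] L(3)[of "prod.swap p"] True by (cases p) simp
    next
      case False
      then show ?thesis using edgeR[OF R(4)[of "p + (0, 1)"]] by (cases p) simp
    qed
  qed
qed

section \<open>Existence of curve decompositions\<close>

lemma plus_unit_unit [simp]:
  fixes p :: point
  shows "p + (1, 0) + (0, 1) = p + (1, 1)" "p + (0, 1) + (1, 0) = p + (1, 1)"
  by (cases p; simp)+

locale compatible_basis =
  fixes K :: "'k ring" and N :: "('k, 'v) rep" and B :: "point \<Rightarrow> 'v set"
  assumes N: "pfd_rep K N" and xy: "xy_zero N"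
    and basis: "\<And>p. vectorspace.basis K (spc N p) (B p)"
    and edge_x: "\<And>p. basis_edge N p (p + (1, 0)) B"
    and edge_y: "\<And>p. basis_edge N p (p + (0, 1)) B"
begin

abbreviation "E \<equiv> Sigma UNIV B"

text \<open>One step to the right, forwards along x or backwards along y. With this orientation a
  curve becomes a directed path.\<close>

definition St :: "((point \<times> 'v) \<times> (point \<times> 'v)) set" where
  "St = {((p, b), (q, c)) | p b q c. b \<in> B p \<and> c \<in> B q \<and>
     (q = p + (1, 0) \<and> c = tr N p q b \<or> p = q + (0, 1) \<and> b = tr N q p c)}"

text \<open>Asking for a directed path in one of the two directions, instead of taking the generated
  equivalence, gives direct access to the path between two members of a class; the price is a proof
  of transitivity.\<close>

definition conn :: "((point \<times> 'v) \<times> (point \<times> 'v)) set" where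
  "conn = {(d, e). d \<in> E \<and> e \<in> E \<and> ((d, e) \<in> St\<^sup>* \<or> (e, d) \<in> St\<^sup>*)}"

lemma B_basis:
  "module.lin_dep K (spc N p) (B p) = False" "B p \<subseteq> carrier (spc N p)"
  "module.span K (spc N p) (B p) = carrier (spc N p)"
  using basis[of p] by (simp_all add: vectorspace.basis_def[OF pfd_repD(1)[OF N]])

lemma B_carrier: "b \<in> B p \<Longrightarrow> b \<in> carrier (spc N p)"
  using B_basis(2)[of p] by auto

lemma B_finite: "finite (B p)"
  by (rule vectorspace.fin_dim_li_fin[OF pfd_repD(1,2)[OF N] _ B_basis(2)]) (simp add: B_basis)

lemma B_nonzero: "b \<in> B p \<Longrightarrow> b \<noteq> \<zero>\<^bsub>spc N p\<^esub>"
  using vectorspace.vs_zero_lin_dep[OF pfd_repD(1)[OF N] B_basis(2)[of p]] B_basis(1)[of p] by auto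

lemma StE:
  assumes "(d, e) \<in> St"
  obtains (x) p b where "d = (p, b)" "b \<in> B p" "e = (p + (1, 0), tr N p (p + (1, 0)) b)"
      "tr N p (p + (1, 0)) b \<in> B (p + (1, 0))"
    | (y) q c where "e = (q, c)" "c \<in> B q" "d = (q + (0, 1), tr N q (q + (0, 1)) c)"
      "tr N q (q + (0, 1)) c \<in> B (q + (0, 1))"
  using assms unfolding St_def by auto

lemma St_x: "b \<in> B p \<Longrightarrow> tr N p (p + (1, 0)) b \<in> B (p + (1, 0)) \<Longrightarrow>
    ((p, b), (p + (1, 0), tr N p (p + (1, 0)) b)) \<in> St"
  unfolding St_def by auto

lemma St_y: "b \<in> B p \<Longrightarrow> tr N p (p + (0, 1)) b \<in> B (p + (0, 1)) \<Longrightarrow>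
    ((p + (0, 1), tr N p (p + (0, 1)) b), (p, b)) \<in> St"
  unfolding St_def by auto

lemma xy_tr_B:
  assumes "b \<in> B p"
  shows "tr N (p + (0, 1)) (p + (1, 1)) (tr N p (p + (0, 1)) b) \<notin> B (p + (1, 1))"
    "tr N (p + (1, 0)) (p + (1, 1)) (tr N p (p + (1, 0)) b) \<notin> B (p + (1, 1))"
  using xy_zero_x_y[OF N xy B_carrier[OF assms]] B_nonzero by metis+

lemma edge_inj:
  assumes "basis_edge N p q B" "b \<in> B p" "c \<in> B p" "tr N p q b = tr N p q c" "tr N p q b \<in> B q"
  shows "b = c"
proof -
  have "inj_on (tr N p q) {b \<in> B p. tr N p q b \<noteq> \<zero>\<^bsub>spc N q\<^esub>}"
    using assms(1) unfolding basis_edge_def by simp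
  then show ?thesis
    using assms(2-4) B_nonzero[OF assms(5)] B_nonzero[OF assms(5)[unfolded assms(4)]]
    by (simp add: inj_on_def)
qed

text \<open>Two steps of the same kind agree, for steps along y because y is injective on surviving
  basis vectors. Steps of different kinds exclude each other: if the vector is an image under y,
  then x kills it, as xy = 0.\<close>

lemma St_single_valued: "single_valued St"
proof (rule single_valuedI)
  fix d e e' assume *: "(d, e) \<in> St" "(d, e') \<in> St"
  from *(1) show "e = e'"
  proof (cases rule: StE)
    case (x p b)
    note 1 = this
    from *(2) show ?thesis
    proof (cases rule: StE)
      case (x p' b')
      then show ?thesis using 1 by simp
    next
      case (y q c)
      have "p = q + (0, 1)" "b = tr N q (q + (0, 1)) c" using 1 y by auto
      then show ?thesis using 1 y xy_tr_B(1)[of c q] by simp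
    qed
  next
    case (y q c)
    note 1 = this
    from *(2) show ?thesis
    proof (cases rule: StE)
      case (x p' b')
      have "p' = q + (0, 1)" "b' = tr N q (q + (0, 1)) c" using 1 x by auto
      then show ?thesis using 1 x xy_tr_B(1)[of c q] by simp
    next
      case (y q' c')
      then have "q' = q" using 1 by simp
      then show ?thesis using 1 y edge_inj[OF edge_y, of c q c'] by simp
    qed
  qed
qed

text \<open>The mirror image of the previous argument: now x has to be injective on survivors, and a
  vector that arrived along x is killed by y.\<close>

lemma St_converse_single_valued: "single_valued (St\<inverse>)"
proof (rule single_valuedI, unfold converse_iff)
  fix d d' e assume *: "(d, e) \<in> St" "(d', e) \<in> St"
  from *(1) show "d = d'"
  proof (cases rule: StE)
    case (x p b)
    note 1 = this
    from *(2) show ?thesis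
    proof (cases rule: StE)
      case (x p' b')
      then have "p' = p" using 1 by simp
      then show ?thesis using 1 x edge_inj[OF edge_x, of b p b'] by simp
    next
      case (y q c)
      have "q = p + (1, 0)" "c = tr N p (p + (1, 0)) b" using 1 y by auto
      then show ?thesis using 1 y xy_tr_B(2)[of b p] by simp
    qed
  next
    case (y q c)
    note 1 = this
    from *(2) show ?thesis
    proof (cases rule: StE)
      case (x p b)
      have "q = p + (1, 0)" "c = tr N p (p + (1, 0)) b" using 1 x by auto
      then show ?thesis using 1 x xy_tr_B(2)[of b p] by simp
    next
      case (y q' c')
      then show ?thesis using 1 by simp
    qed
  qed
qed

lemma St_E: "(d, e) \<in> St \<Longrightarrow> d \<in> E \<and> e \<in> E"
  unfolding St_def by auto

text \<open>The critical case of transitivity is that of two paths with a common start or a common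
  end. As \<open>St\<close> and its converse are single-valued, one of these paths continues the
  other.\<close>

lemma equiv_conn: "equiv E conn"
proof (rule equivI)
  show "conn \<subseteq> E \<times> E" "refl_on E conn" unfolding conn_def refl_on_def by auto
  show "sym conn" unfolding conn_def sym_def by auto
  show "trans conn"
  proof (rule transI)
    fix d e f assume "(d, e) \<in> conn" "(e, f) \<in> conn"
    then have E: "d \<in> E" "f \<in> E"
      and de: "(d, e) \<in> St\<^sup>* \<or> (e, d) \<in> St\<^sup>*" and ef: "(e, f) \<in> St\<^sup>* \<or> (f, e) \<in> St\<^sup>*"
      unfolding conn_def by auto
    have "(d, f) \<in> St\<^sup>* \<or> (f, d) \<in> St\<^sup>*" if "(e, d) \<in> St\<^sup>*" "(e, f) \<in> St\<^sup>*"
      using single_valued_confluent[OF St_single_valued that] .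
    moreover have "(d, f) \<in> St\<^sup>* \<or> (f, d) \<in> St\<^sup>*" if "(d, e) \<in> St\<^sup>*" "(f, e) \<in> St\<^sup>*"
    proof -
      have "(e, d) \<in> (St\<inverse>)\<^sup>*" "(e, f) \<in> (St\<inverse>)\<^sup>*" using that by (simp_all add: rtrancl_converse)
      from single_valued_confluent[OF St_converse_single_valued this]
      show ?thesis by (auto simp: rtrancl_converse)
    qed
    ultimately have "(d, f) \<in> St\<^sup>* \<or> (f, d) \<in> St\<^sup>*"
      using de ef by (meson rtrancl_trans)
    then show "(d, f) \<in> conn" using E unfolding conn_def by auto
  qed
qed

text \<open>A path moves weakly right and weakly down. If its ends share a row, every step was along
  x, and if they share a column, every step was along y; in both cases the path composes to a
  structure map.\<close>

lemma St_path:
  assumes "(d, e) \<in> St\<^sup>*" "d \<in> E"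
  shows "e \<in> E \<and> fst (fst d) \<le> fst (fst e) \<and> snd (fst e) \<le> snd (fst d) \<and>
    (snd (fst d) = snd (fst e) \<longrightarrow> tr N (fst d) (fst e) (snd d) = snd e) \<and>
    (fst (fst d) = fst (fst e) \<longrightarrow> tr N (fst e) (fst d) (snd e) = snd d)"
  using assms(1)
proof (induction rule: rtrancl_induct)
  case base
  have "snd d \<in> carrier (spc N (fst d))" using assms(2) B_carrier by auto
  then show ?case using assms(2) pfd_repD(4)[OF N] by auto
next
  case (step e f)
  obtain p b where d: "d = (p, b)" "b \<in> carrier (spc N p)" using assms(2) B_carrier by auto
  from step.hyps(2) show ?case
  proof (cases rule: StE)
    case (x q c)
    have "tr N p (q + (1, 0)) b = tr N q (q + (1, 0)) c" if "snd p = snd q"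
    proof -
      have "p \<le> q" using step.IH x d that by (simp add: less_eq_prod_def)
      then have "tr N p (q + (1, 0)) b = tr N q (q + (1, 0)) (tr N p q b)"
        using pfd_repD(5)[OF N _ le_plus_unit(1) d(2)] by simp
      then show ?thesis using step.IH x d that by simp
    qed
    then show ?thesis using step.IH x d by auto
  next
    case (y q c)
    have "tr N q p c = b" if "fst p = fst q"
    proof -
      have "q + (0, 1) \<le> p" using step.IH y d that by (simp add: less_eq_prod_def)
      then have "tr N q p c = tr N (q + (0, 1)) p (tr N q (q + (0, 1)) c)"
        using pfd_repD(5)[OF N le_plus_unit(2) _ B_carrier[OF y(2)]] by simp
      then show ?thesis using step.IH y d that by simp
    qed
    then show ?thesis using step.IH y d by auto
  qed
qed

text \<open>Comparable points joined by a path that runs right and down must share a row or a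
  column, so \<open>St_path\<close> applies.\<close>

lemma conn_tr:
  assumes "((p, b), (q, c)) \<in> conn" "p \<le> q"
  shows "tr N p q b = c"
  using assms St_path[of "(p, b)" "(q, c)"] St_path[of "(q, c)" "(p, b)"]
  unfolding conn_def less_eq_prod_def by auto

text \<open>Consequently a class has at most one vector over each point, and its projection to the
  plane loses no multiplicity.\<close>

lemma conn_same:
  assumes "((p, b), (p, c)) \<in> conn"
  shows "b = c"
proof -
  have "b \<in> B p" using assms unfolding conn_def by auto
  then show ?thesis using conn_tr[OF assms] pfd_repD(4)[OF N B_carrier] by simp
qed

text \<open>If the final image is nonzero, so are all intermediate ones, and \<open>edge_x\<close>
  then makes each of them a basis vector.\<close>

lemma tr_x_conn:
  assumes "b \<in> B p" "tr N p (p + (int m, 0)) b \<noteq> \<zero>\<^bsub>spc N (p + (int m, 0))\<^esub>"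
  shows "tr N p (p + (int m, 0)) b \<in> B (p + (int m, 0)) \<and>
    ((p, b), (p + (int m, 0), tr N p (p + (int m, 0)) b)) \<in> St\<^sup>*"
  using assms(2)
proof (induction m)
  case 0
  have "p + (int 0, 0) = p" by (cases p) simp
  then show ?case using assms(1) pfd_repD(4)[OF N B_carrier[OF assms(1)]] by simp
next
  case (Suc m)
  define r where "r = p + (int m, 0)"
  have r: "p + (int (Suc m), 0) = r + (1, 0)" "p \<le> r" unfolding r_def by (cases p; simp)+
  have tr: "tr N p (r + (1, 0)) b = tr N r (r + (1, 0)) (tr N p r b)"
    using pfd_repD(5)[OF N r(2) le_plus_unit(1) B_carrier[OF assms(1)]] by simp
  then have "tr N p r b \<noteq> \<zero>\<^bsub>spc N r\<^esub>"
    using Suc.prems hom_zero[OF pfd_repD(1)[OF N] pfd_repD(1)[OF N] pfd_repD(3)[OF N le_plus_unit(1)]]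
    unfolding r by metis
  then have IH: "tr N p r b \<in> B r" "((p, b), (r, tr N p r b)) \<in> St\<^sup>*"
    using Suc.IH unfolding r_def by auto
  moreover have "tr N r (r + (1, 0)) (tr N p r b) \<in> B (r + (1, 0))"
    using edge_x[of r] IH Suc.prems tr unfolding r basis_edge_def by auto
  ultimately show ?case
    using St_x[of "tr N p r b" r] tr unfolding r by (metis rtrancl.rtrancl_into_rtrancl)
qed

lemma tr_y_conn:
  assumes "b \<in> B p" "tr N p (p + (0, int m)) b \<noteq> \<zero>\<^bsub>spc N (p + (0, int m))\<^esub>"
  shows "tr N p (p + (0, int m)) b \<in> B (p + (0, int m)) \<and>
    ((p + (0, int m), tr N p (p + (0, int m)) b), (p, b)) \<in> St\<^sup>*"
  using assms(2)
proof (induction m)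
  case 0
  have "p + (0, int 0) = p" by (cases p) simp
  then show ?case using assms(1) pfd_repD(4)[OF N B_carrier[OF assms(1)]] by simp
next
  case (Suc m)
  define r where "r = p + (0, int m)"
  have r: "p + (0, int (Suc m)) = r + (0, 1)" "p \<le> r" unfolding r_def by (cases p; simp)+
  have tr: "tr N p (r + (0, 1)) b = tr N r (r + (0, 1)) (tr N p r b)"
    using pfd_repD(5)[OF N r(2) le_plus_unit(2) B_carrier[OF assms(1)]] by simp
  then have "tr N p r b \<noteq> \<zero>\<^bsub>spc N r\<^esub>"
    using Suc.prems hom_zero[OF pfd_repD(1)[OF N] pfd_repD(1)[OF N] pfd_repD(3)[OF N le_plus_unit(2)]]
    unfolding r by metis
  then have IH: "tr N p r b \<in> B r" "((r, tr N p r b), (p, b)) \<in> St\<^sup>*"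
    using Suc.IH unfolding r_def by auto
  moreover have "tr N r (r + (0, 1)) (tr N p r b) \<in> B (r + (0, 1))"
    using edge_y[of r] IH Suc.prems tr unfolding r basis_edge_def by auto
  ultimately show ?case
    using St_y[of "tr N p r b" r] tr unfolding r by (metis converse_rtrancl_into_rtrancl)
qed

text \<open>A nonzero structure map cannot factor through xy, so \<open>p\<close> and
  \<open>q\<close> share a row or a column.\<close>

lemma tr_conn:
  assumes b: "b \<in> B p" and pq: "p \<le> q" and nz: "tr N p q b \<noteq> \<zero>\<^bsub>spc N q\<^esub>"
  shows "((p, b), (q, tr N p q b)) \<in> conn"
proof -
  have "\<not> p + (1, 1) \<le> q" using xy_zero_tr[OF N xy _ B_carrier[OF b], of q] nz by blast
  then have "fst q = fst p \<or> snd q = snd p" using pq by (auto simp: less_eq_prod_def)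
  then show ?thesis
  proof
    assume "snd q = snd p"
    then have "q = p + (int (nat (fst q - fst p)), 0)"
      using pq by (auto simp: less_eq_prod_def prod_eq_iff)
    then show ?thesis using tr_x_conn[OF b] nz b unfolding conn_def by (metis (no_types, lifting) SigmaI UNIV_I case_prodI mem_Collect_eq)
  next
    assume "fst q = fst p"
    then have "q = p + (0, int (nat (snd q - snd p)))"
      using pq by (auto simp: less_eq_prod_def prod_eq_iff)
    then show ?thesis using tr_y_conn[OF b] nz b unfolding conn_def by (metis (no_types, lifting) SigmaI UNIV_I case_prodI mem_Collect_eq)
  qed
qed

abbreviation cls :: "point \<Rightarrow> 'v \<Rightarrow> (point \<times> 'v) set" where
  "cls p b \<equiv> conn `` {(p, b)}"

lemma cls_eq_iff: "b \<in> B p \<Longrightarrow> c \<in> B q \<Longrightarrow> cls p b = cls q c \<longleftrightarrow> ((p, b), (q, c)) \<in> conn"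
  using eq_equiv_class_iff[OF equiv_conn, of "(p, b)" "(q, c)"] by simp

lemma class_memD:
  assumes "X \<in> E // conn" "(p, b) \<in> X"
  shows "b \<in> B p" "X = cls p b"
proof -
  obtain x where x: "X = conn `` {x}" "x \<in> E" using assms(1) by (rule quotientE)
  then have "(x, (p, b)) \<in> conn" using assms(2) by simp
  then show "b \<in> B p" "X = cls p b"
    using equiv_class_eq[OF equiv_conn] x unfolding conn_def by auto
qed

text \<open>Connectedness follows the path between two members. For convexity, the structure map
  between two comparable members takes one basis vector to the other, so it does not vanish halfway
  either. Two members at distance (1, 1) would contradict xy = 0.\<close>

lemma spread_curve_class:
  assumes X: "X \<in> E // conn"
  shows "spread_curve (fst ` X)"
proof -
  let ?R = "\<lambda>a b. a \<in> fst ` X \<and> b \<in> fst ` X \<and> (a \<le> b \<or> b \<le> a)"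
  have path: "?R\<^sup>*\<^sup>* (fst d) (fst e)" if "(d, e) \<in> St\<^sup>*" "d \<in> X" for d e
  proof -
    have "?R\<^sup>*\<^sup>* (fst d) (fst e) \<and> e \<in> X" using that(1)
    proof (induction rule: rtrancl_induct)
      case base
      then show ?case using that by simp
    next
      case (step e f)
      have "(e, f) \<in> conn" using step.hyps(2) St_E[OF step.hyps(2)] unfolding conn_def by auto
      then have "f \<in> X" using in_quotient_imp_closed[OF equiv_conn X] step.IH by blast
      moreover have "fst e \<le> fst f \<or> fst f \<le> fst e"
        using step.hyps(2) by (cases rule: StE) auto
      ultimately have "?R (fst e) (fst f)" using step.IH by auto
      then show ?case using step.IH \<open>f \<in> X\<close> by (auto intro: rtranclp.rtrancl_into_rtrancl)
    qed
    then show ?thesis by simp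
  qed
  have "symp ?R" by (auto simp: symp_def)
  then have sym: "?R\<^sup>*\<^sup>* b a" if "?R\<^sup>*\<^sup>* a b" for a b
    using that symp_rtranclp[of ?R] by (auto dest: sympD)
  have conn: "(d, e) \<in> conn" if "d \<in> X" "e \<in> X" for d e
    using in_quotient_imp_in_rel[OF equiv_conn X] that by simp
  have "X \<noteq> {}" using in_quotient_imp_non_empty[OF equiv_conn X] .
  moreover have "poset_connected (fst ` X)"
    unfolding poset_connected_def
  proof (intro ballI, elim imageE)
    fix p q d e assume "p = fst d" "d \<in> X" "q = fst e" "e \<in> X"
    moreover from this have "(d, e) \<in> St\<^sup>* \<or> (e, d) \<in> St\<^sup>*" using conn unfolding conn_def by auto
    ultimately show "?R\<^sup>*\<^sup>* p q" using path sym by blast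
  qed
  moreover have "poset_convex (fst ` X)"
    unfolding poset_convex_def
  proof (intro ballI allI impI, elim imageE)
    fix p r q d e assume pqr: "p \<le> q \<and> q \<le> r" and *: "p = fst d" "d \<in> X" "r = fst e" "e \<in> X"
    define b where "b = snd d"
    have d: "(p, b) \<in> X" "b \<in> B p" using * class_memD[OF X, of p b] unfolding b_def by auto
    have e: "(r, snd e) \<in> X" "snd e \<in> B r" using * class_memD[OF X, of r "snd e"] by auto
    have "tr N p r b = snd e" using conn_tr[OF conn[OF d(1) e(1)]] pqr by auto
    then have "tr N q r (tr N p q b) \<noteq> \<zero>\<^bsub>spc N r\<^esub>"
      using pfd_repD(5)[OF N _ _ B_carrier[OF d(2)]] pqr B_nonzero[OF e(2)] by simp
    then have "tr N p q b \<noteq> \<zero>\<^bsub>spc N q\<^esub>"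
      using hom_zero[OF pfd_repD(1)[OF N] pfd_repD(1)[OF N] pfd_repD(3)[OF N]] pqr by metis
    then have "((p, b), (q, tr N p q b)) \<in> conn" using tr_conn[OF d(2)] pqr by auto
    then have "(q, tr N p q b) \<in> X" using in_quotient_imp_closed[OF equiv_conn X d(1)] by simp
    then show "q \<in> fst ` X" by force
  qed
  moreover have "\<forall>p\<in>fst ` X. p + (1, 1) \<notin> fst ` X"
  proof (intro ballI notI, elim imageE)
    fix p d e assume *: "p = fst d" "d \<in> X" "p + (1, 1) = fst e" "e \<in> X"
    define b where "b = snd d"
    have d: "(p, b) \<in> X" "b \<in> B p" using * class_memD[OF X, of p b] unfolding b_def by auto
    have e: "(p + (1, 1), snd e) \<in> X" "snd e \<in> B (p + (1, 1))"
      using * class_memD[OF X, of "p + (1, 1)" "snd e"] by auto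
    show False
      using conn_tr[OF conn[OF d(1) e(1)]] xy_zero_tr[OF N xy order.refl B_carrier[OF d(2)]]
        B_nonzero[OF e(2)] by simp
  qed
  ultimately show ?thesis unfolding spread_curve_def by auto
qed

text \<open>Distinct classes may project to the same curve. The classes over a curve
  \<open>I\<close> are numbered below \<open>D I\<close>, which gives every basis vector the index
  of the summand that it generates; the rest of the construction needs only these index
  properties.\<close>

lemma curve_index:
  "\<exists>(D :: point set \<Rightarrow> nat) (idx :: point \<Rightarrow> 'v \<Rightarrow> point set \<times> nat).
    (\<forall>I. D I \<noteq> 0 \<longrightarrow> spread_curve I) \<and>
    (\<forall>p. bij_betw (idx p) (B p) {j. snd j < D (fst j) \<and> p \<in> fst j}) \<and>
    (\<forall>p q. p \<le> q \<longrightarrow> (\<forall>b\<in>B p. q \<in> fst (idx p b) \<longrightarrow>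
       tr N p q b \<in> B q \<and> idx q (tr N p q b) = idx p b)) \<and>
    (\<forall>p q. p \<le> q \<longrightarrow> (\<forall>b\<in>B p. q \<notin> fst (idx p b) \<longrightarrow> tr N p q b = \<zero>\<^bsub>spc N q\<^esub>))"
proof -
  define J where "J = (\<lambda>I. {X \<in> E // conn. fst ` X = I})"
  have fin: "finite (J I)" for I
  proof (cases "I = {}")
    case True
    then have "J I = {}" using in_quotient_imp_non_empty[OF equiv_conn] unfolding J_def by auto
    then show ?thesis by simp
  next
    case False
    \<comment> \<open>Every class over \<open>I\<close> contains a vector over \<open>p\<close>, so
      there are at most as many such classes as elements of the finite set
      \<open>B p\<close>.\<close>
    then obtain p where "p \<in> I" by auto
    then have "J I \<subseteq> cls p ` B p" using class_memD unfolding J_def by force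
    then show ?thesis using B_finite finite_surj by blast
  qed
  define D where "D = (\<lambda>I. card (J I))"
  have "\<exists>h. bij_betw h (J I) {0..<D I}" for I
    using ex_bij_betw_finite_nat[OF fin] unfolding D_def .
  then obtain h where h: "\<And>I. bij_betw (h I) (J I) {0..<D I}" by metis
  define idx where "idx = (\<lambda>p b. (fst ` cls p b, h (fst ` cls p b) (cls p b)))"
  have J: "cls p b \<in> J (fst ` cls p b)" "p \<in> fst ` cls p b" if "b \<in> B p" for p b
  proof -
    show "cls p b \<in> J (fst ` cls p b)" using that unfolding J_def by (auto intro: quotientI)
    have "(p, b) \<in> cls p b" using equiv_class_self[OF equiv_conn] that by simp
    then show "p \<in> fst ` cls p b" by force
  qed
  show ?thesis
  proof (rule exI[of _ D], rule exI[of _ idx], intro conjI allI ballI impI)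
    fix I assume "D I \<noteq> 0"
    then obtain X where "X \<in> J I" unfolding D_def by fastforce
    then show "spread_curve I" using spread_curve_class unfolding J_def by auto
  next
    fix p
    show "bij_betw (idx p) (B p) {j. snd j < D (fst j) \<and> p \<in> fst j}"
      unfolding bij_betw_def
    proof
      show "inj_on (idx p) (B p)"
      proof (rule inj_onI)
        fix b c assume bc: "b \<in> B p" "c \<in> B p" "idx p b = idx p c"
        then have "cls p b = cls p c"
          using J(1)[OF bc(1)] J(1)[OF bc(2)] h bij_betw_imp_inj_on[OF h] unfolding idx_def
          by (metis (no_types, lifting) inj_on_eq_iff prod.inject)
        then show "b = c" using cls_eq_iff bc conn_same by metis
      qed
      show "idx p ` B p = {j. snd j < D (fst j) \<and> p \<in> fst j}"
      proof (intro equalityI subsetI)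
        fix j assume "j \<in> idx p ` B p"
        then show "j \<in> {j. snd j < D (fst j) \<and> p \<in> fst j}"
          using J bij_betwE[OF h] unfolding idx_def by fastforce
      next
        fix j assume j: "j \<in> {j. snd j < D (fst j) \<and> p \<in> fst j}"
        then have "snd j \<in> h (fst j) ` J (fst j)"
          using bij_betw_imp_surj_on[OF h] by simp
        then obtain X where X: "X \<in> J (fst j)" "h (fst j) X = snd j" by auto
        then have "p \<in> fst ` X" using j unfolding J_def by simp
        then obtain b where b: "(p, b) \<in> X" by auto
        then have "b \<in> B p" "X = cls p b" using class_memD[of X p b] X unfolding J_def by auto
        moreover from this have "fst ` cls p b = fst j" using X unfolding J_def by simp
        ultimately have "idx p b = j" using X unfolding idx_def by simp
        then show "j \<in> idx p ` B p" using \<open>b \<in> B p\<close> by blast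
      qed
    qed
  next
    fix p q b assume b: "p \<le> q" "b \<in> B p" and q: "q \<in> fst (idx p b)"
    then obtain c where "((p, b), (q, c)) \<in> conn" unfolding idx_def by auto
    then have "tr N p q b = c" "c \<in> B q" "cls p b = cls q c"
      using conn_tr b cls_eq_iff unfolding conn_def by auto
    then show "tr N p q b \<in> B q" "idx q (tr N p q b) = idx p b" unfolding idx_def by simp_all
  next
    fix p q b assume b: "p \<le> q" "b \<in> B p" and q: "q \<notin> fst (idx p b)"
    then show "tr N p q b = \<zero>\<^bsub>spc N q\<^esub>" using tr_conn[OF b(2,1)] unfolding idx_def by force
  qed
qed

end

section \<open>Coordinates in a direct sum of curve representations\<close>

abbreviation curve_sum :: "'k ring \<Rightarrow> (point set \<Rightarrow> nat) \<Rightarrow> ('k, point set \<times> nat \<Rightarrow> 'k) rep" where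
  "curve_sum K D \<equiv> sum_rep {(I, n). n < D I} (\<lambda>(I, n). curve_rep K I)"

abbreviation curve_idx :: "(point set \<Rightarrow> nat) \<Rightarrow> (point set \<times> nat) set" where
  "curve_idx D \<equiv> {j. snd j < D (fst j)}"

lemma curve_idx_eq: "{(I, n). n < D I} = curve_idx D"
  by auto

lemma carrier_curve_sum:
  assumes "field K"
  shows "c \<in> carrier (spc (curve_sum K D) p) \<longleftrightarrow>
    c \<in> curve_idx D \<rightarrow>\<^sub>E carrier K \<and> (\<forall>j\<in>curve_idx D. p \<notin> fst j \<longrightarrow> c j = \<zero>\<^bsub>K\<^esub>) \<and>
    finite {j \<in> curve_idx D. c j \<noteq> \<zero>\<^bsub>K\<^esub>}"
proof -
  interpret field K by fact
  show ?thesis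
    unfolding sum_rep_def sum_module_def curve_rep_def curve_idx_eq
    by (auto simp: PiE_iff case_prod_beta split: if_splits)
qed

lemma curve_sum_simps:
  "\<zero>\<^bsub>spc (curve_sum K D) p\<^esub> = (\<lambda>j\<in>curve_idx D. \<zero>\<^bsub>K\<^esub>)"
  "c \<oplus>\<^bsub>spc (curve_sum K D) p\<^esub> d = (\<lambda>j\<in>curve_idx D. c j \<oplus>\<^bsub>K\<^esub> d j)"
  "a \<odot>\<^bsub>spc (curve_sum K D) p\<^esub> c = (\<lambda>j\<in>curve_idx D. a \<otimes>\<^bsub>K\<^esub> c j)"
  "tr (curve_sum K D) p q c = (\<lambda>j\<in>curve_idx D. if p \<in> fst j \<and> q \<in> fst j then c j else \<zero>\<^bsub>K\<^esub>)"
  unfolding sum_rep_def sum_module_def curve_rep_def curve_idx_eq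
  by (auto simp: case_prod_beta)

lemma curve_sum_closed:
  assumes "field K"
  shows "c \<in> carrier (spc (curve_sum K D) p) \<Longrightarrow> d \<in> carrier (spc (curve_sum K D) p) \<Longrightarrow>
      c \<oplus>\<^bsub>spc (curve_sum K D) p\<^esub> d \<in> carrier (spc (curve_sum K D) p)"
    "a \<in> carrier K \<Longrightarrow> c \<in> carrier (spc (curve_sum K D) p) \<Longrightarrow>
      a \<odot>\<^bsub>spc (curve_sum K D) p\<^esub> c \<in> carrier (spc (curve_sum K D) p)"
    "c \<in> carrier (spc (curve_sum K D) p) \<Longrightarrow>
      tr (curve_sum K D) p q c \<in> carrier (spc (curve_sum K D) q)"
proof -
  interpret field K by fact
  show "c \<oplus>\<^bsub>spc (curve_sum K D) p\<^esub> d \<in> carrier (spc (curve_sum K D) p)"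
    if c: "c \<in> carrier (spc (curve_sum K D) p)" and d: "d \<in> carrier (spc (curve_sum K D) p)"
  proof -
    have "finite ({j \<in> curve_idx D. c j \<noteq> \<zero>\<^bsub>K\<^esub>} \<union> {j \<in> curve_idx D. d j \<noteq> \<zero>\<^bsub>K\<^esub>})"
      using c d unfolding carrier_curve_sum[OF assms] by simp
    then have "finite {j \<in> curve_idx D. c j \<oplus>\<^bsub>K\<^esub> d j \<noteq> \<zero>\<^bsub>K\<^esub>}"
      by (rule finite_subset[rotated]) auto
    then show ?thesis
      using c d unfolding carrier_curve_sum[OF assms] curve_sum_simps
      by (auto simp: PiE_iff cong: conj_cong)
  qed
  show "a \<odot>\<^bsub>spc (curve_sum K D) p\<^esub> c \<in> carrier (spc (curve_sum K D) p)"
    if a: "a \<in> carrier K" and c: "c \<in> carrier (spc (curve_sum K D) p)"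
  proof -
    have "finite {j \<in> curve_idx D. c j \<noteq> \<zero>\<^bsub>K\<^esub>}"
      using c unfolding carrier_curve_sum[OF assms] by simp
    then have "finite {j \<in> curve_idx D. a \<otimes>\<^bsub>K\<^esub> c j \<noteq> \<zero>\<^bsub>K\<^esub>}"
      by (rule finite_subset[rotated]) (auto simp: a)
    then show ?thesis
      using a c unfolding carrier_curve_sum[OF assms] curve_sum_simps
      by (auto simp: PiE_iff cong: conj_cong)
  qed
  show "tr (curve_sum K D) p q c \<in> carrier (spc (curve_sum K D) q)"
    if c: "c \<in> carrier (spc (curve_sum K D) p)"
  proof -
    have "finite {j \<in> curve_idx D. c j \<noteq> \<zero>\<^bsub>K\<^esub>}"
      using c unfolding carrier_curve_sum[OF assms] by simp
    then have "finite {j \<in> curve_idx D. (if p \<in> fst j \<and> q \<in> fst j then c j else \<zero>\<^bsub>K\<^esub>) \<noteq> \<zero>\<^bsub>K\<^esub>}"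
      by (rule finite_subset[rotated]) auto
    then show ?thesis
      using c unfolding carrier_curve_sum[OF assms] curve_sum_simps
      by (auto simp: PiE_iff cong: conj_cong)
  qed
qed

text \<open>The natural map goes from the direct sum to \<open>N\<close>, by linear combinations,
  whereas a decomposition asks for an isomorphism in the opposite direction.\<close>

lemma rep_iso_symI:
  assumes closed: "\<And>p v w. v \<in> carrier (spc M p) \<Longrightarrow> w \<in> carrier (spc M p) \<Longrightarrow> v \<oplus>\<^bsub>spc M p\<^esub> w \<in> carrier (spc M p)"
    "\<And>p c v. c \<in> carrier K \<Longrightarrow> v \<in> carrier (spc M p) \<Longrightarrow> c \<odot>\<^bsub>spc M p\<^esub> v \<in> carrier (spc M p)"
    "\<And>p q v. p \<le> q \<Longrightarrow> v \<in> carrier (spc M p) \<Longrightarrow> tr M p q v \<in> carrier (spc M q)"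
    and g: "g \<in> rep_hom K M N" "\<And>p. bij_betw (g p) (carrier (spc M p)) (carrier (spc N p))"
  shows "rep_iso K N M"
proof -
  let ?f = "\<lambda>p. inv_into (carrier (spc M p)) (g p)"
  have hom: "g p \<in> module_hom K (spc M p) (spc N p)" for p
    using g(1) unfolding rep_hom_def by simp
  have comm: "g q (tr M p q v) = tr N p q (g p v)" if "p \<le> q" "v \<in> carrier (spc M p)" for p q v
    using g(1) that unfolding rep_hom_def by simp
  have f: "?f p w \<in> carrier (spc M p)" "g p (?f p w) = w" if "w \<in> carrier (spc N p)" for p w
    using that g(2)[of p] by (auto simp: bij_betw_def inv_into_into f_inv_into_f)
  have f': "?f p (g p v) = v" if "v \<in> carrier (spc M p)" for p v
    using that g(2)[of p] by (auto simp: bij_betw_def)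
  have "?f p \<in> module_hom K (spc N p) (spc M p)" for p
    by (rule module_hom_inv[OF closed(1,2) hom g(2)])
  moreover have "?f q (tr N p q w) = tr M p q (?f p w)" if "p \<le> q" "w \<in> carrier (spc N p)" for p q w
  proof -
    have "tr N p q w = g q (tr M p q (?f p w))" using comm f that by simp
    then show ?thesis using f' closed(3) f that by simp
  qed
  ultimately have "?f \<in> rep_hom K N M" unfolding rep_hom_def by simp
  moreover have "bij_betw (?f p) (carrier (spc N p)) (carrier (spc M p))" for p
    using bij_betw_inv_into[OF g(2)] .
  ultimately show ?thesis unfolding rep_iso_def by (intro bexI[of _ ?f]) simp_all
qed

lemma finsum_mono_neutral_cong:
  assumes "abelian_monoid G" "finite A" "C \<subseteq> A" "\<And>i. i \<in> A - C \<Longrightarrow> f i = \<zero>\<^bsub>G\<^esub>"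
    "\<And>i. i \<in> C \<Longrightarrow> f i = g i" "f \<in> A \<rightarrow> carrier G"
  shows "finsum G f A = finsum G g C"
proof -
  interpret abelian_monoid G by fact
  show ?thesis
    unfolding finsum_def using assms(2-)
    by (intro add.finprod_mono_neutral_cong_right[unfolded finsum_def]) auto
qed

theorem curve_decomposition_exists:
  assumes K: "field K" and N: "pfd_rep K N" "xy_zero N"
  shows "\<exists>D. is_curve_decomposition K N D"
proof -
  interpret K: field K by fact
  obtain B where B: "\<And>p. vectorspace.basis K (spc N p) (B p)"
    "\<And>p. basis_edge N p (p + (1, 0)) B" "\<And>p. basis_edge N p (p + (0, 1)) B"
    using compatible_bases[OF N] by metis
  interpret compatible_basis K N B
    by unfold_locales fact+
  from curve_index obtain D :: "point set \<Rightarrow> nat" and idx where *: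
    "\<forall>I. D I \<noteq> 0 \<longrightarrow> spread_curve I"
    "\<forall>p. bij_betw (idx p) (B p) {j. snd j < D (fst j) \<and> p \<in> fst j}"
    "\<forall>p q. p \<le> q \<longrightarrow> (\<forall>b\<in>B p. q \<in> fst (idx p b) \<longrightarrow>
       tr N p q b \<in> B q \<and> idx q (tr N p q b) = idx p b)"
    "\<forall>p q. p \<le> q \<longrightarrow> (\<forall>b\<in>B p. q \<notin> fst (idx p b) \<longrightarrow> tr N p q b = \<zero>\<^bsub>spc N q\<^esub>)"
    by (elim exE conjE)
  note bij = *(2)[rule_format]
  have tr: "tr N p q b \<in> B q \<and> idx q (tr N p q b) = idx p b"
    if "b \<in> B p" "p \<le> q" "q \<in> fst (idx p b)" for p q b using *(3) that by blast
  have tr0: "tr N p q b = \<zero>\<^bsub>spc N q\<^esub>"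
    if "b \<in> B p" "p \<le> q" "q \<notin> fst (idx p b)" for p q b using *(4) that by blast
  let ?S = "curve_sum K D"
  \<comment> \<open>Coordinate \<open>j\<close> at \<open>p\<close> is used as the coefficient of
    the basis vector at \<open>p\<close> whose index is \<open>j\<close>.\<close>
  define g where "g = (\<lambda>p c. module.lincomb (spc N p) (\<lambda>b. c (idx p b)) (B p))"
  have idx: "snd (idx p b) < D (fst (idx p b))" "p \<in> fst (idx p b)" if "b \<in> B p" for p b
    using bij_betwE[OF bij] that by auto
  have coeff: "(\<lambda>b. c (idx p b)) \<in> B p \<rightarrow> carrier K" if "c \<in> carrier (spc ?S p)" for p c
    using that idx unfolding carrier_curve_sum[OF K] by (auto simp: PiE_iff)
  have hom: "g p \<in> module_hom K (spc ?S p) (spc N p)" for p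
  proof -
    interpret V: vectorspace K "spc N p" using pfd_repD(1)[OF N(1)] .
    have "g p c \<in> carrier (spc N p)" if "c \<in> carrier (spc ?S p)" for c
      unfolding g_def using V.lincomb_closed[OF B_basis(2) coeff[OF that]] .
    moreover have "g p (c \<oplus>\<^bsub>spc ?S p\<^esub> d) = g p c \<oplus>\<^bsub>spc N p\<^esub> g p d"
      if "c \<in> carrier (spc ?S p)" "d \<in> carrier (spc ?S p)" for c d
    proof -
      have "g p (c \<oplus>\<^bsub>spc ?S p\<^esub> d) = V.lincomb (\<lambda>b. c (idx p b) \<oplus>\<^bsub>K\<^esub> d (idx p b)) (B p)"
        unfolding g_def using coeff[OF that(1)] coeff[OF that(2)] idx
        by (intro V.lincomb_cong B_basis) (auto simp: curve_sum_simps Pi_iff)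
      then show ?thesis
        unfolding g_def using V.lincomb_sum[OF B_finite B_basis(2) coeff[OF that(1)] coeff[OF that(2)]]
        by simp
    qed
    moreover have "g p (a \<odot>\<^bsub>spc ?S p\<^esub> c) = a \<odot>\<^bsub>spc N p\<^esub> g p c"
      if "a \<in> carrier K" "c \<in> carrier (spc ?S p)" for a c
    proof -
      have "g p (a \<odot>\<^bsub>spc ?S p\<^esub> c) = V.lincomb (\<lambda>b. a \<otimes>\<^bsub>K\<^esub> c (idx p b)) (B p)"
        unfolding g_def using coeff[OF that(2)] that(1) idx
        by (intro V.lincomb_cong B_basis) (auto simp: curve_sum_simps Pi_iff)
      then show ?thesis
        unfolding g_def using V.lincomb_smult[OF B_basis(2) coeff[OF that(2)] that(1)] by simp
    qed
    ultimately show ?thesis unfolding module_hom_def by simp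
  qed
  have ex1_eq: "a = b" if "\<exists>!x. P x" "P a" "P b" for P :: "('v \<Rightarrow> 'k) \<Rightarrow> bool" and a b
    using that by auto
  have bij_g: "bij_betw (g p) (carrier (spc ?S p)) (carrier (spc N p))" for p
  proof -
    interpret V: vectorspace K "spc N p" using pfd_repD(1)[OF N(1)] .
    have ex1: "\<exists>!a. a \<in> B p \<rightarrow>\<^sub>E carrier K \<and> V.lincomb a (B p) = v" if "v \<in> carrier (spc N p)" for v
      using V.basis_criterion[OF B_finite B_basis(2)] basis[of p] that by simp
    have restr: "g p c = V.lincomb (restrict (\<lambda>b. c (idx p b)) (B p)) (B p)"
      if "c \<in> carrier (spc ?S p)" for c
      unfolding g_def using coeff[OF that] by (intro V.lincomb_cong B_basis) auto
    show ?thesis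
      unfolding bij_betw_def
    proof (intro conjI equalityI subsetI)
      show "inj_on (g p) (carrier (spc ?S p))"
      proof (rule inj_onI)
        fix c d assume cd: "c \<in> carrier (spc ?S p)" "d \<in> carrier (spc ?S p)" "g p c = g p d"
        have "restrict (\<lambda>b. c (idx p b)) (B p) = restrict (\<lambda>b. d (idx p b)) (B p)"
          using coeff[OF cd(1)] coeff[OF cd(2)] restr[OF cd(1)] restr[OF cd(2)] cd(3)
          by (intro ex1_eq[OF ex1[OF hom_closed[OF hom cd(1)]]] conjI) (auto simp: Pi_iff)
        then have eq: "c (idx p b) = d (idx p b)" if "b \<in> B p" for b
          using that by (metis restrict_apply')
        show "c = d"
        proof (rule PiE_ext)
          show "c \<in> curve_idx D \<rightarrow>\<^sub>E carrier K" "d \<in> curve_idx D \<rightarrow>\<^sub>E carrier K"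
            using cd unfolding carrier_curve_sum[OF K] by auto
          fix j assume j: "j \<in> curve_idx D"
          show "c j = d j"
          proof (cases "p \<in> fst j")
            case True
            then have "j \<in> idx p ` B p" using bij_betw_imp_surj_on[OF bij] j by simp
            then show ?thesis using eq by auto
          next
            case False
            then show ?thesis using cd j unfolding carrier_curve_sum[OF K] by simp
          qed
        qed
      qed
    next
      fix v assume "v \<in> g p ` carrier (spc ?S p)"
      then show "v \<in> carrier (spc N p)" using hom_closed[OF hom[of p]] by auto
    next
      fix v assume "v \<in> carrier (spc N p)"
      then obtain a where a: "a \<in> B p \<rightarrow>\<^sub>E carrier K" "V.lincomb a (B p) = v" using ex1 by blast
      \<comment> \<open>The inverse of \<open>idx p\<close> makes sense only for curves through
        \<open>p\<close>; all others must have coordinate 0.\<close>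
      define c where "c = (\<lambda>j\<in>curve_idx D. if p \<in> fst j then a (inv_into (B p) (idx p) j) else \<zero>\<^bsub>K\<^esub>)"
      have inv: "inv_into (B p) (idx p) (idx p b) = b" if "b \<in> B p" for b
        using bij_betw_imp_inj_on[OF bij] that by simp
      have inv_in: "inv_into (B p) (idx p) j \<in> B p" if "j \<in> curve_idx D" "p \<in> fst j" for j
        using bij_betw_imp_surj_on[OF bij, of p] that by (intro inv_into_into) simp
      have "finite (idx p ` B p)" using B_finite by simp
      then have "finite {j \<in> curve_idx D. c j \<noteq> \<zero>\<^bsub>K\<^esub>}"
        using bij_betw_imp_surj_on[OF bij, of p]
        by (elim finite_subset[rotated]) (auto simp: c_def split: if_splits)
      then have cS: "c \<in> carrier (spc ?S p)"
        unfolding carrier_curve_sum[OF K] using a(1) inv_in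
        by (auto simp: c_def PiE_iff)
      have "g p c = V.lincomb a (B p)"
        unfolding g_def using a(1) idx inv
        by (intro V.lincomb_cong B_basis) (auto simp: c_def PiE_iff)
      then show "v \<in> g p ` carrier (spc ?S p)" using cS a(2) by auto
    qed
  qed
  have comm: "g q (tr ?S p q c) = tr N p q (g p c)" if pq: "p \<le> q" and c: "c \<in> carrier (spc ?S p)" for p q c
  proof -
    interpret V: vectorspace K "spc N p" using pfd_repD(1)[OF N(1)] .
    interpret W: vectorspace K "spc N q" using pfd_repD(1)[OF N(1)] .
    interpret T: linear_map K "spc N p" "spc N q" "tr N p q"
      by (rule linear_mapI[OF V.vectorspace_axioms W.vectorspace_axioms pfd_repD(3)[OF N(1) pq]])
    \<comment> \<open>The basis vectors at \<open>p\<close> that survive to \<open>q\<close>, and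
      those at \<open>q\<close> that come from \<open>p\<close>. The structure map is a bijection
      between them that preserves indices; all other terms vanish, at \<open>p\<close> because the
      vector dies and at \<open>q\<close> because the transported coefficient is 0.\<close>
    let ?A = "{b \<in> B p. q \<in> fst (idx p b)}"
    let ?A' = "{b \<in> B q. p \<in> fst (idx q b)}"
    have trc: "tr N p q b \<in> carrier (spc N q)" if "b \<in> B p" for b
      using tr_closed[OF N(1) pq B_carrier[OF that]] .
    have img: "tr N p q ` ?A = ?A'"
    proof (intro equalityI subsetI)
      fix b' assume "b' \<in> tr N p q ` ?A"
      then show "b' \<in> ?A'" using tr[OF _ pq] idx(2)[of _ p] by auto
    next
      fix b' assume b': "b' \<in> ?A'"
      then have "idx q b' \<in> idx p ` B p" using bij_betw_imp_surj_on[OF bij] idx(1)[of b' q] by simp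
      then obtain b where b: "b \<in> B p" "idx p b = idx q b'" by auto
      then have "b \<in> ?A" using b' idx(2)[of b' q] by simp
      moreover from this have "tr N p q b = b'"
        using tr[OF _ pq, of b] b b' bij_betw_imp_inj_on[OF bij[of q]] by (auto simp: inj_on_def)
      ultimately show "b' \<in> tr N p q ` ?A" by blast
    qed
    have inj: "inj_on (tr N p q) ?A"
      using tr[OF _ pq] bij_betw_imp_inj_on[OF bij[of p]] by (intro inj_onI) (metis (mono_tags, lifting) inj_onD mem_Collect_eq)
    have cK: "c (idx p b) \<in> carrier K" if "b \<in> B p" for b using coeff[OF c] that by auto
    have cK': "c (idx q b) \<in> carrier K" if "b \<in> B q" for b
      using c idx[OF that] unfolding carrier_curve_sum[OF K] by (auto simp: PiE_iff)
    have "tr N p q (g p c) = (\<Oplus>\<^bsub>spc N q\<^esub>b\<in>B p. tr N p q (c (idx p b) \<odot>\<^bsub>spc N p\<^esub> b))"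
      unfolding g_def V.lincomb_def using cK B_carrier by (intro T.hom_sum B_basis) auto
    also have "\<dots> = (\<Oplus>\<^bsub>spc N q\<^esub>b\<in>?A. c (idx q (tr N p q b)) \<odot>\<^bsub>spc N q\<^esub> tr N p q b)"
      using cK B_carrier trc tr0[OF _ pq] tr[OF _ pq]
      by (intro finsum_mono_neutral_cong B_finite W.abelian_monoid_axioms) auto
    also have "\<dots> = (\<Oplus>\<^bsub>spc N q\<^esub>b\<in>?A'. c (idx q b) \<odot>\<^bsub>spc N q\<^esub> b)"
      using cK' B_carrier unfolding img[symmetric]
      by (intro W.finsum_reindex[symmetric] inj) (auto simp: img)
    also have "\<dots> = (\<Oplus>\<^bsub>spc N q\<^esub>b\<in>B q. tr ?S p q c (idx q b) \<odot>\<^bsub>spc N q\<^esub> b)"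
      using cK' B_carrier idx[of _ q]
      by (intro finsum_mono_neutral_cong[symmetric] B_finite W.abelian_monoid_axioms)
        (auto simp: curve_sum_simps)
    also have "\<dots> = g q (tr ?S p q c)" unfolding g_def W.lincomb_def ..
    finally show ?thesis ..
  qed
  have "g \<in> rep_hom K ?S N" unfolding rep_hom_def using hom comm by simp
  then have "rep_iso K N ?S"
    using curve_sum_closed[OF K] bij_g by (intro rep_iso_symI) auto
  then show ?thesis unfolding is_curve_decomposition_def using *(1) by blast
qed

section \<open>Counting corners\<close>

text \<open>The target of the coordinate functionals, so that rank-nullity can peel off one curve at
  a time.\<close>

definition scalar_module :: "('k, 'm) ring_scheme \<Rightarrow> ('k, 'k) module" where
  "scalar_module K = \<lparr>carrier = carrier K, mult = mult K, one = one K, zero = zero K, add = add K,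
     smult = mult K\<rparr>"

lemma
  assumes "field K"
  shows vectorspace_scalar_module: "vectorspace K (scalar_module K)"
    and dim_scalar_module: "vectorspace.dim K (scalar_module K) = 1"
proof -
  interpret K: field K by fact
  show vs: "vectorspace K (scalar_module K)"
    by (rule vs_criteria[OF assms])
      (auto simp: scalar_module_def K.l_distr K.r_distr K.m_assoc K.a_ac
        intro!: bexI[of _ "\<ominus>\<^bsub>K\<^esub> _"] K.r_neg)
  interpret V: vectorspace K "scalar_module K" by fact
  have one: "\<one>\<^bsub>K\<^esub> \<in> carrier (scalar_module K)" by (simp add: scalar_module_def)
  have sub: "subspace K (V.span {\<one>\<^bsub>K\<^esub>}) (scalar_module K)"
    using one by (intro V.span_is_subspace) simp
  have "carrier (scalar_module K) \<subseteq> V.span {\<one>\<^bsub>K\<^esub>}"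
  proof
    fix a assume a: "a \<in> carrier (scalar_module K)"
    then have "a \<odot>\<^bsub>scalar_module K\<^esub> \<one>\<^bsub>K\<^esub> \<in> V.span {\<one>\<^bsub>K\<^esub>}"
      using one by (intro V.subspace_smult[OF sub] V.span_self) (simp_all add: scalar_module_def)
    then show "a \<in> V.span {\<one>\<^bsub>K\<^esub>}" using a by (simp add: scalar_module_def)
  qed
  then have "V.span {\<one>\<^bsub>K\<^esub>} = carrier (scalar_module K)"
    using V.subspace_carrier[OF sub] by auto
  then show "V.dim = 1"
    using V.dim1I[of "\<one>\<^bsub>K\<^esub>"] one by (simp add: scalar_module_def)
qed

locale curve_decomposition =
  fixes K :: "'k ring" and N :: "('k, 'v) rep" and D :: "point set \<Rightarrow> nat" and f
  assumes K: "field K" and N: "pfd_rep K N"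
    and f: "f \<in> rep_hom K N (curve_sum K D)"
    and f_bij: "\<And>p. bij_betw (f p) (carrier (spc N p)) (carrier (spc (curve_sum K D) p))"
begin

definition through :: "point \<Rightarrow> (point set \<times> nat) set" where
  "through p = {j \<in> curve_idx D. p \<in> fst j}"

definition supported :: "point \<Rightarrow> (point set \<times> nat) set \<Rightarrow> 'v set" where
  "supported p A = {v \<in> carrier (spc N p). \<forall>j\<in>curve_idx D. j \<notin> A \<longrightarrow> f p v j = \<zero>\<^bsub>K\<^esub>}"

lemma vs_N: "vectorspace K (spc N p)" and fd_N: "vectorspace.fin_dim K (spc N p)"
  using pfd_repD[OF N] by auto

lemma f_hom: "f p \<in> module_hom K (spc N p) (spc (curve_sum K D) p)"
  using f unfolding rep_hom_def by simp

lemma f_tr: "p \<le> q \<Longrightarrow> v \<in> carrier (spc N p) \<Longrightarrow> f q (tr N p q v) = tr (curve_sum K D) p q (f p v)"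
  using f unfolding rep_hom_def by simp

lemma f_closed: "v \<in> carrier (spc N p) \<Longrightarrow> f p v \<in> carrier (spc (curve_sum K D) p)"
  using hom_closed[OF f_hom] .

lemma f_carrier: "v \<in> carrier (spc N p) \<Longrightarrow> j \<in> curve_idx D \<Longrightarrow> f p v j \<in> carrier K"
  using f_closed[of v p] unfolding carrier_curve_sum[OF K] by (auto simp: PiE_iff)

lemma f_outside: "v \<in> carrier (spc N p) \<Longrightarrow> j \<in> curve_idx D \<Longrightarrow> p \<notin> fst j \<Longrightarrow> f p v j = \<zero>\<^bsub>K\<^esub>"
  using f_closed[of v p] unfolding carrier_curve_sum[OF K] by auto

lemma f_add: "v \<in> carrier (spc N p) \<Longrightarrow> w \<in> carrier (spc N p) \<Longrightarrow> j \<in> curve_idx D \<Longrightarrow>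
    f p (v \<oplus>\<^bsub>spc N p\<^esub> w) j = f p v j \<oplus>\<^bsub>K\<^esub> f p w j"
  by (simp add: module_hom_add[OF f_hom] curve_sum_simps)

lemma f_smult: "a \<in> carrier K \<Longrightarrow> v \<in> carrier (spc N p) \<Longrightarrow> j \<in> curve_idx D \<Longrightarrow>
    f p (a \<odot>\<^bsub>spc N p\<^esub> v) j = a \<otimes>\<^bsub>K\<^esub> f p v j"
  by (simp add: module_hom_smult[OF f_hom] curve_sum_simps)

lemma f_coord_hom: "j \<in> curve_idx D \<Longrightarrow> (\<lambda>v. f p v j) \<in> module_hom K (spc N p) (scalar_module K)"
  unfolding module_hom_def scalar_module_def
  using f_carrier f_add f_smult by auto

lemma f_zero: "j \<in> curve_idx D \<Longrightarrow> f p \<zero>\<^bsub>spc N p\<^esub> j = \<zero>\<^bsub>K\<^esub>"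
  using hom_zero[OF vs_N vectorspace_scalar_module[OF K] f_coord_hom] by (simp add: scalar_module_def)

lemma f_eqI:
  assumes "v \<in> carrier (spc N p)" "w \<in> carrier (spc N p)" "\<And>j. j \<in> curve_idx D \<Longrightarrow> f p v j = f p w j"
  shows "v = w"
proof -
  have "f p v = f p w"
    using f_closed[OF assms(1)] f_closed[OF assms(2)] assms(3) unfolding carrier_curve_sum[OF K]
    by (intro PiE_ext[of _ "curve_idx D" "\<lambda>_. carrier K"]) auto
  then show ?thesis
    using bij_betw_imp_inj_on[OF f_bij[of p]] assms(1,2) by (auto dest: inj_onD)
qed

lemma zero_closed: "\<zero>\<^bsub>spc N p\<^esub> \<in> carrier (spc N p)"
  using vectorspace.subspace_zero[OF vs_N vectorspace.subspace_carrier_self[OF vs_N]] .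

lemma f_eq_zero_iff:
  assumes "v \<in> carrier (spc N p)"
  shows "v = \<zero>\<^bsub>spc N p\<^esub> \<longleftrightarrow> (\<forall>j\<in>curve_idx D. f p v j = \<zero>\<^bsub>K\<^esub>)"
  using f_eqI[OF assms zero_closed] f_zero[of _ p] by auto

lemma subspace_supported: "subspace K (supported p A) (spc N p)"
proof -
  interpret V: vectorspace K "spc N p" by (rule vs_N)
  interpret K: field K by (rule K)
  show ?thesis
    by (rule V.subspaceI) (auto simp: supported_def f_add f_smult f_zero)
qed

lemma supported_Int: "supported p A \<inter> supported p B = supported p (A \<inter> B)"
  unfolding supported_def by auto

lemma supported_through: "supported p (through p) = carrier (spc N p)"
  unfolding supported_def through_def using f_outside[of _ p] by auto

lemma single_coord:
  assumes "j \<in> through p" "a \<in> carrier K"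
  obtains v where "v \<in> carrier (spc N p)" "f p v j = a"
    "\<And>i. i \<in> curve_idx D \<Longrightarrow> i \<noteq> j \<Longrightarrow> f p v i = \<zero>\<^bsub>K\<^esub>"
proof -
  interpret K: field K by (rule K)
  let ?c = "\<lambda>i\<in>curve_idx D. if i = j then a else \<zero>\<^bsub>K\<^esub>"
  have "finite {i \<in> curve_idx D. ?c i \<noteq> \<zero>\<^bsub>K\<^esub>}"
    by (rule finite_subset[of _ "{j}"]) auto
  then have "?c \<in> carrier (spc (curve_sum K D) p)"
    using assms unfolding carrier_curve_sum[OF K] through_def by (auto simp: PiE_iff)
  then obtain v where v: "v \<in> carrier (spc N p)" "f p v = ?c"
    using bij_betw_imp_surj_on[OF f_bij[of p]] by (metis (no_types, lifting) imageE)
  show ?thesis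
    by (rule that[of v]) (use v assms in \<open>auto simp: through_def\<close>)
qed

text \<open>The functional of the new index \<open>j\<close> maps onto the scalars, and its kernel
  is the subspace supported on the remaining indices.\<close>

lemma sdim_supported_finite:
  assumes "finite A" "A \<subseteq> through p"
  shows "sdim K (spc N p) (supported p A) = card A"
  using assms
proof (induction A rule: finite_induct)
  case empty
  have "supported p {} = {\<zero>\<^bsub>spc N p\<^esub>}"
    unfolding supported_def using f_eq_zero_iff[of _ p] zero_closed[of p] f_zero[of _ p] by auto
  then show ?case using vectorspace.sdim_zero[OF vs_N] by simp
next
  case (insert j A)
  interpret K: field K by (rule K)
  have j: "j \<in> curve_idx D" using insert.prems unfolding through_def by auto
  have "(\<lambda>v. f p v j) ` supported p (insert j A) = carrier (scalar_module K)"
  proof (intro equalityI subsetI)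
    fix a assume "a \<in> (\<lambda>v. f p v j) ` supported p (insert j A)"
    then show "a \<in> carrier (scalar_module K)"
      using f_carrier[of _ p j] j by (auto simp: supported_def scalar_module_def)
  next
    fix a assume "a \<in> carrier (scalar_module K)"
    then have "a \<in> carrier K" by (simp add: scalar_module_def)
    then obtain v where v: "v \<in> carrier (spc N p)" "f p v j = a"
      "\<And>i. i \<in> curve_idx D \<Longrightarrow> i \<noteq> j \<Longrightarrow> f p v i = \<zero>\<^bsub>K\<^esub>"
      using single_coord[of j p a] insert.prems by auto
    then have "v \<in> supported p (insert j A)" unfolding supported_def by simp
    then show "a \<in> (\<lambda>v. f p v j) ` supported p (insert j A)" using v(2) by blast
  qed
  moreover have "{v \<in> supported p (insert j A). f p v j = \<zero>\<^bsub>scalar_module K\<^esub>} = supported p A"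
    using j insert.hyps(2) unfolding supported_def by (auto simp: scalar_module_def)
  ultimately show ?case
    using rank_nullity_subspace[OF vs_N vectorspace_scalar_module[OF K] f_coord_hom[OF j] fd_N
        subspace_supported[of p "insert j A"]] dim_scalar_module[OF K] insert by simp
qed

text \<open>Infinitely many curves through \<open>p\<close> would give subspaces of arbitrarily
  large dimension.\<close>

lemma finite_through: "finite (through p)"
proof (rule ccontr)
  assume "infinite (through p)"
  then obtain A where A: "A \<subseteq> through p" "finite A" "card A = Suc (vectorspace.dim K (spc N p))"
    using infinite_arbitrarily_large by metis
  then show False
    using sdim_supported_finite[OF A(2,1)] vectorspace.sdim_le_dim[OF vs_N fd_N subspace_supported[of p A]]
    by simp
qed

lemma sdim_supported: "A \<subseteq> through p \<Longrightarrow> sdim K (spc N p) (supported p A) = card A"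
  using sdim_supported_finite finite_subset[OF _ finite_through] by metis

lemma dim_eq_card: "vectorspace.dim K (spc N p) = card (through p)"
  using sdim_supported[of "through p" p] supported_through[of p] by simp

lemma kernel_supported:
  assumes "p \<le> q"
  shows "{v \<in> carrier (spc N p). tr N p q v = \<zero>\<^bsub>spc N q\<^esub>} = supported p {j \<in> through p. q \<notin> fst j}"
proof -
  have "tr N p q v = \<zero>\<^bsub>spc N q\<^esub> \<longleftrightarrow>
      (\<forall>j\<in>curve_idx D. \<not> (j \<in> through p \<and> q \<notin> fst j) \<longrightarrow> f p v j = \<zero>\<^bsub>K\<^esub>)"
    if v: "v \<in> carrier (spc N p)" for v
    using f_eq_zero_iff[OF tr_closed[OF N assms v]] f_tr[OF assms v] f_outside[OF v]
    by (auto simp: curve_sum_simps through_def)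
  then show ?thesis unfolding supported_def by auto
qed

lemma image_supported:
  assumes "q \<le> p"
  shows "tr N q p ` carrier (spc N q) = supported p {j \<in> through p. q \<in> fst j}"
proof (intro equalityI subsetI)
  fix v assume "v \<in> tr N q p ` carrier (spc N q)"
  then obtain w where w: "w \<in> carrier (spc N q)" "v = tr N q p w" by auto
  then show "v \<in> supported p {j \<in> through p. q \<in> fst j}"
    using tr_closed[OF N assms w(1)] f_tr[OF assms w(1)]
    by (auto simp: supported_def curve_sum_simps through_def)
next
  fix v assume v: "v \<in> supported p {j \<in> through p. q \<in> fst j}"
  then have vc: "v \<in> carrier (spc N p)" unfolding supported_def by simp
  \<comment> \<open>The structure map of the direct sum is applied against the order, from
    \<open>p\<close> to the smaller \<open>q\<close>. Its formula is symmetric in the two points, so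
    it serves as the coordinate mask that produces a preimage.\<close>
  define c where "c = tr (curve_sum K D) p q (f p v)"
  have "c \<in> carrier (spc (curve_sum K D) q)"
    unfolding c_def using curve_sum_closed(3)[OF K f_closed[OF vc]] .
  then obtain w where w: "w \<in> carrier (spc N q)" "f q w = c"
    using bij_betw_imp_surj_on[OF f_bij[of q]] by (metis (no_types, lifting) imageE)
  have "tr N q p w = v"
  proof (rule f_eqI[OF tr_closed[OF N assms w(1)] vc])
    fix j assume "j \<in> curve_idx D"
    then show "f p (tr N q p w) j = f p v j"
      using f_tr[OF assms w(1)] w(2) v f_outside[OF vc]
      by (auto simp: c_def curve_sum_simps supported_def through_def)
  qed
  then show "v \<in> tr N q p ` carrier (spc N q)" using w by blast
qed

text \<open>Summing multiplicities over curves is counting indexed copies. Since a corner lies on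
  its curve, finitely many curves contribute.\<close>

lemma corner_sum_eq_card:
  assumes "\<And>I. c I \<subseteq> I"
  shows "corner_sum c D p = card {j \<in> through p. p \<in> c (fst j)}"
proof -
  let ?S = "{I. D I \<noteq> 0 \<and> p \<in> c I}"
  have pc: "p \<in> I" if "p \<in> c I" for I using assms[of I] that by auto
  have "?S \<subseteq> fst ` through p"
  proof
    fix I assume "I \<in> ?S"
    then have "(I, 0) \<in> through p" using assms[of I] unfolding through_def by auto
    then show "I \<in> fst ` through p" by force
  qed
  then have fin: "finite ?S" using finite_through finite_surj by blast
  have "{j \<in> through p. p \<in> c (fst j)} = Sigma ?S (\<lambda>I. {..<D I})"
    using pc unfolding through_def by auto
  then show ?thesis
    unfolding corner_sum_def using card_SigmaI[OF fin, of "\<lambda>I. {..<D I}"] by simp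
qed

lemma card_complement:
  assumes "A \<subseteq> through p" "B \<subseteq> through p"
  shows "card (through p - (A \<union> B)) + card A + card B = card (through p) + card (A \<inter> B)"
proof -
  have fin: "finite A" "finite B" using assms finite_subset[OF _ finite_through] by auto
  have "card (through p - (A \<union> B)) + card (A \<union> B) = card (through p)"
    using assms fin finite_through by (metis card_Diff_subset card_mono finite_UnI le_add_diff_inverse2 le_sup_iff)
  then show ?thesis using card_Un_Int[OF fin] by simp
qed

text \<open>A curve through \<open>p\<close> has a convex corner there if neither x nor y reaches
  it, and an inner concave corner if both do. Images are coordinate subspaces, so
  inclusion-exclusion for curves becomes a relation of dimensions.\<close>

lemma births:
  fixes p
  defines "X \<equiv> tr N (p - (1, 0)) p ` carrier (spc N (p - (1, 0)))"
    and "Y \<equiv> tr N (p - (0, 1)) p ` carrier (spc N (p - (0, 1)))"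
  shows "corner_sum convex_corners D p + sdim K (spc N p) X + sdim K (spc N p) Y =
      vectorspace.dim K (spc N p) + sdim K (spc N p) (X \<inter> Y)"
    and "corner_sum inner_concave_corners D p = sdim K (spc N p) (X \<inter> Y)"
proof -
  let ?A = "{j \<in> through p. p - (1, 0) \<in> fst j}" and ?B = "{j \<in> through p. p - (0, 1) \<in> fst j}"
  have le: "p - (1, 0) \<le> p" "p - (0, 1) \<le> p" by (cases p; simp)+
  have X: "X = supported p ?A" and Y: "Y = supported p ?B"
    unfolding X_def Y_def using image_supported le by auto
  have dims: "sdim K (spc N p) X = card ?A" "sdim K (spc N p) Y = card ?B"
    "sdim K (spc N p) (X \<inter> Y) = card (?A \<inter> ?B)"
    unfolding X Y supported_Int by (intro sdim_supported; auto)+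
  have "{j \<in> through p. p \<in> convex_corners (fst j)} = through p - (?A \<union> ?B)"
    unfolding through_def convex_corners_def by auto
  moreover have "convex_corners I \<subseteq> I" for I unfolding convex_corners_def by auto
  ultimately show "corner_sum convex_corners D p + sdim K (spc N p) X + sdim K (spc N p) Y =
      vectorspace.dim K (spc N p) + sdim K (spc N p) (X \<inter> Y)"
    using corner_sum_eq_card[of convex_corners p] card_complement[of ?A p ?B] dims
    by (simp add: dim_eq_card)
  have "{j \<in> through p. p \<in> inner_concave_corners (fst j)} = ?A \<inter> ?B"
    unfolding through_def inner_concave_corners_def by auto
  moreover have "inner_concave_corners I \<subseteq> I" for I unfolding inner_concave_corners_def by auto
  ultimately show "corner_sum inner_concave_corners D p = sdim K (spc N p) (X \<inter> Y)"
    using corner_sum_eq_card[of inner_concave_corners p] dims by simp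
qed

text \<open>Dual to \<open>births\<close>: now concave corners belong to the intersection of the two
  kernels, and inner convex corners to the complement of both.\<close>

lemma deaths:
  fixes p
  defines "X \<equiv> {v \<in> carrier (spc N p). tr N p (p + (1, 0)) v = \<zero>\<^bsub>spc N (p + (1, 0))\<^esub>}"
    and "Y \<equiv> {v \<in> carrier (spc N p). tr N p (p + (0, 1)) v = \<zero>\<^bsub>spc N (p + (0, 1))\<^esub>}"
  shows "corner_sum inner_convex_corners D p + sdim K (spc N p) X + sdim K (spc N p) Y =
      vectorspace.dim K (spc N p) + sdim K (spc N p) (X \<inter> Y)"
    and "corner_sum concave_corners D p = sdim K (spc N p) (X \<inter> Y)"
proof -
  let ?A = "{j \<in> through p. p + (1, 0) \<notin> fst j}" and ?B = "{j \<in> through p. p + (0, 1) \<notin> fst j}"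
  have X: "X = supported p ?A" and Y: "Y = supported p ?B"
    unfolding X_def Y_def using kernel_supported by auto
  have dims: "sdim K (spc N p) X = card ?A" "sdim K (spc N p) Y = card ?B"
    "sdim K (spc N p) (X \<inter> Y) = card (?A \<inter> ?B)"
    unfolding X Y supported_Int by (intro sdim_supported; auto)+
  have "{j \<in> through p. p \<in> inner_convex_corners (fst j)} = through p - (?A \<union> ?B)"
    unfolding through_def inner_convex_corners_def by auto
  moreover have "inner_convex_corners I \<subseteq> I" for I unfolding inner_convex_corners_def by auto
  ultimately show "corner_sum inner_convex_corners D p + sdim K (spc N p) X + sdim K (spc N p) Y =
      vectorspace.dim K (spc N p) + sdim K (spc N p) (X \<inter> Y)"
    using corner_sum_eq_card[of inner_convex_corners p] card_complement[of ?A p ?B] dims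
    by (simp add: dim_eq_card)
  have "{j \<in> through p. p \<in> concave_corners (fst j)} = ?A \<inter> ?B"
    unfolding through_def concave_corners_def by auto
  moreover have "concave_corners I \<subseteq> I" for I unfolding concave_corners_def by auto
  ultimately show "corner_sum concave_corners D p = sdim K (spc N p) (X \<inter> Y)"
    using corner_sum_eq_card[of concave_corners p] dims by simp
qed

text \<open>The right-hand side involves only \<open>D\<close>, so all ranks are determined by the
  multiset of curves.\<close>

lemma rank_eq_card:
  assumes "q \<le> p"
  shows "sdim K (spc N p) (tr N q p ` carrier (spc N q)) = card {j \<in> curve_idx D. p \<in> fst j \<and> q \<in> fst j}"
proof -
  have "{j \<in> through p. q \<in> fst j} = {j \<in> curve_idx D. p \<in> fst j \<and> q \<in> fst j}"
    unfolding through_def by auto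
  then show ?thesis
    using image_supported[OF assms] sdim_supported[of "{j \<in> through p. q \<in> fst j}" p] by auto
qed

end

section \<open>Quotients\<close>

text \<open>Each vector space axiom is transported along \<open>T\<close>, which avoids computing
  with cosets when \<open>W\<close> is a quotient.\<close>

lemma vectorspace_surj_image:
  assumes V: "vectorspace K V" and T: "T \<in> module_hom K V W"
    and surj: "T ` carrier V = carrier W" and zero: "T \<zero>\<^bsub>V\<^esub> = \<zero>\<^bsub>W\<^esub>"
  shows "vectorspace K W"
proof -
  interpret V: vectorspace K V by fact
  have lift: "\<exists>v\<in>carrier V. w = T v" if "w \<in> carrier W" for w using that surj by auto
  note T_simps = module_hom_add[OF T, symmetric] module_hom_smult[OF T, symmetric] zero[symmetric]
  have Tc: "T v \<in> carrier W" if "v \<in> carrier V" for v using surj that by auto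
  show ?thesis
  proof (rule vs_criteria)
    show "field K" by (rule V.field_axioms)
    show "\<zero>\<^bsub>W\<^esub> \<in> carrier W" using Tc[of "\<zero>\<^bsub>V\<^esub>"] zero by simp
    show "\<forall>v w. v \<in> carrier W \<and> w \<in> carrier W \<longrightarrow> v \<oplus>\<^bsub>W\<^esub> w \<in> carrier W"
      by (auto dest!: lift simp: T_simps Tc)
    show "\<forall>v\<in>carrier W. \<exists>w\<in>carrier W. v \<oplus>\<^bsub>W\<^esub> w = \<zero>\<^bsub>W\<^esub>"
    proof
      fix w assume "w \<in> carrier W"
      then obtain v where v: "v \<in> carrier V" "w = T v" using lift by auto
      then have "w \<oplus>\<^bsub>W\<^esub> T (\<ominus>\<^bsub>V\<^esub> v) = \<zero>\<^bsub>W\<^esub>" by (simp add: T_simps V.r_neg)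
      then show "\<exists>w'\<in>carrier W. w \<oplus>\<^bsub>W\<^esub> w' = \<zero>\<^bsub>W\<^esub>" using v Tc by blast
    qed
    show "\<forall>c v. c \<in> carrier K \<and> v \<in> carrier W \<longrightarrow> c \<odot>\<^bsub>W\<^esub> v \<in> carrier W"
      by (auto dest!: lift simp: T_simps Tc)
    show "\<forall>v w. v \<in> carrier W \<and> w \<in> carrier W \<longrightarrow> v \<oplus>\<^bsub>W\<^esub> w = w \<oplus>\<^bsub>W\<^esub> v"
      by (auto dest!: lift simp: T_simps V.a_comm)
    show "\<forall>v w x. v \<in> carrier W \<and> w \<in> carrier W \<and> x \<in> carrier W \<longrightarrow>
        (v \<oplus>\<^bsub>W\<^esub> w) \<oplus>\<^bsub>W\<^esub> x = v \<oplus>\<^bsub>W\<^esub> (w \<oplus>\<^bsub>W\<^esub> x)"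
      by (auto dest!: lift simp: T_simps V.a_assoc)
    show "\<forall>v\<in>carrier W. v \<oplus>\<^bsub>W\<^esub> \<zero>\<^bsub>W\<^esub> = v"
      by (auto dest!: lift simp: T_simps)
    show "\<forall>c d v. c \<in> carrier K \<and> d \<in> carrier K \<and> v \<in> carrier W \<longrightarrow>
        (c \<otimes>\<^bsub>K\<^esub> d) \<odot>\<^bsub>W\<^esub> v = c \<odot>\<^bsub>W\<^esub> (d \<odot>\<^bsub>W\<^esub> v)"
      by (auto dest!: lift simp: T_simps V.smult_assoc1)
    show "\<forall>v\<in>carrier W. \<one>\<^bsub>K\<^esub> \<odot>\<^bsub>W\<^esub> v = v"
      by (auto dest!: lift simp: T_simps)
    show "\<forall>c d v. c \<in> carrier K \<and> d \<in> carrier K \<and> v \<in> carrier W \<longrightarrow>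
        (c \<oplus>\<^bsub>K\<^esub> d) \<odot>\<^bsub>W\<^esub> v = c \<odot>\<^bsub>W\<^esub> v \<oplus>\<^bsub>W\<^esub> d \<odot>\<^bsub>W\<^esub> v"
      by (auto dest!: lift simp: T_simps V.smult_l_distr)
    show "\<forall>c v w. c \<in> carrier K \<and> v \<in> carrier W \<and> w \<in> carrier W \<longrightarrow>
        c \<odot>\<^bsub>W\<^esub> (v \<oplus>\<^bsub>W\<^esub> w) = c \<odot>\<^bsub>W\<^esub> v \<oplus>\<^bsub>W\<^esub> c \<odot>\<^bsub>W\<^esub> w"
      by (auto dest!: lift simp: T_simps V.smult_r_distr)
  qed
qed

section \<open>Cosets and quotients by a subspace\<close>

context vectorspace
begin

lemma abelian_subgroup_subspace:
  assumes "subspace K U V"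
  shows "abelian_subgroup U V"
proof (rule abelian_subgroupI3)
  show "abelian_group V" by (rule abelian_group_axioms)
  show "additive_subgroup U V"
    by (rule additive_subgroup.intro, rule subgroup.intro)
      (use assms subspace_carrier subspace_add subspace_zero subspace_neg in
        \<open>auto simp: a_inv_def[symmetric]\<close>)
qed

lemma coset_eq_iff:
  assumes "subspace K U V" "v \<in> carrier V" "w \<in> carrier V"
  shows "U +>\<^bsub>V\<^esub> v = U +>\<^bsub>V\<^esub> w \<longleftrightarrow> v \<ominus>\<^bsub>V\<^esub> w \<in> U"
proof -
  interpret U: abelian_subgroup U V by (rule abelian_subgroup_subspace) fact
  show ?thesis
    unfolding a_minus_def
    using U.a_rcos_module[OF assms(3,2)] U.a_repr_independence'[of v w] U.a_rcos_self[OF assms(2)] assms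
    by metis
qed

lemma mem_coset_iff:
  assumes "subspace K U V" "v \<in> carrier V"
  shows "w \<in> U +>\<^bsub>V\<^esub> v \<longleftrightarrow> w \<in> carrier V \<and> U +>\<^bsub>V\<^esub> w = U +>\<^bsub>V\<^esub> v"
proof -
  interpret U: abelian_subgroup U V by (rule abelian_subgroup_subspace) fact
  show ?thesis
    using U.a_repr_independence'[of w v] U.a_rcos_self[of w] U.a_elemrcos_carrier[OF assms(2)] assms(2) by auto
qed

lemma coset_zero:
  assumes "subspace K U V"
  shows "U +>\<^bsub>V\<^esub> \<zero>\<^bsub>V\<^esub> = U"
  using abelian_subgroup.a_rcos_const[OF abelian_subgroup_subspace[OF assms] subspace_zero[OF assms]] .

lemma coset_eq_self_iff:
  assumes "subspace K U V" "v \<in> carrier V"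
  shows "U +>\<^bsub>V\<^esub> v = U \<longleftrightarrow> v \<in> U"
  using mem_coset_iff[OF assms, of v] assms(2)
    abelian_subgroup.a_rcos_const[OF abelian_subgroup_subspace[OF assms(1)], of v] by auto

text \<open>Operations on quotients are encoded as unions over all representatives; when the result
  is independent of the representative, the union collapses to a single value.\<close>

lemma UN_coset:
  assumes "subspace K U V" "v \<in> carrier V"
    and "\<And>w. w \<in> carrier V \<Longrightarrow> w \<ominus>\<^bsub>V\<^esub> v \<in> U \<Longrightarrow> F w = F v"
  shows "(\<Union>w\<in>U +>\<^bsub>V\<^esub> v. F w) = F v"
proof -
  have "F w = F v" if "w \<in> U +>\<^bsub>V\<^esub> v" for w
    using that assms coset_eq_iff[OF assms(1)] mem_coset_iff[OF assms(1,2)] by auto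
  moreover have "v \<in> U +>\<^bsub>V\<^esub> v" using assms mem_coset_iff by auto
  ultimately show ?thesis by blast
qed

end

context
  fixes K :: "('k, 'm) ring_scheme" and V :: "('k, 'v) module"
  assumes V: "vectorspace K V"
begin

interpretation vectorspace K V by (rule V)

lemma quot_module_simps:
  assumes U: "subspace K U V"
  shows "carrier (quot_module V U) = (\<lambda>v. U +>\<^bsub>V\<^esub> v) ` carrier V"
    and "\<zero>\<^bsub>quot_module V U\<^esub> = U"
    and "v \<in> carrier V \<Longrightarrow> w \<in> carrier V \<Longrightarrow>
      (U +>\<^bsub>V\<^esub> v) \<oplus>\<^bsub>quot_module V U\<^esub> (U +>\<^bsub>V\<^esub> w) = U +>\<^bsub>V\<^esub> (v \<oplus>\<^bsub>V\<^esub> w)"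
    and "c \<in> carrier K \<Longrightarrow> v \<in> carrier V \<Longrightarrow>
      c \<odot>\<^bsub>quot_module V U\<^esub> (U +>\<^bsub>V\<^esub> v) = U +>\<^bsub>V\<^esub> (c \<odot>\<^bsub>V\<^esub> v)"
proof -
  show "carrier (quot_module V U) = (\<lambda>v. U +>\<^bsub>V\<^esub> v) ` carrier V"
    unfolding quot_module_def A_RCOSETS_def' by auto
  show "\<zero>\<^bsub>quot_module V U\<^esub> = U" unfolding quot_module_def by simp
  show "(U +>\<^bsub>V\<^esub> v) \<oplus>\<^bsub>quot_module V U\<^esub> (U +>\<^bsub>V\<^esub> w) = U +>\<^bsub>V\<^esub> (v \<oplus>\<^bsub>V\<^esub> w)"
    if "v \<in> carrier V" "w \<in> carrier V"
    using abelian_subgroup.a_rcos_sum[OF abelian_subgroup_subspace[OF U] that]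
    unfolding quot_module_def by simp
  show "c \<odot>\<^bsub>quot_module V U\<^esub> (U +>\<^bsub>V\<^esub> v) = U +>\<^bsub>V\<^esub> (c \<odot>\<^bsub>V\<^esub> v)"
    if c: "c \<in> carrier K" and v: "v \<in> carrier V"
  proof -
    have "U +>\<^bsub>V\<^esub> (c \<odot>\<^bsub>V\<^esub> w) = U +>\<^bsub>V\<^esub> (c \<odot>\<^bsub>V\<^esub> v)" if w: "w \<in> carrier V" "w \<ominus>\<^bsub>V\<^esub> v \<in> U" for w
    proof -
      have "c \<odot>\<^bsub>V\<^esub> (w \<ominus>\<^bsub>V\<^esub> v) \<in> U" using subspace_smult[OF U c w(2)] .
      then have "c \<odot>\<^bsub>V\<^esub> w \<ominus>\<^bsub>V\<^esub> c \<odot>\<^bsub>V\<^esub> v \<in> U"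
        using c v w by (simp add: a_minus_def smult_r_distr smult_r_minus)
      then show ?thesis using coset_eq_iff[OF U] c v w by simp
    qed
    then show ?thesis
      using UN_coset[OF U v, of "\<lambda>x. U +>\<^bsub>V\<^esub> (c \<odot>\<^bsub>V\<^esub> x)"] unfolding quot_module_def by simp
  qed
qed

lemma coset_hom:
  assumes U: "subspace K U V"
  shows "(\<lambda>v. U +>\<^bsub>V\<^esub> v) \<in> module_hom K V (quot_module V U)"
  unfolding module_hom_def using quot_module_simps[OF U] by auto

lemma vectorspace_quot:
  assumes U: "subspace K U V"
  shows "vectorspace K (quot_module V U)"
  using vectorspace_surj_image[OF vectorspace_axioms coset_hom[OF U]] quot_module_simps[OF U]
    coset_zero[OF U] by simp

lemma fin_dim_quot:
  assumes "fin_dim" and U: "subspace K U V"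
  shows "vectorspace.fin_dim K (quot_module V U)"
  using fin_dim_surj[OF vectorspace_axioms vectorspace_quot[OF U] coset_hom[OF U] assms(1)]
    quot_module_simps(1)[OF U] by simp

lemma sdim_quot:
  assumes "fin_dim" and U: "subspace K U V" and W: "subspace K W V"
  shows "sdim K (quot_module V U) ((\<lambda>v. U +>\<^bsub>V\<^esub> v) ` W) + sdim K V (W \<inter> U) = sdim K V W"
proof -
  have "{w \<in> W. U +>\<^bsub>V\<^esub> w = \<zero>\<^bsub>quot_module V U\<^esub>} = W \<inter> U"
    using subspace_carrier[OF W] coset_eq_self_iff[OF U] quot_module_simps(2)[OF U] by auto
  then show ?thesis
    using rank_nullity_subspace[OF vectorspace_axioms vectorspace_quot[OF U] coset_hom[OF U] assms(1) W]
    by simp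
qed

lemma dim_quot:
  assumes "fin_dim" and U: "subspace K U V"
  shows "vectorspace.dim K (quot_module V U) + sdim K V U = dim"
  using sdim_quot[OF assms subspace_carrier_self, folded quot_module_simps(1)[OF U]] subspace_carrier[OF U]
  by (simp add: Int_absorb1)

end

text \<open>The first isomorphism theorem: \<open>T\<close> is constant on cosets of its kernel, so
  it may be evaluated at a chosen representative.\<close>

lemma quot_lift:
  assumes V: "vectorspace K V" and W: "vectorspace K W" and T: "T \<in> module_hom K V W"
  defines "U \<equiv> {v \<in> carrier V. T v = \<zero>\<^bsub>W\<^esub>}"
  obtains F where "F \<in> module_hom K (quot_module V U) W" "inj_on F (carrier (quot_module V U))"
    "\<And>v. v \<in> carrier V \<Longrightarrow> F (U +>\<^bsub>V\<^esub> v) = T v"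
proof -
  interpret V: vectorspace K V by fact
  interpret W: vectorspace K W by fact
  have U: "subspace K U V" unfolding U_def by (rule subspace_ker) fact+
  have Tc: "T v \<in> carrier W" if "v \<in> carrier V" for v using hom_closed[OF T that] .
  have eq: "U +>\<^bsub>V\<^esub> v = U +>\<^bsub>V\<^esub> w \<longleftrightarrow> T v = T w" if "v \<in> carrier V" "w \<in> carrier V" for v w
  proof -
    have "T v \<ominus>\<^bsub>W\<^esub> T w = \<zero>\<^bsub>W\<^esub> \<longleftrightarrow> T v = T w"
      using Tc[OF that(1)] Tc[OF that(2)] by (metis W.r_neg W.minus_unique W.minus_minus a_minus_def W.a_inv_closed W.l_neg W.minus_equality)
    then show ?thesis
      using V.coset_eq_iff[OF U that] hom_minus[OF V W T that] that unfolding U_def by simp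
  qed
  define F where "F = (\<lambda>X. T (SOME v. v \<in> X))"
  have F: "F (U +>\<^bsub>V\<^esub> v) = T v" if v: "v \<in> carrier V" for v
  proof -
    define s where "s = (SOME w. w \<in> U +>\<^bsub>V\<^esub> v)"
    have "v \<in> U +>\<^bsub>V\<^esub> v" using V.mem_coset_iff[OF U v] v by simp
    then have "s \<in> U +>\<^bsub>V\<^esub> v" unfolding s_def by (rule someI)
    then show ?thesis
      unfolding F_def s_def[symmetric] using V.mem_coset_iff[OF U v] eq[of s v] v by simp
  qed
  show ?thesis
  proof (rule that[OF _ _ F])
    show "F \<in> module_hom K (quot_module V U) W"
      unfolding module_hom_def
      by (auto simp: quot_module_simps[OF V U] F Tc module_hom_add[OF T] module_hom_smult[OF T])
    show "inj_on F (carrier (quot_module V U))"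
      by (auto simp: quot_module_simps[OF V U] inj_on_def F eq)
  qed
qed

text \<open>Changing a representative by an element of \<open>U p\<close> changes its image by an
  element of \<open>U q\<close>; the axioms for the quotient are then inherited from
  \<open>M\<close> through representatives.\<close>

lemma
  assumes M: "pfd_rep K M" and U: "\<And>p. subspace K (U p) (spc M p)"
    and tr_U: "\<And>p q. p \<le> q \<Longrightarrow> tr M p q ` U p \<subseteq> U q"
  shows quot_rep_tr: "p \<le> q \<Longrightarrow> v \<in> carrier (spc M p) \<Longrightarrow>
      tr (quot_rep M U) p q (U p +>\<^bsub>spc M p\<^esub> v) = U q +>\<^bsub>spc M q\<^esub> tr M p q v"
    and pfd_quot_rep: "pfd_rep K (quot_rep M U)"
proof -
  have tr: "tr (quot_rep M U) p q (U p +>\<^bsub>spc M p\<^esub> v) = U q +>\<^bsub>spc M q\<^esub> tr M p q v"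
    if pq: "p \<le> q" and v: "v \<in> carrier (spc M p)" for p q v
  proof -
    interpret V: vectorspace K "spc M p" using pfd_repD(1)[OF M] .
    interpret W: vectorspace K "spc M q" using pfd_repD(1)[OF M] .
    have "U q +>\<^bsub>spc M q\<^esub> tr M p q w = U q +>\<^bsub>spc M q\<^esub> tr M p q v"
      if w: "w \<in> carrier (spc M p)" "w \<ominus>\<^bsub>spc M p\<^esub> v \<in> U p" for w
    proof -
      have "tr M p q (w \<ominus>\<^bsub>spc M p\<^esub> v) \<in> U q" using tr_U[OF pq] w(2) by auto
      then have "tr M p q w \<ominus>\<^bsub>spc M q\<^esub> tr M p q v \<in> U q"
        using hom_minus[OF V.vectorspace_axioms W.vectorspace_axioms pfd_repD(3)[OF M pq] w(1) v] by simp
      then show ?thesis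
        using W.coset_eq_iff[OF U tr_closed[OF M pq w(1)] tr_closed[OF M pq v]] by simp
    qed
    then show ?thesis
      using V.UN_coset[OF U v, of "\<lambda>w. U q +>\<^bsub>spc M q\<^esub> tr M p q w"] unfolding quot_rep_def by simp
  qed
  then show "p \<le> q \<Longrightarrow> v \<in> carrier (spc M p) \<Longrightarrow>
      tr (quot_rep M U) p q (U p +>\<^bsub>spc M p\<^esub> v) = U q +>\<^bsub>spc M q\<^esub> tr M p q v" .
  have spc: "spc (quot_rep M U) p = quot_module (spc M p) (U p)" for p
    unfolding quot_rep_def by simp
  note simps = quot_module_simps[OF pfd_repD(1)[OF M] U]
  show "pfd_rep K (quot_rep M U)"
    unfolding pfd_rep_def spc
  proof (intro conjI allI impI ballI)
    fix p
    show "vectorspace K (quot_module (spc M p) (U p))" "vectorspace.fin_dim K (quot_module (spc M p) (U p))"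
      using vectorspace_quot[OF pfd_repD(1)[OF M] U]
        fin_dim_quot[OF pfd_repD(1)[OF M] pfd_repD(2)[OF M] U] by auto
  next
    fix p q :: point assume pq: "p \<le> q"
    show "tr (quot_rep M U) p q \<in> module_hom K (quot_module (spc M p) (U p)) (quot_module (spc M q) (U q))"
    proof -
      interpret V: vectorspace K "spc M p" using pfd_repD(1)[OF M] .
      show ?thesis
        unfolding module_hom_def
        using tr[OF pq] quot_module_simps[OF pfd_repD(1)[OF M] U[of p]]
          quot_module_simps[OF pfd_repD(1)[OF M] U[of q]] tr_closed[OF M pq]
        by (auto simp: module_hom_add[OF pfd_repD(3)[OF M pq]] module_hom_smult[OF pfd_repD(3)[OF M pq]])
    qed
  next
    fix p X assume "X \<in> carrier (quot_module (spc M p) (U p))"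
    then obtain v where v: "v \<in> carrier (spc M p)" "X = U p +>\<^bsub>spc M p\<^esub> v" using simps(1) by auto
    then show "tr (quot_rep M U) p p X = X" using tr[OF order.refl v(1)] pfd_repD(4)[OF M v(1)] by simp
  next
    fix p q r X assume pqr: "p \<le> q" "q \<le> r" and "X \<in> carrier (quot_module (spc M p) (U p))"
    then obtain v where v: "v \<in> carrier (spc M p)" "X = U p +>\<^bsub>spc M p\<^esub> v" using simps(1) by auto
    then show "tr (quot_rep M U) q r (tr (quot_rep M U) p q X) = tr (quot_rep M U) p r X"
      using tr[OF pqr(1) v(1)] tr[OF pqr(2) tr_closed[OF M pqr(1) v(1)]]
        tr[OF order.trans[OF pqr] v(1)] pfd_repD(5)[OF M pqr v(1)] by simp
  qed
qed

section \<open>The modules \<open>K\<close>, \<open>C\<close>, \<open>TL\<close> and \<open>BR\<close>\<close>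

definition tr_image :: "('k, 'v) rep \<Rightarrow> point \<Rightarrow> point \<Rightarrow> 'v set" where
  "tr_image M p q = tr M p q ` carrier (spc M p)"

definition tr_kernel :: "('k, 'v) rep \<Rightarrow> point \<Rightarrow> point \<Rightarrow> 'v set" where
  "tr_kernel M p q = {v \<in> carrier (spc M p). tr M p q v = \<zero>\<^bsub>spc M q\<^esub>}"

lemma Cmon_eq: "Cmon a M = quot_rep M (\<lambda>p. tr_image M (p - a) p)"
  unfolding Cmon_def coker_rep_def mon_def shift_def tr_image_def by simp

lemma spc_Cmon: "spc (Cmon a M) p = quot_module (spc M p) (tr_image M (p - a) p)"
  unfolding Cmon_eq quot_rep_def by simp

lemma spc_Kmon: "spc (Kmon a M) p = (spc M (p - a))\<lparr>carrier := tr_kernel M (p - a) p\<rparr>"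
  unfolding Kmon_def ker_rep_def sub_rep_def mon_def shift_def tr_kernel_def by simp

lemma tr_Kmon: "tr (Kmon a M) p q = tr M (p - a) (q - a)"
  unfolding Kmon_def ker_rep_def sub_rep_def mon_def shift_def by simp

lemma minus_le:
  fixes p a :: point
  shows "0 \<le> a \<Longrightarrow> p - a \<le> p" "p \<le> q \<Longrightarrow> p - a \<le> q - a"
  by (cases p; cases a; cases q; simp add: less_eq_prod_def)+

lemma subspace_tr_image: "pfd_rep K M \<Longrightarrow> p \<le> q \<Longrightarrow> subspace K (tr_image M p q) (spc M q)"
  unfolding tr_image_def
  using subspace_image[OF pfd_repD(1) pfd_repD(1) pfd_repD(3) vectorspace.subspace_carrier_self[OF pfd_repD(1)]] .

lemma subspace_tr_kernel: "pfd_rep K M \<Longrightarrow> p \<le> q \<Longrightarrow> subspace K (tr_kernel M p q) (spc M p)"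
  unfolding tr_kernel_def using subspace_ker[OF pfd_repD(1) pfd_repD(1) pfd_repD(3)] .

lemma tr_image_tr_image:
  assumes "pfd_rep K M" "p \<le> q" "q \<le> r"
  shows "tr M q r ` tr_image M p q = tr_image M p r"
  unfolding tr_image_def using pfd_repD(5)[OF assms] by (auto simp: image_image)

lemma tr_image_mono:
  assumes "pfd_rep K M" "p \<le> q" "q \<le> r"
  shows "tr_image M p r \<subseteq> tr_image M q r"
  unfolding tr_image_tr_image[OF assms, symmetric]
  using tr_closed[OF assms(1,2)] unfolding tr_image_def by auto

lemma
  assumes M: "pfd_rep K M" and a: "0 \<le> a"
  shows tr_Cmon: "p \<le> q \<Longrightarrow> v \<in> carrier (spc M p) \<Longrightarrow>
      tr (Cmon a M) p q (tr_image M (p - a) p +>\<^bsub>spc M p\<^esub> v) = tr_image M (q - a) q +>\<^bsub>spc M q\<^esub> tr M p q v"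
    and pfd_Cmon: "pfd_rep K (Cmon a M)"
proof -
  have U: "subspace K (tr_image M (p - a) p) (spc M p)" for p
    by (intro subspace_tr_image M minus_le a)
  have "tr M p q ` tr_image M (p - a) p \<subseteq> tr_image M (q - a) q" if "p \<le> q" for p q
    using tr_image_tr_image[OF M minus_le(1)[OF a] that]
      tr_image_mono[OF M minus_le(2)[OF that] minus_le(1)[OF a]] by simp
  note * = quot_rep_tr[OF M U this] pfd_quot_rep[OF M U this]
  show "p \<le> q \<Longrightarrow> v \<in> carrier (spc M p) \<Longrightarrow>
      tr (Cmon a M) p q (tr_image M (p - a) p +>\<^bsub>spc M p\<^esub> v) = tr_image M (q - a) q +>\<^bsub>spc M q\<^esub> tr M p q v"
    "pfd_rep K (Cmon a M)"
    unfolding Cmon_eq using * by auto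
qed

lemma carrier_Cmon:
  assumes M: "pfd_rep K M" and a: "0 \<le> a"
  shows "carrier (spc (Cmon a M) p) = (\<lambda>v. tr_image M (p - a) p +>\<^bsub>spc M p\<^esub> v) ` carrier (spc M p)"
  unfolding spc_Cmon
  by (rule quot_module_simps(1)[OF pfd_repD(1)[OF M] subspace_tr_image[OF M minus_le(1)[OF a]]])

lemma zero_Cmon:
  assumes M: "pfd_rep K M" and a: "0 \<le> a"
  shows "\<zero>\<^bsub>spc (Cmon a M) p\<^esub> = tr_image M (p - a) p"
  unfolding spc_Cmon
  by (rule quot_module_simps(2)[OF pfd_repD(1)[OF M] subspace_tr_image[OF M minus_le(1)[OF a]]])

lemma pfd_Kmon:
  assumes M: "pfd_rep K M" and a: "0 \<le> a"
  shows "pfd_rep K (Kmon a M)"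
  unfolding pfd_rep_def spc_Kmon tr_Kmon
proof (intro conjI allI impI ballI)
  fix p
  have sub: "subspace K (tr_kernel M (p - a) p) (spc M (p - a))"
    using subspace_tr_kernel[OF M minus_le(1)[OF a]] .
  show "vectorspace K ((spc M (p - a))\<lparr>carrier := tr_kernel M (p - a) p\<rparr>)"
    "vectorspace.fin_dim K ((spc M (p - a))\<lparr>carrier := tr_kernel M (p - a) p\<rparr>)"
    using vectorspace.subspace_is_vs[OF pfd_repD(1)[OF M] sub]
      vectorspace.subspace_fin_dim[OF pfd_repD(1,2)[OF M] sub] by auto
  fix q assume pq: "p \<le> q"
  have "tr M (p - a) (q - a) v \<in> tr_kernel M (q - a) q" if v: "v \<in> tr_kernel M (p - a) p" for v
  proof -
    have vc: "v \<in> carrier (spc M (p - a))" "tr M (p - a) p v = \<zero>\<^bsub>spc M p\<^esub>"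
      using v unfolding tr_kernel_def by auto
    have "tr M (q - a) q (tr M (p - a) (q - a) v) = tr M p q (tr M (p - a) p v)"
      using pfd_repD(5)[OF M minus_le(2)[OF pq] minus_le(1)[OF a] vc(1)]
        pfd_repD(5)[OF M minus_le(1)[OF a] pq vc(1)] by simp
    then show ?thesis
      using hom_zero[OF pfd_repD(1)[OF M] pfd_repD(1)[OF M] pfd_repD(3)[OF M pq]] vc
        tr_closed[OF M minus_le(2)[OF pq]] unfolding tr_kernel_def by simp
  qed
  then have "tr M (p - a) (q - a) ` tr_kernel M (p - a) p \<subseteq> tr_kernel M (q - a) q" by auto
  then show "tr M (p - a) (q - a) \<in> module_hom K
      ((spc M (p - a))\<lparr>carrier := tr_kernel M (p - a) p\<rparr>) ((spc M (q - a))\<lparr>carrier := tr_kernel M (q - a) q\<rparr>)"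
    using vectorspace.subspace_carrier[OF pfd_repD(1)[OF M] sub]
    by (intro module_hom_corestrict module_hom_restrict pfd_repD(3)[OF M] minus_le pq) auto
next
  fix p v assume "v \<in> carrier ((spc M (p - a))\<lparr>carrier := tr_kernel M (p - a) p\<rparr>)"
  then show "tr M (p - a) (p - a) v = v"
    using pfd_repD(4)[OF M] unfolding tr_kernel_def by simp
next
  fix p q r v assume "p \<le> q" "q \<le> r" "v \<in> carrier ((spc M (p - a))\<lparr>carrier := tr_kernel M (p - a) p\<rparr>)"
  then show "tr M (q - a) (r - a) (tr M (p - a) (q - a) v) = tr M (p - a) (r - a) v"
    using pfd_repD(5)[OF M minus_le(2) minus_le(2)] unfolding tr_kernel_def by simp
qed

text \<open>By the shift in \<open>Kmon\<close>, the map of \<open>K_xy M\<close> from p to p + (1,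
  1) is the very map from p - (1, 1) to p whose kernel is taken.\<close>

lemma xy_zero_K: 
  assumes "pfd_rep K M"
  shows "xy_zero (K_xy M)"
  unfolding xy_zero_def spc_Kmon tr_Kmon by (auto simp: tr_kernel_def)

lemma xy_zero_C:
  assumes M: "pfd_rep K M"
  shows "xy_zero (C_xy M)"
  unfolding xy_zero_def
proof (intro allI ballI)
  have le: "(0 :: point) \<le> (1, 1)" by (simp add: less_eq_prod_def)
  fix p X assume "X \<in> carrier (spc (C_xy M) p)"
  then obtain v where v: "v \<in> carrier (spc M p)" "X = tr_image M (p - (1, 1)) p +>\<^bsub>spc M p\<^esub> v"
    using carrier_Cmon[OF M le] by auto
  let ?q = "p + (1, 1)"
  have "tr (C_xy M) p ?q X = tr_image M (?q - (1, 1)) ?q +>\<^bsub>spc M ?q\<^esub> tr M p ?q v"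
    unfolding v(2) by (rule tr_Cmon[OF M le _ v(1)]) simp
  moreover have "tr M p ?q v \<in> tr_image M (?q - (1, 1)) ?q"
    unfolding tr_image_def using v(1) by simp
  moreover have "subspace K (tr_image M (?q - (1, 1)) ?q) (spc M ?q)"
    by (intro subspace_tr_image M minus_le le)
  ultimately show "tr (C_xy M) p ?q X = \<zero>\<^bsub>spc (C_xy M) ?q\<^esub>"
    using vectorspace.coset_eq_self_iff[OF pfd_repD(1)[OF M], of _ ?q "tr M p ?q v"]
      tr_closed[OF M le_plus_unit(3) v(1)] zero_Cmon[OF M le] by simp
qed

lemma dec_is_curve_decomposition:
  assumes "field K" "pfd_rep K N" "xy_zero N"
  shows "is_curve_decomposition K N (dec K N)"
  using someI_ex[OF curve_decomposition_exists[OF assms]] unfolding dec_def .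

abbreviation rank :: "('k, 'm) ring_scheme \<Rightarrow> ('k, 'v) rep \<Rightarrow> point \<Rightarrow> point \<Rightarrow> nat" where
  "rank K M p q \<equiv> sdim K (spc M q) (tr_image M p q)"

lemma rank_kernel:
  assumes "pfd_rep K M" "p \<le> q"
  shows "rank K M p q + sdim K (spc M p) (tr_kernel M p q) = vectorspace.dim K (spc M p)"
  using rank_nullity_subspace[OF pfd_repD(1)[OF assms(1)] pfd_repD(1)[OF assms(1)]
      pfd_repD(3)[OF assms] pfd_repD(2)[OF assms(1)] vectorspace.subspace_carrier_self[OF pfd_repD(1)[OF assms(1)]]]
  unfolding tr_image_def tr_kernel_def by simp

text \<open>A common form of \<open>TL\<close> and \<open>BR\<close>, so that the symmetric
  statements are proved once: \<open>a\<close> is the direction of the cokernel, \<open>b\<close>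
  that of the kernel.\<close>

definition corner_rep :: "point \<Rightarrow> point \<Rightarrow> ('k, 'v) rep \<Rightarrow> ('k, 'v set) rep" where
  "corner_rep a b M = im_rep (Kmon b M) (shift (- b) (Cmon a M))
     (\<lambda>p. coker_proj (shift (- a) M) M (mon a M) (p - b))"

lemma TL_eq: "TL M = corner_rep (1, 0) (0, 1) M"
  and BR_eq: "BR M = corner_rep (0, 1) (1, 0) M"
proof -
  have *: "p + (0, - 1) = p - (0, 1)" "p + (- 1, 0) = p - (1, 0)" for p :: point
    by (cases p; simp)+
  show "TL M = corner_rep (1, 0) (0, 1) M" "BR M = corner_rep (0, 1) (1, 0) M"
    unfolding TL_def BR_def corner_rep_def * by simp_all
qed

lemma spc_corner_rep: "spc (corner_rep a b M) p =
    (spc (Cmon a M) (p - b))\<lparr>carrier :=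
      (\<lambda>v. tr_image M (p - b - a) (p - b) +>\<^bsub>spc M (p - b)\<^esub> v) ` tr_kernel M (p - b) p\<rparr>"
  unfolding corner_rep_def im_rep_def sub_rep_def spc_Kmon coker_proj_def
  by (simp add: shift_def mon_def tr_image_def)

lemma tr_corner_rep: "tr (corner_rep a b M) p q = tr (Cmon a M) (p - b) (q - b)"
  unfolding corner_rep_def im_rep_def sub_rep_def shift_def by simp

text \<open>At q = p - b the space is W / (W \<inter> U), where W is the kernel of the map from q to
  p and U the image of the map from q - a to q. The dimension of W \<inter> U is the drop in rank
  when the map from q - a to q is continued to p.\<close>

lemma
  assumes M: "pfd_rep K M" and a: "0 \<le> a" and b: "0 \<le> b"
  shows subspace_corner_rep: "subspace K (carrier (spc (corner_rep a b M) p)) (spc (Cmon a M) (p - b))"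
    and vectorspace_corner_rep: "vectorspace K (spc (corner_rep a b M) p)"
    and fin_dim_corner_rep: "vectorspace.fin_dim K (spc (corner_rep a b M) p)"
    and dim_corner_rep: "dec_points K (corner_rep a b M) p + rank K M (p - b - a) (p - b) + rank K M (p - b) p =
      vectorspace.dim K (spc M (p - b)) + rank K M (p - b - a) p"
proof -
  let ?q = "p - b"
  let ?U = "tr_image M (?q - a) ?q" and ?W = "tr_kernel M ?q p"
  interpret V: vectorspace K "spc M ?q" using pfd_repD(1)[OF M] .
  have le: "?q \<le> p" "?q - a \<le> ?q" using minus_le a b by auto
  have U: "subspace K ?U (spc M ?q)" and W: "subspace K ?W (spc M ?q)"
    using subspace_tr_image[OF M le(2)] subspace_tr_kernel[OF M le(1)] by auto
  have C: "pfd_rep K (Cmon a M)" by (rule pfd_Cmon[OF M a])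
  have carr: "carrier (spc (corner_rep a b M) p) = (\<lambda>v. ?U +>\<^bsub>spc M ?q\<^esub> v) ` ?W"
    unfolding spc_corner_rep by simp
  show sub: "subspace K (carrier (spc (corner_rep a b M) p)) (spc (Cmon a M) ?q)"
    unfolding carr spc_Cmon
    by (rule subspace_image[OF V.vectorspace_axioms vectorspace_quot[OF V.vectorspace_axioms U]
          coset_hom[OF V.vectorspace_axioms U] W])
  have eq: "spc (corner_rep a b M) p = (spc (Cmon a M) ?q)\<lparr>carrier := carrier (spc (corner_rep a b M) p)\<rparr>"
    unfolding carr unfolding spc_corner_rep ..
  show "vectorspace K (spc (corner_rep a b M) p)"
    using vectorspace.subspace_is_vs[OF pfd_repD(1)[OF C] sub] eq by simp
  show "vectorspace.fin_dim K (spc (corner_rep a b M) p)"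
    using vectorspace.subspace_fin_dim[OF pfd_repD(1,2)[OF C] sub] eq by simp
  have "dec_points K (corner_rep a b M) p + sdim K (spc M ?q) (?W \<inter> ?U) = sdim K (spc M ?q) ?W"
    using sdim_quot[OF V.vectorspace_axioms pfd_repD(2)[OF M] U W]
    unfolding dec_points_def spc_corner_rep spc_Cmon by simp
  moreover have "rank K M (?q - a) p + sdim K (spc M ?q) (?W \<inter> ?U) = rank K M (?q - a) ?q"
  proof -
    have "{u \<in> ?U. tr M ?q p u = \<zero>\<^bsub>spc M p\<^esub>} = ?W \<inter> ?U"
      using V.subspace_carrier[OF U] unfolding tr_kernel_def by auto
    then show ?thesis
      using rank_nullity_subspace[OF V.vectorspace_axioms pfd_repD(1)[OF M] pfd_repD(3)[OF M le(1)]
          pfd_repD(2)[OF M] U] tr_image_tr_image[OF M le(2,1)] by simp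
  qed
  moreover have "rank K M ?q p + sdim K (spc M ?q) ?W = V.dim"
    by (rule rank_kernel[OF M le(1)])
  ultimately show "dec_points K (corner_rep a b M) p + rank K M (p - b - a) (p - b) + rank K M (p - b) p =
      vectorspace.dim K (spc M (p - b)) + rank K M (p - b - a) p"
    by linarith
qed

text \<open>As im(xy) is contained in the image along \<open>a\<close>, the modules \<open>M\<close>
  and \<open>C_xy M\<close> have the same cokernel along \<open>a\<close>. The kernel along
  \<open>b\<close> may grow in \<open>C_xy M\<close>, but only by vectors which, modulo the image
  along \<open>a\<close>, can be corrected to elements of the original kernel.\<close>

lemma corner_rep_C_xy:
  assumes M: "pfd_rep K M" and a: "0 \<le> a" and b: "0 \<le> b" and ab: "a + b = (1, 1)"
  shows "rep_iso K (corner_rep a b M) (corner_rep a b (C_xy M))"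
proof -
  let ?C = "C_xy M"
  have c: "(0 :: point) \<le> (1, 1)" by (simp add: less_eq_prod_def)
  have C: "pfd_rep K ?C" by (rule pfd_Cmon[OF M c])
  have CC: "pfd_rep K (Cmon a ?C)" by (rule pfd_Cmon[OF C a])
  let ?p1 = "\<lambda>q v. tr_image M (q - (1, 1)) q +>\<^bsub>spc M q\<^esub> v"
  let ?p2 = "\<lambda>q z. tr_image ?C (q - a) q +>\<^bsub>spc ?C q\<^esub> z"
  let ?pa = "\<lambda>q v. tr_image M (q - a) q +>\<^bsub>spc M q\<^esub> v"
  have sU: "subspace K (tr_image M (q - (1, 1)) q) (spc M q)" for q
    by (intro subspace_tr_image M minus_le c)
  have sUa: "subspace K (tr_image M (q - a) q) (spc M q)" for q
    by (intro subspace_tr_image M minus_le a)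
  have sV: "subspace K (tr_image ?C (q - a) q) (spc ?C q)" for q
    by (intro subspace_tr_image C minus_le a)
  have hom: "(\<lambda>v. ?p2 q (?p1 q v)) \<in> module_hom K (spc M q) (spc (Cmon a ?C) q)" for q
    using module_hom_comp[OF coset_hom[OF pfd_repD(1)[OF M] sU[of q]], of _ "spc (Cmon a ?C) q"]
      coset_hom[OF pfd_repD(1)[OF C] sV[of q]] by (simp add: spc_Cmon)
  have p1c: "?p1 q v \<in> carrier (spc ?C q)" if "v \<in> carrier (spc M q)" for q v
    using that carrier_Cmon[OF M c] by auto
  have tr1: "tr ?C q r (?p1 q v) = ?p1 r (tr M q r v)" if "q \<le> r" "v \<in> carrier (spc M q)" for q r v
    by (rule tr_Cmon[OF M c that])
  have tr2: "tr (Cmon a ?C) q r (?p2 q z) = ?p2 r (tr ?C q r z)" if "q \<le> r" "z \<in> carrier (spc ?C q)" for q r z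
    by (rule tr_Cmon[OF C a that])
  have tra: "tr (Cmon a M) q r (?pa q v) = ?pa r (tr M q r v)" if "q \<le> r" "v \<in> carrier (spc M q)" for q r v
    by (rule tr_Cmon[OF M a that])
  have sub: "tr_image M (q - (1, 1)) q \<subseteq> tr_image M (q - a) q" for q
  proof -
    have "q - (1, 1) = q - a - b" using ab by (metis diff_diff_eq)
    then show ?thesis using tr_image_mono[OF M minus_le(1)[OF b] minus_le(1)[OF a]] by metis
  qed
  \<comment> \<open>Identifying the kernel of the double projection with the image along
    \<open>a\<close> makes the induced map \<open>F\<close> between the two cokernels
    injective.\<close>
  have ker: "{v \<in> carrier (spc M q). ?p2 q (?p1 q v) = \<zero>\<^bsub>spc (Cmon a ?C) q\<^esub>} = tr_image M (q - a) q" for q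
  proof -
    interpret V: vectorspace K "spc M q" using pfd_repD(1)[OF M] .
    have leq: "q - a \<le> q" using minus_le(1)[OF a] .
    have "?p1 q v \<in> tr_image ?C (q - a) q \<longleftrightarrow> v \<in> tr_image M (q - a) q" if v: "v \<in> carrier (spc M q)" for v
    proof
      assume "?p1 q v \<in> tr_image ?C (q - a) q"
      then obtain z where z: "z \<in> carrier (spc ?C (q - a))" "?p1 q v = tr ?C (q - a) q z"
        unfolding tr_image_def by auto
      then obtain w where w: "w \<in> carrier (spc M (q - a))" "z = ?p1 (q - a) w"
        using carrier_Cmon[OF M c] by auto
      then have "?p1 q v = ?p1 q (tr M (q - a) q w)" using z tr1[OF leq w(1)] by simp
      then have "v \<ominus>\<^bsub>spc M q\<^esub> tr M (q - a) q w \<in> tr_image M (q - a) q"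
        using V.coset_eq_iff[OF sU v tr_closed[OF M leq w(1)]] sub[of q] by auto
      moreover have "tr M (q - a) q w \<in> tr_image M (q - a) q" unfolding tr_image_def using w by simp
      ultimately have "(v \<ominus>\<^bsub>spc M q\<^esub> tr M (q - a) q w) \<oplus>\<^bsub>spc M q\<^esub> tr M (q - a) q w \<in> tr_image M (q - a) q"
        using V.subspace_add[OF sUa] by simp
      then show "v \<in> tr_image M (q - a) q"
        using v tr_closed[OF M leq w(1)] by (simp add: a_minus_def V.a_assoc V.l_neg)
    next
      assume "v \<in> tr_image M (q - a) q"
      then obtain w where w: "w \<in> carrier (spc M (q - a))" "v = tr M (q - a) q w"
        unfolding tr_image_def by auto
      then have "?p1 q v = tr ?C (q - a) q (?p1 (q - a) w)" using tr1[OF leq w(1)] by simp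
      then show "?p1 q v \<in> tr_image ?C (q - a) q" using p1c[OF w(1)] unfolding tr_image_def by auto
    qed
    then have "?p2 q (?p1 q v) = \<zero>\<^bsub>spc (Cmon a ?C) q\<^esub> \<longleftrightarrow> v \<in> tr_image M (q - a) q"
      if "v \<in> carrier (spc M q)" for v
      using vectorspace.coset_eq_self_iff[OF pfd_repD(1)[OF C] sV p1c[OF that]] that zero_Cmon[OF C a] by simp
    then show ?thesis using V.subspace_carrier[OF sUa] by auto
  qed
  have "\<exists>F. F \<in> module_hom K (spc (Cmon a M) q) (spc (Cmon a ?C) q) \<and> inj_on F (carrier (spc (Cmon a M) q)) \<and>
      (\<forall>v\<in>carrier (spc M q). F (?pa q v) = ?p2 q (?p1 q v))" for q
    using quot_lift[OF pfd_repD(1)[OF M] pfd_repD(1)[OF CC] hom[of q]] unfolding ker spc_Cmon[of a M]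
    by metis
  then obtain F where F: "\<And>q. F q \<in> module_hom K (spc (Cmon a M) q) (spc (Cmon a ?C) q)"
    "\<And>q. inj_on (F q) (carrier (spc (Cmon a M) q))"
    "\<And>q v. v \<in> carrier (spc M q) \<Longrightarrow> F q (?pa q v) = ?p2 q (?p1 q v)"
    by metis
  let ?f = "\<lambda>p. F (p - b)"
  have carr: "carrier (spc (corner_rep a b M) p) = ?pa (p - b) ` tr_kernel M (p - b) p"
    "carrier (spc (corner_rep a b ?C) p) = ?p2 (p - b) ` tr_kernel ?C (p - b) p" for p
    unfolding spc_corner_rep by simp_all
  have img: "?f p ` carrier (spc (corner_rep a b M) p) = carrier (spc (corner_rep a b ?C) p)" for p
  proof -
    let ?q = "p - b"
    have le: "?q \<le> p" using minus_le(1)[OF b] .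
    interpret V: vectorspace K "spc M ?q" using pfd_repD(1)[OF M] .
    interpret W: vectorspace K "spc M p" using pfd_repD(1)[OF M] .
    show ?thesis
    proof (intro equalityI subsetI)
      fix Z assume "Z \<in> ?f p ` carrier (spc (corner_rep a b M) p)"
      then obtain v where v: "v \<in> tr_kernel M ?q p" "Z = F ?q (?pa ?q v)" unfolding carr by auto
      then have vc: "v \<in> carrier (spc M ?q)" "tr M ?q p v = \<zero>\<^bsub>spc M p\<^esub>" unfolding tr_kernel_def by auto
      have "tr ?C ?q p (?p1 ?q v) = \<zero>\<^bsub>spc ?C p\<^esub>"
        using tr1[OF le vc(1)] vc(2) W.coset_zero[OF sU] zero_Cmon[OF M c] by simp
      then have "?p1 ?q v \<in> tr_kernel ?C ?q p" unfolding tr_kernel_def using p1c[OF vc(1)] by simp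
      then show "Z \<in> carrier (spc (corner_rep a b ?C) p)"
        unfolding carr v(2) F(3)[OF vc(1)] by blast
    next
      fix Z assume "Z \<in> carrier (spc (corner_rep a b ?C) p)"
      then obtain z where z: "z \<in> carrier (spc ?C ?q)" "tr ?C ?q p z = \<zero>\<^bsub>spc ?C p\<^esub>" "Z = ?p2 ?q z"
        unfolding carr tr_kernel_def by auto
      obtain v where v: "v \<in> carrier (spc M ?q)" "z = ?p1 ?q v"
        using z(1) carrier_Cmon[OF M c] by auto
      have eq: "p - (1, 1) = ?q - a" using ab by (metis add.commute diff_diff_eq)
      have "?p1 p (tr M ?q p v) = tr_image M (p - (1, 1)) p"
        using z(2) v tr1[OF le v(1)] zero_Cmon[OF M c] by simp
      then have "tr M ?q p v \<in> tr_image M (p - (1, 1)) p"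
        using W.coset_eq_self_iff[OF sU tr_closed[OF M le v(1)]] by simp
      then have "tr M ?q p v \<in> tr_image M (?q - a) p" unfolding eq .
      then obtain w where w: "w \<in> carrier (spc M (?q - a))" "tr M ?q p v = tr M (?q - a) p w"
        unfolding tr_image_def by auto
      have leq: "?q - a \<le> ?q" using minus_le(1)[OF a] .
      \<comment> \<open>\<open>v\<close> goes to im(xy) at \<open>p\<close>, say to the image of
        \<open>w\<close>. Moving \<open>w\<close> only along \<open>a\<close> gives
        \<open>u\<close>, which has the same image at \<open>p\<close> as \<open>v\<close> and is
        zero in the cokernel, so \<open>v\<close> minus \<open>u\<close> represents the same class
        and lies in the kernel.\<close>
      define u where "u = tr M (?q - a) ?q w"
      have u: "u \<in> carrier (spc M ?q)" "u \<in> tr_image M (?q - a) ?q" "tr M ?q p u = tr M ?q p v"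
        unfolding u_def using tr_closed[OF M leq w(1)] w pfd_repD(5)[OF M leq le w(1)]
        by (auto simp: tr_image_def)
      have "v \<ominus>\<^bsub>spc M ?q\<^esub> u \<in> tr_kernel M ?q p"
        using hom_minus[OF V.vectorspace_axioms W.vectorspace_axioms pfd_repD(3)[OF M le] v(1) u(1)] u(1,3) v(1)
          tr_closed[OF M le v(1)] unfolding tr_kernel_def by (simp add: a_minus_def W.r_neg)
      moreover have "?pa ?q (v \<ominus>\<^bsub>spc M ?q\<^esub> u) = ?pa ?q v"
      proof -
        have "v \<ominus>\<^bsub>spc M ?q\<^esub> (v \<ominus>\<^bsub>spc M ?q\<^esub> u) = u"
          using u(1) v(1) by (simp add: a_minus_def V.minus_add V.r_neg2)
        then show ?thesis
          using V.coset_eq_iff[OF sUa v(1), of "v \<ominus>\<^bsub>spc M ?q\<^esub> u"] u(1,2) v(1) by simp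
      qed
      ultimately have "?pa ?q v \<in> carrier (spc (corner_rep a b M) p)"
        unfolding carr by (metis imageI)
      moreover have "F ?q (?pa ?q v) = Z" using F(3)[OF v(1)] v z by simp
      ultimately show "Z \<in> ?f p ` carrier (spc (corner_rep a b M) p)" by blast
    qed
  qed
  have cor_sub: "carrier (spc (corner_rep a b M) p) \<subseteq> carrier (spc (Cmon a M) (p - b))" for p
    using vectorspace.subspace_carrier[OF pfd_repD(1)[OF pfd_Cmon[OF M a]] subspace_corner_rep[OF M a b]] .
  have fhom: "?f p \<in> module_hom K (spc (corner_rep a b M) p) (spc (corner_rep a b ?C) p)" for p
  proof -
    have 1: "F (p - b) \<in> module_hom K ((spc (Cmon a M) (p - b))\<lparr>carrier := carrier (spc (corner_rep a b M) p)\<rparr>)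
        ((spc (Cmon a ?C) (p - b))\<lparr>carrier := carrier (spc (corner_rep a b ?C) p)\<rparr>)"
      using img[of p] by (intro module_hom_corestrict module_hom_restrict F(1) cor_sub) simp
    show ?thesis using 1 unfolding carr unfolding spc_corner_rep .
  qed
  have "?f q (tr (corner_rep a b M) p q X) = tr (corner_rep a b ?C) p q (?f p X)"
    if pq: "p \<le> q" and X: "X \<in> carrier (spc (corner_rep a b M) p)" for p q X
  proof -
    obtain v where v: "v \<in> carrier (spc M (p - b))" "X = ?pa (p - b) v"
      using X unfolding carr tr_kernel_def by auto
    have le: "p - b \<le> q - b" using minus_le(2)[OF pq] .
    show ?thesis
      unfolding tr_corner_rep v(2)
      using tra[OF le v(1)] F(3)[OF tr_closed[OF M le v(1)]] F(3)[OF v(1)] tr2[OF le p1c[OF v(1)]] tr1[OF le v(1)]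
      by simp
  qed
  then have "?f \<in> rep_hom K (corner_rep a b M) (corner_rep a b ?C)"
    unfolding rep_hom_def using fhom by simp
  moreover have "bij_betw (?f p) (carrier (spc (corner_rep a b M) p)) (carrier (spc (corner_rep a b ?C) p))" for p
    unfolding bij_betw_def using img[of p] inj_on_subset[OF F(2)[of "p - b"] cor_sub[of p]] by simp
  ultimately show ?thesis unfolding rep_iso_def by (intro bexI[of _ ?f]) simp_all
qed

section \<open>The Betti tables\<close>

lemma unit_nonneg [simp]: "(0 :: point) \<le> (1, 0)" "(0 :: point) \<le> (0, 1)" "(0 :: point) \<le> (1, 1)"
  by (simp_all add: less_eq_prod_def)

lemma shift_eq_minus [simp]:
  fixes p :: point
  shows "p + (- 1, 0) = p - (1, 0)" "p + (0, - 1) = p - (0, 1)" "p + (- 1, - 1) = p - (1, 1)"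
  by (cases p; simp)+

lemma square_le [simp]:
  fixes p :: point
  shows "p - (1, 0) \<le> p" "p - (0, 1) \<le> p" "p - (1, 1) \<le> p"
    "p - (1, 1) \<le> p - (1, 0)" "p - (1, 1) \<le> p - (0, 1)"
  by (cases p; simp)+

section \<open>The Koszul differentials and the dimensions of their homology\<close>

lemma kos_d1_image:
  assumes M: "pfd_rep K M"
  shows "kos_d1 M p ` carrier (spc (Kos1 M) p) =
    module.submodule_sum (spc M p) (tr_image M (p - (1, 0)) p) (tr_image M (p - (0, 1)) p)"
proof -
  interpret V: vectorspace K "spc M p" using pfd_repD(1)[OF M] .
  show ?thesis
    unfolding V.submodule_sum_def kos_d1_def Kos1_def prod_rep_def shift_def direct_sum_def tr_image_def
    by force
qed

lemma kos_d1_hom: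
  assumes M: "pfd_rep K M"
  shows "kos_d1 M p \<in> module_hom K (spc (Kos1 M) p) (spc M p)"
proof -
  interpret V: vectorspace K "spc M p" using pfd_repD(1)[OF M] .
  have x: "tr M (p - (1, 0)) p \<in> module_hom K (spc M (p - (1, 0))) (spc M p)"
    and y: "tr M (p - (0, 1)) p \<in> module_hom K (spc M (p - (0, 1))) (spc M p)"
    using pfd_repD(3)[OF M] by simp_all
  show ?thesis
    unfolding module_hom_def kos_d1_def Kos1_def prod_rep_def shift_def direct_sum_def
    using hom_closed[OF x] hom_closed[OF y]
    by (auto simp: module_hom_add[OF x] module_hom_add[OF y] module_hom_smult[OF x] module_hom_smult[OF y]
        V.a_ac V.smult_r_distr)
qed

lemma kos_d2_hom:
  assumes M: "pfd_rep K M"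
  shows "kos_d2 M p \<in> module_hom K (spc M (p - (1, 1))) (spc (Kos1 M) p)"
proof -
  interpret V: vectorspace K "spc M (p - (0, 1))" using pfd_repD(1)[OF M] .
  have x: "tr M (p - (1, 1)) (p - (1, 0)) \<in> module_hom K (spc M (p - (1, 1))) (spc M (p - (1, 0)))"
    and y: "tr M (p - (1, 1)) (p - (0, 1)) \<in> module_hom K (spc M (p - (1, 1))) (spc M (p - (0, 1)))"
    using pfd_repD(3)[OF M] by simp_all
  show ?thesis
    unfolding module_hom_def kos_d2_def Kos1_def prod_rep_def shift_def direct_sum_def
    using hom_closed[OF x] hom_closed[OF y]
    by (auto simp: module_hom_add[OF x] module_hom_add[OF y] module_hom_smult[OF x] module_hom_smult[OF y]
        V.minus_add V.smult_r_minus)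
qed

lemma kos_d1_d2:
  assumes M: "pfd_rep K M" and v: "v \<in> carrier (spc M (p - (1, 1)))"
  shows "kos_d1 M p (kos_d2 M p v) = \<zero>\<^bsub>spc M p\<^esub>"
proof -
  interpret V: vectorspace K "spc M p" using pfd_repD(1)[OF M] .
  have c: "tr M (p - (1, 1)) (p - (0, 1)) v \<in> carrier (spc M (p - (0, 1)))"
    by (rule tr_closed[OF M _ v]) simp
  have "tr M (p - (1, 0)) p (tr M (p - (1, 1)) (p - (1, 0)) v) = tr M (p - (1, 1)) p v"
    "tr M (p - (0, 1)) p (tr M (p - (1, 1)) (p - (0, 1)) v) = tr M (p - (1, 1)) p v"
    using pfd_repD(5)[OF M _ _ v] by simp_all
  moreover have "tr M (p - (1, 1)) p v \<in> carrier (spc M p)"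
    by (rule tr_closed[OF M _ v]) simp
  ultimately show ?thesis
    using hom_neg[OF pfd_repD(1)[OF M] pfd_repD(1)[OF M] pfd_repD(3)[OF M square_le(2)] c]
    unfolding kos_d1_def kos_d2_def by (simp add: V.r_neg)
qed

lemma
  assumes M: "pfd_rep K M"
  shows vectorspace_Kos1: "vectorspace K (spc (Kos1 M) p)"
    and fin_dim_Kos1: "vectorspace.fin_dim K (spc (Kos1 M) p)"
    and dim_Kos1: "vectorspace.dim K (spc (Kos1 M) p) =
      vectorspace.dim K (spc M (p - (1, 0))) + vectorspace.dim K (spc M (p - (0, 1)))"
  unfolding Kos1_def prod_rep_def shift_def
  using direct_sum_is_vs[OF pfd_repD(1)[OF M] pfd_repD(1)[OF M]]
    fin_dim_direct_sum[OF pfd_repD(1)[OF M] pfd_repD(1)[OF M] pfd_repD(2)[OF M] pfd_repD(2)[OF M]]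
    dim_direct_sum[OF pfd_repD(1)[OF M] pfd_repD(1)[OF M] pfd_repD(2)[OF M] pfd_repD(2)[OF M]]
  by simp_all

lemma betti0_dims:
  assumes M: "pfd_rep K M"
  defines "X \<equiv> \<lambda>p. tr_image M (p - (1, 0)) p" and "Y \<equiv> \<lambda>p. tr_image M (p - (0, 1)) p"
  shows "betti0 K M p + rank K M (p - (1, 0)) p + rank K M (p - (0, 1)) p =
    vectorspace.dim K (spc M p) + sdim K (spc M p) (X p \<inter> Y p)"
proof -
  interpret V: vectorspace K "spc M p" using pfd_repD(1)[OF M] .
  have sub: "subspace K (X p) (spc M p)" "subspace K (Y p) (spc M p)"
    unfolding X_def Y_def by (simp_all add: subspace_tr_image[OF M])
  have "spc (kos_H0 M) p = quot_module (spc M p) (V.subspace_sum (X p) (Y p))"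
    unfolding kos_H0_def coker_rep_def quot_rep_def X_def Y_def
    by (simp add: kos_d1_image[OF M])
  then show ?thesis
    using dim_quot[OF V.vectorspace_axioms pfd_repD(2)[OF M] V.sum_is_subspace[OF sub]]
      V.sdim_sum_Int[OF pfd_repD(2)[OF M] sub]
    unfolding betti0_def X_def Y_def by simp
qed

lemma kos_d2_kernel:
  assumes M: "pfd_rep K M"
  shows "{v \<in> carrier (spc M (p - (1, 1))). kos_d2 M p v = \<zero>\<^bsub>spc (Kos1 M) p\<^esub>} =
    tr_kernel M (p - (1, 1)) (p - (1, 0)) \<inter> tr_kernel M (p - (1, 1)) (p - (0, 1))"
proof -
  interpret V: vectorspace K "spc M (p - (0, 1))" using pfd_repD(1)[OF M] .
  have neg: "\<ominus>\<^bsub>spc M (p - (0, 1))\<^esub> w = \<zero>\<^bsub>spc M (p - (0, 1))\<^esub> \<longleftrightarrow> w = \<zero>\<^bsub>spc M (p - (0, 1))\<^esub>"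
    if "w \<in> carrier (spc M (p - (0, 1)))" for w
    using that V.minus_nonzero[of w] V.r_neg[of "\<zero>\<^bsub>spc M (p - (0, 1))\<^esub>"] by auto
  have "tr M (p - (1, 1)) (p - (0, 1)) v \<in> carrier (spc M (p - (0, 1)))"
    if "v \<in> carrier (spc M (p - (1, 1)))" for v
    by (rule tr_closed[OF M _ that]) simp
  then show ?thesis
    unfolding kos_d2_def tr_kernel_def Kos1_def prod_rep_def shift_def direct_sum_def
    by (auto simp: neg)
qed

lemma betti2_dims:
  assumes M: "pfd_rep K M"
  shows "betti2 K M p = sdim K (spc M (p - (1, 1)))
    (tr_kernel M (p - (1, 1)) (p - (1, 0)) \<inter> tr_kernel M (p - (1, 1)) (p - (0, 1)))"
  unfolding betti2_def kos_H2_def ker_rep_def sub_rep_def kos_d2_kernel[OF M, symmetric]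
  by (simp add: Kos2_def shift_def)

text \<open>Rank-nullity for both differentials, with the rank of \<open>kos_d1\<close> rewritten as
  the dimension of im x + im y, and hence in terms of im x \<inter> im y.\<close>

lemma betti1_dims:
  assumes M: "pfd_rep K M"
  defines "X \<equiv> \<lambda>p. tr_image M (p - (1, 0)) p" and "Y \<equiv> \<lambda>p. tr_image M (p - (0, 1)) p"
  shows "betti1 K M p + vectorspace.dim K (spc M (p - (1, 1))) +
      rank K M (p - (1, 0)) p + rank K M (p - (0, 1)) p =
    vectorspace.dim K (spc M (p - (1, 0))) + vectorspace.dim K (spc M (p - (0, 1))) +
      betti2 K M p + sdim K (spc M p) (X p \<inter> Y p)"
proof -
  interpret V: vectorspace K "spc M p" using pfd_repD(1)[OF M] .
  interpret S: vectorspace K "spc (Kos1 M) p" using vectorspace_Kos1[OF M] .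
  have sub: "subspace K (X p) (spc M p)" "subspace K (Y p) (spc M p)"
    unfolding X_def Y_def by (simp_all add: subspace_tr_image[OF M])
  let ?Z = "{v \<in> carrier (spc (Kos1 M) p). kos_d1 M p v = \<zero>\<^bsub>spc M p\<^esub>}"
  let ?I = "kos_d2 M p ` carrier (spc M (p - (1, 1)))"
  have Z: "subspace K ?Z (spc (Kos1 M) p)"
    by (rule subspace_ker[OF S.vectorspace_axioms V.vectorspace_axioms kos_d1_hom[OF M]])
  have I: "subspace K ?I (spc (Kos1 M) p)"
    by (rule subspace_image[OF pfd_repD(1)[OF M] S.vectorspace_axioms kos_d2_hom[OF M]
          vectorspace.subspace_carrier_self[OF pfd_repD(1)[OF M]]])
  have IZ: "?I \<subseteq> ?Z"
    using kos_d1_d2[OF M, of _ p] hom_closed[OF kos_d2_hom[OF M, of p]] by (intro image_subsetI) simp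
  have "spc (kos_H1 M) p = quot_module (S.vs ?Z) ?I"
    unfolding kos_H1_def quot_rep_def ker_rep_def sub_rep_def Kos2_def shift_def by simp
  then have "betti1 K M p + sdim K (spc (Kos1 M) p) ?I = sdim K (spc (Kos1 M) p) ?Z"
    using dim_quot[OF S.subspace_is_vs[OF Z] S.subspace_fin_dim[OF fin_dim_Kos1[OF M] Z]
        S.nested_subspace[OF Z I IZ]]
    unfolding betti1_def by simp
  moreover have "sdim K (spc M p) (V.subspace_sum (X p) (Y p)) + sdim K (spc (Kos1 M) p) ?Z =
      vectorspace.dim K (spc M (p - (1, 0))) + vectorspace.dim K (spc M (p - (0, 1)))"
    using rank_nullity_subspace[OF S.vectorspace_axioms V.vectorspace_axioms kos_d1_hom[OF M]
        fin_dim_Kos1[OF M] S.subspace_carrier_self] dim_Kos1[OF M] kos_d1_image[OF M, of p]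
    unfolding X_def Y_def by simp
  moreover have "sdim K (spc (Kos1 M) p) ?I + betti2 K M p = vectorspace.dim K (spc M (p - (1, 1)))"
    using rank_nullity_subspace[OF pfd_repD(1)[OF M] S.vectorspace_axioms kos_d2_hom[OF M] pfd_repD(2)[OF M]
        vectorspace.subspace_carrier_self[OF pfd_repD(1)[OF M]]]
    unfolding betti2_dims[OF M] kos_d2_kernel[OF M, symmetric] by simp
  moreover have "sdim K (spc M p) (V.subspace_sum (X p) (Y p)) + sdim K (spc M p) (X p \<inter> Y p) =
      rank K M (p - (1, 0)) p + rank K M (p - (0, 1)) p"
    using V.sdim_sum_Int[OF pfd_repD(2)[OF M] sub] unfolding X_def Y_def by simp
  ultimately show ?thesis unfolding X_def Y_def by linarith
qed

section \<open>Expressing corner counts by ranks in \<open>M\<close>\<close>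

lemma tr_image_C_xy:
  assumes M: "pfd_rep K M" and "q \<le> p"
  shows "tr_image (C_xy M) q p = (\<lambda>v. tr_image M (p - (1, 1)) p +>\<^bsub>spc M p\<^esub> v) ` tr_image M q p"
  unfolding tr_image_def[of "C_xy M"] carrier_Cmon[OF M unit_nonneg(3)] image_image
  using tr_Cmon[OF M unit_nonneg(3) assms(2)] by (auto simp: tr_image_def image_image)

lemma obtain_curve_decomposition:
  assumes "field K" "pfd_rep K N" "is_curve_decomposition K N D"
  obtains f where "curve_decomposition K N D f"
  using assms unfolding is_curve_decomposition_def rep_iso_def curve_decomposition_def by auto

text \<open>All subspaces in \<open>births\<close> lift to subspaces of \<open>M\<close> that
  contain im(xy), so passing from \<open>C_xy M\<close> to \<open>M\<close> adds the rank of xy to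
  each dimension. These additions cancel in the first equation and leave one rank in the
  second.\<close>

lemma births_dims:
  assumes K: "field K" and M: "pfd_rep K M" and D: "is_curve_decomposition K (C_xy M) D"
  defines "X \<equiv> \<lambda>p. tr_image M (p - (1, 0)) p" and "Y \<equiv> \<lambda>p. tr_image M (p - (0, 1)) p"
  shows "corner_sum convex_corners D p + rank K M (p - (1, 0)) p + rank K M (p - (0, 1)) p =
      vectorspace.dim K (spc M p) + sdim K (spc M p) (X p \<inter> Y p)"
    and "corner_sum inner_concave_corners D p + rank K M (p - (1, 1)) p = sdim K (spc M p) (X p \<inter> Y p)"
proof -
  have C: "pfd_rep K (C_xy M)" by (rule pfd_Cmon[OF M unit_nonneg(3)])
  obtain f where "curve_decomposition K (C_xy M) D f"
    using obtain_curve_decomposition[OF K C D] by auto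
  then interpret curve_decomposition K "C_xy M" D f .
  interpret V: vectorspace K "spc M p" using pfd_repD(1)[OF M] .
  let ?U = "tr_image M (p - (1, 1)) p"
  let ?p = "\<lambda>v. ?U +>\<^bsub>spc M p\<^esub> v"
  have U: "subspace K ?U (spc M p)" and X: "subspace K (X p) (spc M p)" and Y: "subspace K (Y p) (spc M p)"
    unfolding X_def Y_def by (simp_all add: subspace_tr_image[OF M])
  have sub: "?U \<subseteq> X p" "?U \<subseteq> Y p"
    unfolding X_def Y_def by (intro tr_image_mono[OF M]; simp)+
  have quot: "sdim K (spc (C_xy M) p) (?p ` W) + sdim K (spc M p) ?U = sdim K (spc M p) W"
    if "subspace K W (spc M p)" "?U \<subseteq> W" for W
    using sdim_quot[OF V.vectorspace_axioms pfd_repD(2)[OF M] U that(1)] that(2)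
    by (simp add: spc_Cmon Int_absorb1)
  \<comment> \<open>Projection commutes with this intersection because both subspaces contain the
    kernel \<open>?U\<close> of the projection.\<close>
  have "?p ` X p \<inter> ?p ` Y p = ?p ` (X p \<inter> Y p)"
  proof (intro equalityI subsetI)
    fix z assume "z \<in> ?p ` X p \<inter> ?p ` Y p"
    then obtain x y where xy: "x \<in> X p" "y \<in> Y p" "z = ?p x" "z = ?p y" by auto
    have c: "x \<in> carrier (spc M p)" "y \<in> carrier (spc M p)"
      using xy V.subspace_carrier[OF X] V.subspace_carrier[OF Y] by auto
    have "x \<ominus>\<^bsub>spc M p\<^esub> y \<in> ?U" using xy V.coset_eq_iff[OF U c] by simp
    then have "(x \<ominus>\<^bsub>spc M p\<^esub> y) \<oplus>\<^bsub>spc M p\<^esub> y \<in> Y p" using sub(2) xy(2) V.subspace_add[OF Y] by auto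
    then have "x \<in> Y p" using c by (simp add: a_minus_def V.a_assoc V.l_neg)
    then show "z \<in> ?p ` (X p \<inter> Y p)" using xy by auto
  qed auto
  moreover have "tr (C_xy M) (p - (1, 0)) p ` carrier (spc (C_xy M) (p - (1, 0))) = ?p ` X p"
    "tr (C_xy M) (p - (0, 1)) p ` carrier (spc (C_xy M) (p - (0, 1))) = ?p ` Y p"
    using tr_image_C_xy[OF M square_le(1)] tr_image_C_xy[OF M square_le(2)]
    unfolding X_def Y_def tr_image_def[of "C_xy M"] by auto
  ultimately have b:
    "corner_sum convex_corners D p + sdim K (spc (C_xy M) p) (?p ` X p) + sdim K (spc (C_xy M) p) (?p ` Y p) =
      vectorspace.dim K (spc (C_xy M) p) + sdim K (spc (C_xy M) p) (?p ` (X p \<inter> Y p))"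
    "corner_sum inner_concave_corners D p = sdim K (spc (C_xy M) p) (?p ` (X p \<inter> Y p))"
    using births[of p] by simp_all
  have "vectorspace.dim K (spc (C_xy M) p) + sdim K (spc M p) ?U = vectorspace.dim K (spc M p)"
    unfolding spc_Cmon using dim_quot[OF V.vectorspace_axioms pfd_repD(2)[OF M] U] .
  moreover have "sdim K (spc (C_xy M) p) (?p ` (X p \<inter> Y p)) + sdim K (spc M p) ?U = sdim K (spc M p) (X p \<inter> Y p)"
    using sub by (intro quot V.subspace_Int X Y) simp
  moreover have "sdim K (spc (C_xy M) p) (?p ` X p) + sdim K (spc M p) ?U = rank K M (p - (1, 0)) p"
    "sdim K (spc (C_xy M) p) (?p ` Y p) + sdim K (spc M p) ?U = rank K M (p - (0, 1)) p"
    using quot[OF X sub(1)] quot[OF Y sub(2)] unfolding X_def Y_def by auto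
  ultimately show "corner_sum convex_corners D p + rank K M (p - (1, 0)) p + rank K M (p - (0, 1)) p =
      vectorspace.dim K (spc M p) + sdim K (spc M p) (X p \<inter> Y p)"
    "corner_sum inner_concave_corners D p + rank K M (p - (1, 1)) p = sdim K (spc M p) (X p \<inter> Y p)"
    using b by linarith+
qed

text \<open>The kernels of x and of y are contained in ker(xy), so computing them inside
  \<open>K_xy M\<close> or inside \<open>M\<close> makes no difference; rank-nullity then converts
  kernels to ranks.\<close>

lemma deaths_dims:
  assumes K: "field K" and M: "pfd_rep K M" and D: "is_curve_decomposition K (K_xy M) D"
  shows "corner_sum inner_convex_corners D p + vectorspace.dim K (spc M (p - (1, 1))) + rank K M (p - (1, 1)) p =
      rank K M (p - (1, 1)) (p - (1, 0)) + rank K M (p - (1, 1)) (p - (0, 1)) + betti2 K M p"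
    and "corner_sum concave_corners D p = betti2 K M p"
proof -
  have N: "pfd_rep K (K_xy M)" by (rule pfd_Kmon[OF M unit_nonneg(3)])
  obtain f where "curve_decomposition K (K_xy M) D f"
    using obtain_curve_decomposition[OF K N D] by auto
  then interpret curve_decomposition K "K_xy M" D f .
  \<comment> \<open>\<open>K_xy M\<close> at p lives in degree p - (1, 1) of \<open>M\<close>, so
    its x-neighbour p + (1, 0) corresponds to p - (0, 1), and its y-neighbour to p - (1, 0).\<close>
  have shift: "p + (1, 0) - (1, 1) = p - (0, 1)" "p + (0, 1) - (1, 1) = p - (1, 0)"
    by (cases p; simp)+
  have mono: "tr_kernel M (p - (1, 1)) q \<subseteq> tr_kernel M (p - (1, 1)) p" if q: "p - (1, 1) \<le> q" "q \<le> p" for q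
  proof
    fix v assume v: "v \<in> tr_kernel M (p - (1, 1)) q"
    then have vc: "v \<in> carrier (spc M (p - (1, 1)))" "tr M (p - (1, 1)) q v = \<zero>\<^bsub>spc M q\<^esub>"
      unfolding tr_kernel_def by auto
    have "tr M (p - (1, 1)) p v = tr M q p \<zero>\<^bsub>spc M q\<^esub>"
      using pfd_repD(5)[OF M q vc(1)] vc(2) by simp
    then show "v \<in> tr_kernel M (p - (1, 1)) p"
      using hom_zero[OF pfd_repD(1)[OF M] pfd_repD(1)[OF M] pfd_repD(3)[OF M q(2)]] vc(1)
      unfolding tr_kernel_def by simp
  qed
  have "{v \<in> carrier (spc (K_xy M) p). tr (K_xy M) p (p + (1, 0)) v = \<zero>\<^bsub>spc (K_xy M) (p + (1, 0))\<^esub>} =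
      tr_kernel M (p - (1, 1)) (p - (0, 1))"
    "{v \<in> carrier (spc (K_xy M) p). tr (K_xy M) p (p + (0, 1)) v = \<zero>\<^bsub>spc (K_xy M) (p + (0, 1))\<^esub>} =
      tr_kernel M (p - (1, 1)) (p - (1, 0))"
    unfolding spc_Kmon tr_Kmon shift
    using mono[of "p - (0, 1)"] mono[of "p - (1, 0)"] by (auto simp: tr_kernel_def)
  note d = deaths[of p, unfolded this]
  show "corner_sum concave_corners D p = betti2 K M p"
    using d(2) unfolding betti2_dims[OF M] by (simp add: spc_Kmon Int_commute)
  moreover have "rank K M (p - (1, 1)) q + sdim K (spc M (p - (1, 1))) (tr_kernel M (p - (1, 1)) q) =
      vectorspace.dim K (spc M (p - (1, 1)))" if "p - (1, 1) \<le> q" for q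
    by (rule rank_kernel[OF M that])
  from this[of "p - (1, 0)"] this[of "p - (0, 1)"] this[of p]
  have "rank K M (p - (1, 1)) (p - (1, 0)) + sdim K (spc M (p - (1, 1))) (tr_kernel M (p - (1, 1)) (p - (1, 0))) =
      vectorspace.dim K (spc M (p - (1, 1)))"
    "rank K M (p - (1, 1)) (p - (0, 1)) + sdim K (spc M (p - (1, 1))) (tr_kernel M (p - (1, 1)) (p - (0, 1))) =
      vectorspace.dim K (spc M (p - (1, 1)))"
    "rank K M (p - (1, 1)) p + sdim K (spc M (p - (1, 1))) (tr_kernel M (p - (1, 1)) p) =
      vectorspace.dim K (spc M (p - (1, 1)))"
    by simp_all
  ultimately show "corner_sum inner_convex_corners D p + vectorspace.dim K (spc M (p - (1, 1))) + rank K M (p - (1, 1)) p =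
      rank K M (p - (1, 1)) (p - (1, 0)) + rank K M (p - (1, 1)) (p - (0, 1)) + betti2 K M p"
    using d by (simp add: spc_Kmon)
qed

text \<open>Once every term is expressed through the commutative square ending at \<open>p\<close>,
  the formula for \<open>betti1\<close> is a linear identity: the ranks of the two maps out of p -
  (1, 1) cancel between the inner convex corners and TL and BR, and the rank of the diagonal map
  occurs twice with each sign.\<close>

theorem betti_formulas:
  assumes K: "field K" and M: "pfd_rep K M"
    and C: "is_curve_decomposition K (C_xy M) C" and D: "is_curve_decomposition K (K_xy M) D"
  shows "betti0 K M p = corner_sum convex_corners C p"
    and "betti1 K M p = corner_sum inner_convex_corners D p + corner_sum inner_concave_corners C p
      + dec_points K (TL M) p + dec_points K (BR M) p"
    and "betti2 K M p = corner_sum concave_corners D p"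
proof -
  show "betti0 K M p = corner_sum convex_corners C p"
    using betti0_dims[OF M, of p] births_dims(1)[OF K M C, of p] by linarith
  show "betti2 K M p = corner_sum concave_corners D p"
    using deaths_dims(2)[OF K M D] by simp
  have minus: "p - (0, 1) - (1, 0) = p - (1, 1)" "p - (1, 0) - (0, 1) = p - (1, 1)"
    by (cases p; simp)+
  have "dec_points K (TL M) p + rank K M (p - (1, 1)) (p - (0, 1)) + rank K M (p - (0, 1)) p =
      vectorspace.dim K (spc M (p - (0, 1))) + rank K M (p - (1, 1)) p"
    "dec_points K (BR M) p + rank K M (p - (1, 1)) (p - (1, 0)) + rank K M (p - (1, 0)) p =
      vectorspace.dim K (spc M (p - (1, 0))) + rank K M (p - (1, 1)) p"
    unfolding TL_eq BR_eq
    using dim_corner_rep[OF M unit_nonneg(1,2), of p, unfolded minus]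
      dim_corner_rep[OF M unit_nonneg(2,1), of p, unfolded minus] by simp_all
  then show "betti1 K M p = corner_sum inner_convex_corners D p + corner_sum inner_concave_corners C p
      + dec_points K (TL M) p + dec_points K (BR M) p"
    using betti1_dims[OF M, of p] births_dims(2)[OF K M C, of p] deaths_dims(1)[OF K M D, of p] by linarith
qed

text \<open>By \<open>dim_corner_rep\<close> the left-hand side is a combination of dimensions and
  ranks, and these are counted by the same curves for \<open>N\<close> and
  \<open>N'\<close>.\<close>

lemma dec_points_corner_rep_cong:
  assumes K: "field K" and N: "pfd_rep K N" "is_curve_decomposition K N D"
    and N': "pfd_rep K N'" "is_curve_decomposition K N' D" and ab: "0 \<le> a" "0 \<le> b"
  shows "dec_points K (corner_rep a b N) p = dec_points K (corner_rep a b N') p"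
proof -
  obtain f where "curve_decomposition K N D f"
    using obtain_curve_decomposition[OF K N] by auto
  then interpret N: curve_decomposition K N D f .
  obtain g where "curve_decomposition K N' D g"
    using obtain_curve_decomposition[OF K N'] by auto
  then interpret N': curve_decomposition K N' D g .
  have "rank K N q r = rank K N' q r" if "q \<le> r" for q r
    using N.rank_eq_card[OF that] N'.rank_eq_card[OF that] unfolding tr_image_def by simp
  moreover have "vectorspace.dim K (spc N q) = vectorspace.dim K (spc N' q)" for q
    unfolding N.dim_eq_card N'.dim_eq_card N.through_def N'.through_def ..
  moreover have "p - b - a \<le> p - b" "p - b \<le> p" "p - b - a \<le> p"
    using minus_le(1)[OF ab(1)] minus_le(1)[OF ab(2)] order_trans by blast+
  ultimately show ?thesis
    using dim_corner_rep[OF N(1) ab, of p] dim_corner_rep[OF N'(1) ab, of p] by simp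
qed

lemma dec_points_C_xy:
  assumes M: "pfd_rep K M" and ab: "0 \<le> a" "0 \<le> b" "a + b = (1, 1)"
  shows "dec_points K (corner_rep a b M) p = dec_points K (corner_rep a b (C_xy M)) p"
proof -
  have C: "pfd_rep K (C_xy M)" by (rule pfd_Cmon[OF M unit_nonneg(3)])
  obtain f where f: "f \<in> rep_hom K (corner_rep a b M) (corner_rep a b (C_xy M))"
    "\<And>p. bij_betw (f p) (carrier (spc (corner_rep a b M) p)) (carrier (spc (corner_rep a b (C_xy M)) p))"
    using corner_rep_C_xy[OF M ab] unfolding rep_iso_def by auto
  have "f p \<in> module_hom K (spc (corner_rep a b M) p) (spc (corner_rep a b (C_xy M)) p)"
    using f(1) unfolding rep_hom_def by simp
  then show ?thesis
    unfolding dec_points_def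
    using dim_eq_of_bij[OF vectorspace_corner_rep[OF M ab(1,2)] vectorspace_corner_rep[OF C ab(1,2)] _
        fin_dim_corner_rep[OF M ab(1,2)] f(2)] by simp
qed

lemma rep_iso_trans:
  assumes "rep_iso K L M" "rep_iso K M N"
  shows "rep_iso K L N"
proof -
  obtain f g where f: "f \<in> rep_hom K L M" "\<And>p. bij_betw (f p) (carrier (spc L p)) (carrier (spc M p))"
    and g: "g \<in> rep_hom K M N" "\<And>p. bij_betw (g p) (carrier (spc M p)) (carrier (spc N p))"
    using assms unfolding rep_iso_def by auto
  let ?h = "\<lambda>p v. g p (f p v)"
  have fh: "f p \<in> module_hom K (spc L p) (spc M p)" for p using f(1) unfolding rep_hom_def by simp
  have gh: "g p \<in> module_hom K (spc M p) (spc N p)" for p using g(1) unfolding rep_hom_def by simp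
  have "?h q (tr L p q v) = tr N p q (?h p v)" if "p \<le> q" "v \<in> carrier (spc L p)" for p q v
    using f(1) g(1) that hom_closed[OF fh that(2)] unfolding rep_hom_def by simp
  then have "?h \<in> rep_hom K L N"
    unfolding rep_hom_def using module_hom_comp[OF fh gh] by simp
  moreover have "bij_betw (?h p) (carrier (spc L p)) (carrier (spc N p))" for p
    using bij_betw_trans[OF f(2) g(2)] by (simp add: comp_def)
  ultimately show ?thesis unfolding rep_iso_def by (intro bexI[of _ ?h]) simp_all
qed

lemma rep_iso_sym:
  assumes M: "pfd_rep K M" and "rep_iso K M N"
  shows "rep_iso K N M"
proof -
  obtain f where f: "f \<in> rep_hom K M N" "\<And>p. bij_betw (f p) (carrier (spc M p)) (carrier (spc N p))"
    using assms unfolding rep_iso_def by auto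
  note self = vectorspace.subspace_carrier_self[OF pfd_repD(1)[OF M]]
  show ?thesis
    using vectorspace.subspace_add[OF pfd_repD(1)[OF M] self] vectorspace.subspace_smult[OF pfd_repD(1)[OF M] self]
      tr_closed[OF M] by (intro rep_iso_symI[OF _ _ _ f])
qed

text \<open>Isomorphic representations have exactly the same decompositions, so the choice operator
  receives the same predicate and returns the same multiset.\<close>

lemma dec_cong:
  assumes "pfd_rep K N" "rep_iso K N N'"
  shows "dec K N = dec K N'"
proof -
  have "is_curve_decomposition K N D \<longleftrightarrow> is_curve_decomposition K N' D" for D
    unfolding is_curve_decomposition_def
    using rep_iso_trans[OF assms(2)] rep_iso_trans[OF rep_iso_sym[OF assms]] by blast
  then have "is_curve_decomposition K N = is_curve_decomposition K N'" by (rule ext)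
  then show ?thesis unfolding dec_def by simp
qed

text \<open>The terms TL and BR are defined from \<open>M\<close> itself. They are first moved to
  \<open>C_xy M\<close> by \<open>dec_points_C_xy\<close>, where the common decomposition determines
  them.\<close>

lemma betti_cong:
  fixes K :: "'k ring" and M :: "('k, 'v) rep" and M' :: "('k, 'w) rep"
  assumes K: "field K" and M: "pfd_rep K M" and M': "pfd_rep K M'"
    and eq: "dec K (C_xy M) = dec K (C_xy M')" "dec K (K_xy M) = dec K (K_xy M')"
  shows "betti0 K M = betti0 K M' \<and> betti1 K M = betti1 K M' \<and> betti2 K M = betti2 K M'"
proof -
  have pfd: "pfd_rep K (C_xy M)" "pfd_rep K (C_xy M')" "pfd_rep K (K_xy M)" "pfd_rep K (K_xy M')"
    using pfd_Cmon[OF M unit_nonneg(3)] pfd_Cmon[OF M' unit_nonneg(3)]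
      pfd_Kmon[OF M unit_nonneg(3)] pfd_Kmon[OF M' unit_nonneg(3)] by auto
  note C = dec_is_curve_decomposition[OF K pfd(1) xy_zero_C[OF M]]
    and C' = dec_is_curve_decomposition[OF K pfd(2) xy_zero_C[OF M'], folded eq]
    and D = dec_is_curve_decomposition[OF K pfd(3) xy_zero_K[OF M]]
    and D' = dec_is_curve_decomposition[OF K pfd(4) xy_zero_K[OF M'], folded eq]
  have "dec_points K (TL M) p = dec_points K (TL M') p" "dec_points K (BR M) p = dec_points K (BR M') p" for p
    unfolding TL_eq BR_eq
    using dec_points_C_xy[OF M unit_nonneg(1,2)] dec_points_C_xy[OF M' unit_nonneg(1,2)]
      dec_points_C_xy[OF M unit_nonneg(2,1)] dec_points_C_xy[OF M' unit_nonneg(2,1)]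
      dec_points_corner_rep_cong[OF K pfd(1) C pfd(2) C' unit_nonneg(1,2)]
      dec_points_corner_rep_cong[OF K pfd(1) C pfd(2) C' unit_nonneg(2,1)]
    by simp_all
  then show ?thesis
    using betti_formulas[OF K M C D] betti_formulas[OF K M' C' D'] by (simp add: fun_eq_iff)
qed

theorem theoremD:
  fixes K :: "'k ring" and M :: "('k, 'v) rep"
  assumes "field K" and "pfd_rep K M"
  shows
    "(\<forall>p. betti0 K M p = corner_sum convex_corners (dec K (C_xy M)) p) \<and>
     (\<forall>p. betti1 K M p =
        corner_sum inner_convex_corners (dec K (K_xy M)) p
        + corner_sum inner_concave_corners (dec K (C_xy M)) p
        + dec_points K (TL M) p + dec_points K (BR M) p) \<and>
     (\<forall>p. betti2 K M p = corner_sum concave_corners (dec K (K_xy M)) p) \<and>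
     rep_iso K (TL M) (TL (C_xy M)) \<and>
     rep_iso K (BR M) (BR (C_xy M)) \<and>
     (\<forall>M' :: ('k, 'w) rep. pfd_rep K M' \<and>
        rep_iso K (C_xy M) (C_xy M') \<and> rep_iso K (K_xy M) (K_xy M') \<longrightarrow>
        betti0 K M = betti0 K M' \<and> betti1 K M = betti1 K M' \<and> betti2 K M = betti2 K M') \<and>
     (\<forall>M' :: ('k, 'w) rep. pfd_rep K M' \<and>
        dec K (C_xy M) = dec K (C_xy M') \<and> dec K (K_xy M) = dec K (K_xy M') \<longrightarrow>
        betti0 K M = betti0 K M' \<and> betti1 K M = betti1 K M' \<and> betti2 K M = betti2 K M')"
proof -
  note K = assms(1) and M = assms(2)
  have pfd: "pfd_rep K (C_xy M)" "pfd_rep K (K_xy M)"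
    using pfd_Cmon[OF M unit_nonneg(3)] pfd_Kmon[OF M unit_nonneg(3)] by auto
  note betti = betti_formulas[OF K M dec_is_curve_decomposition[OF K pfd(1) xy_zero_C[OF M]]
      dec_is_curve_decomposition[OF K pfd(2) xy_zero_K[OF M]]]
  have "rep_iso K (TL M) (TL (C_xy M))" "rep_iso K (BR M) (BR (C_xy M))"
    unfolding TL_eq BR_eq by (intro corner_rep_C_xy[OF M]; simp)+
  moreover have "betti0 K M = betti0 K M' \<and> betti1 K M = betti1 K M' \<and> betti2 K M = betti2 K M'"
    if "pfd_rep K M' \<and> dec K (C_xy M) = dec K (C_xy M') \<and> dec K (K_xy M) = dec K (K_xy M')"
    for M' :: "('k, 'w) rep"
    using that by (intro betti_cong[OF K M]) auto
  moreover have "betti0 K M = betti0 K M' \<and> betti1 K M = betti1 K M' \<and> betti2 K M = betti2 K M'"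
    if "pfd_rep K M' \<and> rep_iso K (C_xy M) (C_xy M') \<and> rep_iso K (K_xy M) (K_xy M')"
    for M' :: "('k, 'w) rep"
    using that by (intro betti_cong[OF K M] dec_cong pfd) auto
  ultimately show ?thesis using betti by simp
qed

end
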